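(* Let $\Gamma$ be a non-elementary hyperbolic group, equipped with the word-length $|\cdot|$ given by a finite symmetric generating set $S$. For $k\ge 0$ let $\sigma_k=\sum_{|\gamma|=k}\gamma\in\mathbb{C}\Gamma$, and let $\lambda$ denote the left-regular representation on $\ell^2\Gamma$. Then the following hold, where the constants implicit in $\asymp$ depend only on $\Gamma$ and $S$. (i) For the spherical element $\sigma_n$, we have $\|\lambda(\sigma_n)\|\asymp (n+1)\|\sigma_n\|_2$. In particular, the inequality "$\|\lambda(a)\|\preccurlyeq (n+1)\|a\|_2$ whenever $a\in\mathbb{C}\Gamma$ is supported on the sphere of radius $n$" is essentially sharp. (ii) For the ball element $\beta_n=\sum_{k\le n}\sigma_k$, we have $\|\lambda(\beta_n)\|\asymp (n+1)\|\beta_n\|_2$. (iii) For the radial element $a=\sum_{k\le n}a_k\sigma_k$, where $a_k\ge 0$ is such that $\|a_k\sigma_k\|_2=k+1$, we have $\|\lambda(a)\|\asymp (n+1)^{3/2}\|a\|_2$. In particular, the inequality "$\|\lambda(a)\|\preccurlyeq (n+1)^{3/2}\|a\|_2$ whenever $a\in\mathbb{C}\Gamma$ is supported on the ball of radius $n$" is essentially sharp. (iv) For the radial element $a=\sum_{k\le n}a_k\sigma_k$, where $a_k\ge 0$ is such that $\|a_k\sigma_k\|_2=(k+1)^{-2}$, we have $\|\lambda(a)\|\asymp \log(n+1)\,\|a\|_{2,3/2}$. In particular, the inequality "$\|\lambda(a)\|\preccurlyeq\|a\|_{2,s}$ for $s>3/2$" is essentially sharp.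
   Context: $\mathbb{C}\Gamma$ is the complex group algebra, i.e. finitely supported functions $a:\Gamma\to\mathbb{C}$, written $a=\sum_\gamma a(\gamma)\gamma$. $\|a\|_2=\big(\sum_\gamma|a(\gamma)|^2\big)^{1/2}$, and $\|a\|_{2,s}=\big(\sum_\gamma(|\gamma|+1)^{2s}|a(\gamma)|^2\big)^{1/2}$ is the $s$-weighted $\ell^2$-norm. The left-regular representation is extended linearly to $\mathbb{C}\Gamma$, so $\lambda(a)$ is left convolution by $a$ on $\ell^2\Gamma$, and $\|\lambda(a)\|$ is its operator norm. The sphere of radius $n$ is $\{\gamma\in\Gamma:|\gamma|=n\}$ and the ball of radius $n$ is $\{\gamma\in\Gamma:|\gamma|\le n\}$. $A\preccurlyeq B$ means $A\le C\,B$ for a constant $C>0$ depending only on $\Gamma$ and $S$ (and on $s$, for the weighted inequality), and $A\asymp B$ means $A\preccurlyeq B$ and $B\preccurlyeq A$. The three quoted inequalities are known forms of Haagerup's inequality, valid for hyperbolic groups. "Essentially sharp" is used informally: for the sphere (respectively ball) inequality, the power $n+1$ (respectively $(n+1)^{3/2}$) is attained, up to a multiplicative constant, by the indicated elements; for the weighted inequality, the condition $s>3/2$ cannot be relaxed to include $s=3/2$.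
   Formalization: In (iv) the factor log(n+1) is replaced by its square root and n≥1 is required: as printed the claim fails, since ‖a‖_{2,3/2} is the square root of H_{n+1}=1+1/2+...+1/(n+1) and ‖λ(a)‖≍H_{n+1}, while at n=0 the right side is 0 but ‖λ(a)‖=1. *)

theory Defs
  imports "HOL-Analysis.Analysis" "HOL-Algebra.Generated_Groups"
begin

section \<open>Word metrics and hyperbolic groups\<close>

definition finite_symmetric_generating_set :: "('a, 'b) monoid_scheme \<Rightarrow> 'a set \<Rightarrow> bool" where
  "finite_symmetric_generating_set G S \<longleftrightarrow>
     finite S \<and> S \<subseteq> carrier G \<and> (\<forall>x\<in>S. inv\<^bsub>G\<^esub> x \<in> S) \<and> generate G S = carrier G"

definition word_length :: "('a, 'b) monoid_scheme \<Rightarrow> 'a set \<Rightarrow> 'a \<Rightarrow> nat" where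
  "word_length G S x =
     (LEAST n. \<exists>w. length w = n \<and> set w \<subseteq> S \<and> foldr (\<otimes>\<^bsub>G\<^esub>) w \<one>\<^bsub>G\<^esub> = x)"

definition word_dist :: "('a, 'b) monoid_scheme \<Rightarrow> 'a set \<Rightarrow> 'a \<Rightarrow> 'a \<Rightarrow> real" where
  "word_dist G S x y = real (word_length G S (inv\<^bsub>G\<^esub> x \<otimes>\<^bsub>G\<^esub> y))"

definition word_sphere :: "('a, 'b) monoid_scheme \<Rightarrow> 'a set \<Rightarrow> nat \<Rightarrow> 'a set" where
  "word_sphere G S n = {x \<in> carrier G. word_length G S x = n}"

definition word_ball :: "('a, 'b) monoid_scheme \<Rightarrow> 'a set \<Rightarrow> nat \<Rightarrow> 'a set" where
  "word_ball G S n = {x \<in> carrier G. word_length G S x \<le> n}"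

definition gromov_product :: "('a \<Rightarrow> 'a \<Rightarrow> real) \<Rightarrow> 'a \<Rightarrow> 'a \<Rightarrow> 'a \<Rightarrow> real" where
  "gromov_product d p x y = (d p x + d p y - d x y) / 2"

definition gromov_hyperbolic :: "'a set \<Rightarrow> ('a \<Rightarrow> 'a \<Rightarrow> real) \<Rightarrow> bool" where
  "gromov_hyperbolic M d \<longleftrightarrow> (\<exists>\<delta>\<ge>0. \<forall>p\<in>M. \<forall>x\<in>M. \<forall>y\<in>M. \<forall>z\<in>M.
     gromov_product d p x z \<ge> min (gromov_product d p x y) (gromov_product d p y z) - \<delta>)"

text \<open>
  Hyperbolicity is a property of the group alone: it is required for the word metric of some
  finite symmetric generating set, not necessarily the one that defines the norms below.
\<close>
definition hyperbolic_group :: "('a, 'b) monoid_scheme \<Rightarrow> bool" where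
  "hyperbolic_group G \<longleftrightarrow> group G \<and>
     (\<exists>T. finite_symmetric_generating_set G T \<and> gromov_hyperbolic (carrier G) (word_dist G T))"

text \<open>
  Elementary means virtually cyclic; this includes the finite groups, through the trivial subgroup.
\<close>
definition elementary_group :: "('a, 'b) monoid_scheme \<Rightarrow> bool" where
  "elementary_group G \<longleftrightarrow> (\<exists>x\<in>carrier G. finite (rcosets\<^bsub>G\<^esub> (generate G {x})))"


section \<open>The group algebra and the left regular representation\<close>

text \<open>
  Functions on the group are total functions on the underlying type that vanish off the carrier.
\<close>
definition group_algebra_on :: "('a, 'b) monoid_scheme \<Rightarrow> 'a set \<Rightarrow> ('a \<Rightarrow> complex) set" where
  "group_algebra_on G A = {a. finite {x. a x \<noteq> 0} \<and> {x. a x \<noteq> 0} \<subseteq> carrier G \<inter> A}"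

abbreviation group_algebra :: "('a, 'b) monoid_scheme \<Rightarrow> ('a \<Rightarrow> complex) set" where
  "group_algebra G \<equiv> group_algebra_on G (carrier G)"

definition l2_space :: "('a, 'b) monoid_scheme \<Rightarrow> ('a \<Rightarrow> complex) set" where
  "l2_space G = {f. {x. f x \<noteq> 0} \<subseteq> carrier G \<and> (\<lambda>x. (cmod (f x))\<^sup>2) summable_on carrier G}"

definition l2_norm :: "('a, 'b) monoid_scheme \<Rightarrow> ('a \<Rightarrow> complex) \<Rightarrow> real" where
  "l2_norm G f = sqrt (\<Sum>\<^sub>\<infinity>x\<in>carrier G. (cmod (f x))\<^sup>2)"

definition weighted_l2_norm ::
    "('a, 'b) monoid_scheme \<Rightarrow> 'a set \<Rightarrow> real \<Rightarrow> ('a \<Rightarrow> complex) \<Rightarrow> real" where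
  "weighted_l2_norm G S s f =
     sqrt (\<Sum>\<^sub>\<infinity>x\<in>carrier G. (real (word_length G S x) + 1) powr (2 * s) * (cmod (f x))\<^sup>2)"

definition left_translation ::
    "('a, 'b) monoid_scheme \<Rightarrow> 'a \<Rightarrow> ('a \<Rightarrow> complex) \<Rightarrow> 'a \<Rightarrow> complex" where
  "left_translation G g f = (\<lambda>x. if x \<in> carrier G then f (inv\<^bsub>G\<^esub> g \<otimes>\<^bsub>G\<^esub> x) else 0)"

definition left_regular ::
    "('a, 'b) monoid_scheme \<Rightarrow> ('a \<Rightarrow> complex) \<Rightarrow> ('a \<Rightarrow> complex) \<Rightarrow> 'a \<Rightarrow> complex" where
  "left_regular G a f = (\<lambda>x. \<Sum>g | a g \<noteq> 0. a g * left_translation G g f x)"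

definition l2_opnorm ::
    "('a, 'b) monoid_scheme \<Rightarrow> (('a \<Rightarrow> complex) \<Rightarrow> 'a \<Rightarrow> complex) \<Rightarrow> real" where
  "l2_opnorm G T = Sup {l2_norm G (T f) | f. f \<in> l2_space G \<and> l2_norm G f \<le> 1}"

abbreviation regular_norm :: "('a, 'b) monoid_scheme \<Rightarrow> ('a \<Rightarrow> complex) \<Rightarrow> real" where
  "regular_norm G a \<equiv> l2_opnorm G (left_regular G a)"


section \<open>Radial elements\<close>

definition sph :: "('a, 'b) monoid_scheme \<Rightarrow> 'a set \<Rightarrow> nat \<Rightarrow> 'a \<Rightarrow> complex" where
  "sph G S k = indicator (word_sphere G S k)"

definition radial ::
    "('a, 'b) monoid_scheme \<Rightarrow> 'a set \<Rightarrow> nat \<Rightarrow> (nat \<Rightarrow> real) \<Rightarrow> 'a \<Rightarrow> complex" where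
  "radial G S n c = (\<lambda>x. \<Sum>k\<le>n. complex_of_real (c k) * sph G S k x)"

definition ball_element :: "('a, 'b) monoid_scheme \<Rightarrow> 'a set \<Rightarrow> nat \<Rightarrow> 'a \<Rightarrow> complex" where
  "ball_element G S n = (\<lambda>x. \<Sum>k\<le>n. sph G S k x)"

text \<open>
  The coefficients \<open>c 0, \<dots>, c n\<close> are nonnegative and the \<open>k\<close>-th spherical part of
  \<open>radial G S n c\<close> has \<open>\<ell>\<^sup>2\<close>-norm \<open>h k\<close>.

  For \<open>h k = (k + 1) powr -2\<close> the square of the weighted norm with \<open>s = 3/2\<close> is
  \<open>\<Sum>k\<le>n. (k + 1)^3 * (k + 1) powr -4\<close>, the harmonic number \<open>H(n + 1)\<close>, and by Haagerup's
  inequality on spheres the operator norm is at most a constant times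
  \<open>\<Sum>k\<le>n. (k + 1) * (k + 1) powr -2 = H(n + 1)\<close>. Hence the factor between the two norms has
  order \<open>sqrt (ln (n + 1))\<close>; a comparison with the factor \<open>ln (n + 1)\<close> itself, as one also
  finds it written, fails for these norms. For \<open>n = 0\<close> either factor vanishes while the operator
  norm is 1, so the comparison is made for \<open>n \<ge> 1\<close>.
\<close>
definition radial_profile ::
    "('a, 'b) monoid_scheme \<Rightarrow> 'a set \<Rightarrow> (nat \<Rightarrow> real) \<Rightarrow> nat \<Rightarrow> (nat \<Rightarrow> real) \<Rightarrow> bool" where
  "radial_profile G S h n c \<longleftrightarrow>
     (\<forall>k\<le>n. c k \<ge> 0 \<and> l2_norm G (\<lambda>x. complex_of_real (c k) * sph G S k x) = h k)"


section \<open>Comparison up to constants\<close>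

text \<open>One constant serves for all indices in \<open>I\<close>.\<close>

definition dominated_on :: "'i set \<Rightarrow> ('i \<Rightarrow> real) \<Rightarrow> ('i \<Rightarrow> real) \<Rightarrow> bool" where
  "dominated_on I f g \<longleftrightarrow> (\<exists>C>0. \<forall>x\<in>I. f x \<le> C * g x)"

definition comparable_on :: "'i set \<Rightarrow> ('i \<Rightarrow> real) \<Rightarrow> ('i \<Rightarrow> real) \<Rightarrow> bool" where
  "comparable_on I f g \<longleftrightarrow> dominated_on I f g \<and> dominated_on I g f"

text \<open>
  The factor \<open>h\<close> in an inequality \<open>regular_norm G a \<le> C * h n * l2_norm G a\<close>, for \<open>a\<close>
  supported on \<open>A n\<close>, is attained up to a multiplicative constant by nonzero elements of
  the given families \<open>B n\<close>.
\<close>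
definition factor_attained ::
    "('a, 'b) monoid_scheme \<Rightarrow> (nat \<Rightarrow> 'a set) \<Rightarrow> (nat \<Rightarrow> real) \<Rightarrow> (nat \<Rightarrow> ('a \<Rightarrow> complex) set) \<Rightarrow> bool"
  where
  "factor_attained G A h B \<longleftrightarrow> (\<exists>C>0. \<forall>n. \<exists>b\<in>B n.
     b \<in> group_algebra_on G (A n) \<and> l2_norm G b > 0 \<and> h n * l2_norm G b \<le> C * regular_norm G b)"

end

theory Submission
  imports Defs "HOL-Real_Asymp.Real_Asymp"
begin

text \<open>
  For nonnegative coefficients, \<open>\<parallel>\<lambda>(\<Sum>k. c k \<sigma>\<^sub>k)\<parallel>\<close> is comparable to \<open>\<Sum>k. (k + 1) c k \<parallel>\<sigma>\<^sub>k\<parallel>\<^sub>2\<close>; given the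
  exponential growth of spheres, \<open>|S\<^sub>n| \<asymp> q ^ (2 n)\<close>, every assertion is a numerical consequence.

  The upper bound is Haagerup's inequality on spheres. For the lower bound one tests with
  \<open>f x = q ^ (- |x|)\<close> on a ball of radius \<open>3 n\<close>: in \<open>(\<sigma>\<^sub>k * f) x\<close> the elements of \<open>S\<^sub>k\<close> that cancel \<open>j\<close>
  letters of \<open>x\<close> contribute about \<open>q ^ k f x\<close> for each \<open>j \<le> k\<close>. Both this count and the growth rest
  on one spreading property: some finite set \<open>F\<close> contains, for any \<open>g\<close> and \<open>h\<close>, an \<open>f\<close> with
  \<open>|g f h| \<ge> |g| + |h| - C\<close>. If spreading fails, arbitrarily large balls act almost by translations
  on a long geodesic; then the group has linear growth and an element of infinite order, and is
  virtually cyclic.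
\<close>

section \<open>Hyperbolicity under change of generators\<close>

text \<open>Hyperbolicity is known for one generating set and the norms use another, but the
  four-point inequality is not visibly invariant under a bi-Lipschitz change of metric; hence the
  opening detour through stability of quasi-geodesics. Spreading takes the place of boundary
  dynamics, free subgroups and conformal measures. It makes sphere sizes supermultiplicative up to a
  constant, which fixes them up to a bounded factor and not merely a subexponential one; this
  precision is needed because the claims compare powers of n + 1. The decay q^(-|x|) of the test
  function is the critical one: every sphere carries about the same mass, so that the ball of radius
  3 n and the shell between n and 2 n have comparable norms, and the shell is where convolution can
  be computed without boundary effects.\<close>

locale graph_metric =
  fixes M :: "'a set" and d :: "'a \<Rightarrow> 'a \<Rightarrow> nat"
  assumes zero: "\<lbrakk>x \<in> M; y \<in> M\<rbrakk> \<Longrightarrow> d x y = 0 \<longleftrightarrow> x = y"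
    and sym: "\<lbrakk>x \<in> M; y \<in> M\<rbrakk> \<Longrightarrow> d x y = d y x"
    and tri: "\<lbrakk>x \<in> M; y \<in> M; z \<in> M\<rbrakk> \<Longrightarrow> d x z \<le> d x y + d y z"
    and geod: "\<lbrakk>x \<in> M; y \<in> M; k \<le> d x y\<rbrakk> \<Longrightarrow> \<exists>z\<in>M. d x z = k \<and> d z y = d x y - k"

text \<open>Twice the Gromov product, which keeps all quantities integral.\<close>
definition gp :: "('a \<Rightarrow> 'a \<Rightarrow> nat) \<Rightarrow> 'a \<Rightarrow> 'a \<Rightarrow> 'a \<Rightarrow> int" where
  "gp d p x y = int (d p x) + int (d p y) - int (d x y)"

text \<open>Since \<open>gp\<close> is twice the Gromov product, \<open>\<Delta>\<close> stands for
  twice the usual hyperbolicity constant, rounded to an integer.\<close>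

definition four_point :: "'a set \<Rightarrow> ('a \<Rightarrow> 'a \<Rightarrow> nat) \<Rightarrow> nat \<Rightarrow> bool" where
  "four_point M d \<Delta> \<longleftrightarrow> (\<forall>p\<in>M. \<forall>x\<in>M. \<forall>y\<in>M. \<forall>z\<in>M.
     min (gp d p x y) (gp d p y z) \<le> gp d p x z + int \<Delta>)"

lemma four_pointD:
  assumes "four_point M d \<Delta>" "p \<in> M" "x \<in> M" "y \<in> M" "z \<in> M"
  shows "min (gp d p x y) (gp d p y z) \<le> gp d p x z + int \<Delta>"
  using assms unfolding four_point_def by blast

definition geodesic_path :: "'a set \<Rightarrow> ('a \<Rightarrow> 'a \<Rightarrow> nat) \<Rightarrow> 'a \<Rightarrow> 'a \<Rightarrow> (nat \<Rightarrow> 'a) \<Rightarrow> bool" where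
  "geodesic_path M d p q \<gamma> \<longleftrightarrow> \<gamma> 0 = p \<and> \<gamma> (d p q) = q \<and> (\<forall>i\<le>d p q. \<gamma> i \<in> M) \<and>
     (\<forall>i j. i \<le> j \<longrightarrow> j \<le> d p q \<longrightarrow> d (\<gamma> i) (\<gamma> j) = j - i)"

lemma geodesic_pathD:
  assumes "geodesic_path M d p q \<gamma>"
  shows "\<gamma> 0 = p" "\<gamma> (d p q) = q" "i \<le> d p q \<Longrightarrow> \<gamma> i \<in> M"
    "\<lbrakk>i \<le> j; j \<le> d p q\<rbrakk> \<Longrightarrow> d (\<gamma> i) (\<gamma> j) = j - i"
  using assms unfolding geodesic_path_def by blast+

context graph_metric
begin

lemma geodesic_path_exists:
  assumes "p \<in> M" "q \<in> M"
  shows "\<exists>\<gamma>. geodesic_path M d p q \<gamma>"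
  using assms
proof (induction "d p q" arbitrary: q)
  case 0
  then have "p = q" "d q q = 0" using zero by metis+
  then show ?case
    using 0 by (intro exI[of _ "\<lambda>i. p"]) (auto simp: geodesic_path_def)
next
  case (Suc n)
  obtain z where z: "z \<in> M" "d p z = n" "d z q = 1"
    using geod[of p q n] Suc by auto
  obtain \<gamma> where \<gamma>: "geodesic_path M d p z \<gamma>" using Suc z by metis
  define \<eta> where "\<eta> i = (if i \<le> n then \<gamma> i else q)" for i
  have "d (\<gamma> i) q = Suc n - i" if "i \<le> n" for i
  proof -
    have i: "\<gamma> i \<in> M" "d p (\<gamma> i) = i" "d (\<gamma> i) z = n - i"
      using geodesic_pathD[OF \<gamma>] that z(2) by (metis diff_zero le_refl zero_le)+
    then show ?thesis
      using tri[of p "\<gamma> i" q] tri[of "\<gamma> i" z q] z Suc that by auto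
  qed
  moreover have "d q q = 0" using zero Suc by auto
  ultimately have "geodesic_path M d p q \<eta>"
    using \<gamma> z Suc.prems unfolding geodesic_path_def \<eta>_def Suc(2)[symmetric]
    by (auto simp: le_Suc_eq)
  then show ?case by blast
qed

lemma dist_diff_le: "\<lbrakk>x \<in> M; y \<in> M; z \<in> M\<rbrakk> \<Longrightarrow> d x z \<le> d x y + d z y"
  using tri sym by metis

text \<open>Halving the chain costs one application of the four-point inequality, hence the logarithm.\<close>
lemma chain_gp:
  assumes hyp: "four_point M d \<Delta>" and "p \<in> M" and "\<And>i. i \<le> n \<Longrightarrow> x i \<in> M"
    and "0 < n" "n \<le> 2 ^ k"
  shows "\<exists>i<n. gp d p (x i) (x (Suc i)) \<le> gp d p (x 0) (x n) + int (k * \<Delta>)"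
  using assms(3-)
proof (induction k arbitrary: n x)
  case 0
  then have "n = 1" by auto
  then show ?case by auto
next
  case (Suc k)
  show ?case
  proof (cases "n = 1")
    case True
    then show ?thesis by auto
  next
    case False
    define h where "h = n div 2"
    have h: "0 < h" "0 < n - h" "h \<le> 2 ^ k" "n - h \<le> 2 ^ k" "h \<le> n" "h < n"
      using Suc.prems False unfolding h_def by auto
    have "min (gp d p (x 0) (x h)) (gp d p (x h) (x n)) \<le> gp d p (x 0) (x n) + int \<Delta>"
      using four_pointD[OF hyp] Suc.prems h assms(2) by auto
    then consider "gp d p (x 0) (x h) \<le> gp d p (x 0) (x n) + int \<Delta>"
      | "gp d p (x h) (x n) \<le> gp d p (x 0) (x n) + int \<Delta>" by linarith
    then show ?thesis
    proof cases
      case 1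
      obtain i where "i < h" "gp d p (x i) (x (Suc i)) \<le> gp d p (x 0) (x h) + int (k * \<Delta>)"
        using Suc.IH[of h x] Suc.prems h by auto
      then show ?thesis using 1 h by (intro exI[of _ i]) auto
    next
      case 2
      obtain i where "i < n - h"
        "gp d p (x (i + h)) (x (Suc (i + h))) \<le> gp d p (x h) (x n) + int (k * \<Delta>)"
        using Suc.IH[of "n - h" "\<lambda>i. x (i + h)"] Suc.prems h by auto
      then show ?thesis using 2 h by (intro exI[of _ "i + h"]) auto
    qed
  qed
qed

end

text \<open>The arithmetic end of the stability argument: a detour of at most
  \<open>6 * L * D + 2\<close> steps takes only logarithmically many halvings \<open>k\<close>, and
  \<open>2 * D \<le> L + k * \<Delta>\<close> fails for such \<open>k\<close> once \<open>D\<close>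
  is large.\<close>

lemma linear_below_exponential:
  fixes L \<Delta> :: nat
  shows "\<exists>D0. \<forall>D. (\<forall>k. 6 * L * D + 2 \<le> 2 ^ k \<longrightarrow> 2 * D \<le> L + k * \<Delta>) \<longrightarrow> D \<le> D0"
proof -
  define c where "c = real (6 * L * (\<Delta> + 1))"
  have "eventually (\<lambda>k::nat. c * (real k + 1) + 2 \<le> 2 ^ k) sequentially"
  proof -
    have "c \<ge> 0" unfolding c_def by simp
    then consider "c = 0" | "c > 0" by linarith
    then show ?thesis by cases real_asymp+
  qed
  then obtain k0 where k0: "\<And>k::nat. k \<ge> k0 \<Longrightarrow> c * (real k + 1) + 2 \<le> 2 ^ k"
    unfolding eventually_sequentially by blast
  have "D \<le> L + k0 * (\<Delta> + 1)"
    if D: "\<forall>k. 6 * L * D + 2 \<le> 2 ^ k \<longrightarrow> 2 * D \<le> L + k * \<Delta>" for D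
  proof (rule ccontr)
    assume "\<not> D \<le> L + k0 * (\<Delta> + 1)"
    then have big: "D > L + k0 * (\<Delta> + 1)" by simp
    \<comment> \<open>A \<open>k\<close> linear in \<open>D\<close> is good enough:
      \<open>k * \<Delta> \<le> D\<close> turns the hypothesis into \<open>D \<le> L\<close>, while
      \<open>2 ^ k\<close> exceeds every linear function of \<open>k\<close>.\<close>
    define k where "k = D div (\<Delta> + 1)"
    have "D mod (\<Delta> + 1) < \<Delta> + 1" by simp
    moreover have "D = k * (\<Delta> + 1) + D mod (\<Delta> + 1)"
      unfolding k_def by (rule div_mult_mod_eq[symmetric])
    moreover have e: "(k + 1) * (\<Delta> + 1) = k * (\<Delta> + 1) + (\<Delta> + 1)" by simp
    ultimately have k: "k * (\<Delta> + 1) \<le> D" "D < (k + 1) * (\<Delta> + 1)"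
      unfolding e by linarith+
    have "k0 * (\<Delta> + 1) < (k + 1) * (\<Delta> + 1)" using big k(2) by linarith
    then have "k0 \<le> k" unfolding mult_less_cancel2 by linarith
    have "6 * L * D + 2 \<le> 6 * L * ((k + 1) * (\<Delta> + 1)) + 2"
      using k(2) by (intro add_mono mult_left_mono) auto
    then have "real (6 * L * D + 2) \<le> real (6 * L * ((k + 1) * (\<Delta> + 1)) + 2)"
      by linarith
    also have "\<dots> = c * (real k + 1) + 2" unfolding c_def by (simp add: algebra_simps)
    also have "\<dots> \<le> 2 ^ k" using k0 \<open>k0 \<le> k\<close> by blast
    finally have "real (6 * L * D + 2) \<le> real (2 ^ k)" by simp
    then have "6 * L * D + 2 \<le> 2 ^ k" by linarith
    with D have "2 * D \<le> L + k * \<Delta>" by blast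
    then show False using k(1) big by (simp add: algebra_simps)
  qed
  then show ?thesis by blast
qed

text \<open>A discrete quasi-geodesic. The lower bound is purely multiplicative, as it is for
  geodesics of a bi-Lipschitz equivalent metric.\<close>

definition quasi_path :: "'a set \<Rightarrow> ('a \<Rightarrow> 'a \<Rightarrow> nat) \<Rightarrow> nat \<Rightarrow> nat \<Rightarrow> (nat \<Rightarrow> 'a) \<Rightarrow> bool" where
  "quasi_path M d L N x \<longleftrightarrow> (\<forall>i\<le>N. x i \<in> M) \<and> (\<forall>i<N. d (x i) (x (Suc i)) \<le> L) \<and>
     (\<forall>i j. i \<le> j \<longrightarrow> j \<le> N \<longrightarrow> j - i \<le> L * d (x i) (x j))"

text \<open>
  A point of the geodesic at maximal distance \<open>D\<close> from the path sees a detour along the path of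
  length at most linear in \<open>D\<close>, while every step of the detour has Gromov product about \<open>D\<close>;
  the logarithmic chain bound then limits \<open>D\<close>.
\<close>
lemma (in graph_metric) geodesic_near_quasi_path:
  assumes hyp: "four_point M d \<Delta>"
  shows "\<exists>D0. \<forall>N x \<gamma> t. quasi_path M d L N x \<longrightarrow> geodesic_path M d (x 0) (x N) \<gamma> \<longrightarrow>
    t \<le> d (x 0) (x N) \<longrightarrow> (\<exists>i\<le>N. d (\<gamma> t) (x i) \<le> D0)"
proof -
  obtain D0 where D0: "\<And>D. (\<forall>k. 6 * L * D + 2 \<le> 2 ^ k \<longrightarrow> 2 * D \<le> L + k * \<Delta>) \<Longrightarrow> D \<le> D0"
    using linear_below_exponential[of L \<Delta>] by blast
  have "\<exists>i\<le>N. d (\<gamma> t) (x i) \<le> D0"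
    if qp: "quasi_path M d L N x" and geo: "geodesic_path M d (x 0) (x N) \<gamma>"
      and t: "t \<le> d (x 0) (x N)" for N x \<gamma> t
  proof -
    define n where "n = d (x 0) (x N)"
    note g = geodesic_pathD[OF geo, folded n_def]
    have xM: "x i \<in> M" if "i \<le> N" for i using qp that unfolding quasi_path_def by blast
    have step: "d (x i) (x (Suc i)) \<le> L" if "i < N" for i
      using qp that unfolding quasi_path_def by blast
    have quasi: "j - i \<le> L * d (x i) (x j)" if "i \<le> j" "j \<le> N" for i j
      using qp that unfolding quasi_path_def by blast
    define dist where "dist z = Min ((\<lambda>i. d z (x i)) ` {..N})" for z
    have dist_le: "dist z \<le> d z (x i)" if "i \<le> N" for z i
      unfolding dist_def using that by (intro Min_le) auto
    have dist_att: "\<exists>i\<le>N. d z (x i) = dist z" for z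
    proof -
      have "dist z \<in> (\<lambda>i. d z (x i)) ` {..N}" unfolding dist_def by (intro Min_in) auto
      then show ?thesis by auto
    qed
    \<comment> \<open>The worst distance from the geodesic to the path, attained at
      \<open>z\<close>; its maximality keeps the points \<open>\<gamma> r\<close> below within
      \<open>D\<close> of the path.\<close>
    define D where "D = Max ((\<lambda>t. dist (\<gamma> t)) ` {..n})"
    have D_ge: "dist (\<gamma> t) \<le> D" if "t \<le> n" for t
      unfolding D_def using that by (intro Max_ge) auto
    have "D \<in> (\<lambda>t. dist (\<gamma> t)) ` {..n}" unfolding D_def by (intro Max_in) auto
    then obtain s where s: "s \<le> n" "dist (\<gamma> s) = D" by auto
    define z where "z = \<gamma> s"
    have zM: "z \<in> M" using g s unfolding z_def by blast
    have far: "D \<le> d z (x i)" if "i \<le> N" for i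
      using dist_le[OF that, of z] s unfolding z_def by simp
    \<comment> \<open>From \<open>z\<close> one walks \<open>2 * D\<close> along the geodesic in
      either direction, or stops at an endpoint. After a full walk the product is at least
      \<open>2 * D + D - D\<close>; an endpoint lies on the path, and there it is
      \<open>2 * d z (\<gamma> r)\<close>.\<close>
    have ends: "\<exists>i\<le>N. d (\<gamma> r) (x i) \<le> D \<and> d z (\<gamma> r) \<le> 2 * D \<and> 2 * D \<le> gp d z (\<gamma> r) (x i)"
      if r: "r \<le> n" "(r = s - 2 * D) \<or> (r = min n (s + 2 * D))" for r
    proof -
      have rM: "\<gamma> r \<in> M" using g r by blast
      have zr: "d z (\<gamma> r) = (if r \<le> s then s - r else r - s)"
        using g(4)[of r s] g(4)[of s r] r s rM zM sym[of z "\<gamma> r"] unfolding z_def by auto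
      have le: "d z (\<gamma> r) \<le> 2 * D" using r s(1) unfolding zr by auto
      consider "d z (\<gamma> r) = 2 * D" | "r = 0" | "r = n"
        using r s(1) unfolding zr by (cases "r \<le> s") (simp_all, linarith+)
      then show ?thesis
      proof cases
        case 1
        obtain i where i: "i \<le> N" "d (\<gamma> r) (x i) = dist (\<gamma> r)" using dist_att by blast
        then have "d (\<gamma> r) (x i) \<le> D" using D_ge r by simp
        then show ?thesis using 1 i far[of i] unfolding gp_def by (intro exI[of _ i]) auto
      next
        case 2
        then have "\<gamma> r = x 0" using g by simp
        then show ?thesis using far[of 0] zero[of "x 0" "x 0"] xM[of 0] le
          unfolding gp_def by (intro exI[of _ 0]) auto
      next
        case 3
        then have "\<gamma> r = x N" using g by simp
        then show ?thesis using far[of N] zero[of "x N" "x N"] xM[of N] le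
          unfolding gp_def by (intro exI[of _ N]) auto
      qed
    qed
    define r where "r = s - 2 * D"
    define r' where "r' = min n (s + 2 * D)"
    have rr: "r \<le> n" "r' \<le> n" "r \<le> s" "s \<le> r'" using s unfolding r_def r'_def by auto
    obtain i where i: "i \<le> N" "d (\<gamma> r) (x i) \<le> D" "d z (\<gamma> r) \<le> 2 * D" "2 * D \<le> gp d z (\<gamma> r) (x i)"
      using ends[of r] rr r_def by blast
    obtain j where j: "j \<le> N" "d (\<gamma> r') (x j) \<le> D" "d z (\<gamma> r') \<le> 2 * D" "2 * D \<le> gp d z (\<gamma> r') (x j)"
      using ends[of r'] rr r'_def by blast
    have M: "\<gamma> r \<in> M" "\<gamma> r' \<in> M" using g rr by auto
    have gp0: "gp d z (\<gamma> r) (\<gamma> r') = 0"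
      using g(4)[of r s] g(4)[of s r'] g(4)[of r r'] rr s sym[OF zM M(1)] unfolding gp_def z_def by auto
    define m where "m = (if i \<le> j then j - i else i - j)"
    \<comment> \<open>The route through \<open>z\<close> has pieces of length at most
      \<open>D\<close>, \<open>2 * D\<close>, \<open>2 * D\<close> and \<open>D\<close>.\<close>
    have xij: "d (x i) (x j) \<le> 6 * D"
    proof -
      have "d (x i) (x j) \<le> d (x i) (\<gamma> r) + d (\<gamma> r) z + d z (\<gamma> r') + d (\<gamma> r') (x j)"
        using tri[OF xM[OF i(1)] M(1) xM[OF j(1)]] tri[OF M(1) zM xM[OF j(1)]]
          tri[OF zM M(2) xM[OF j(1)]] by linarith
      moreover have "d (x i) (\<gamma> r) = d (\<gamma> r) (x i)" "d (\<gamma> r) z = d z (\<gamma> r)"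
        using sym M zM xM i(1) by blast+
      ultimately show ?thesis using i j by linarith
    qed
    have m: "m \<le> L * (6 * D)"
    proof -
      have "m \<le> L * d (x i) (x j)"
        using quasi[of i j] quasi[of j i] i j sym[OF xM xM] unfolding m_def by auto
      also have "\<dots> \<le> L * (6 * D)" using xij by (rule mult_left_mono) simp
      finally show ?thesis .
    qed
    define w where "w l = (if i \<le> j then i + l else i - l)" for l
    have w: "w 0 = i" "w m = j" "\<And>l. l \<le> m \<Longrightarrow> w l \<le> N" using i j unfolding w_def m_def by auto
    have wstep: "d (x (w l)) (x (w (Suc l))) \<le> L" if "l < m" for l
    proof (cases "i \<le> j")
      case True
      then show ?thesis using that step[of "i + l"] i j unfolding w_def m_def by auto
    next
      case False
      then have "Suc (i - Suc l) = i - l" "i - l \<le> N" "i - Suc l < N" using that i j unfolding m_def by auto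
      then show ?thesis using False step[of "i - Suc l"] sym[OF xM xM, of "i - l" "i - Suc l"]
        unfolding w_def by auto
    qed
    \<comment> \<open>The chain steps from \<open>\<gamma> r\<close> to the path, follows it and
      steps back to \<open>\<gamma> r'\<close>, whence \<open>m + 2\<close> steps.\<close>
    define c where "c l = (if l = 0 then \<gamma> r else if l \<le> m + 1 then x (w (l - 1)) else \<gamma> r')" for l
    have cM: "c l \<in> M" for l using M xM w unfolding c_def by auto
    \<comment> \<open>Path points are at distance at least \<open>D\<close> from \<open>z\<close>,
      and neighbours are at most \<open>L\<close> apart.\<close>
    have cstep: "2 * int D - int L \<le> gp d z (c l) (c (Suc l))" if "l < m + 2" for l
    proof -
      have "l = 0 \<or> l = Suc (l - 1) \<and> l - 1 < m \<or> l = m + 1" using that by linarith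
      then consider "l = 0" | l' where "l = Suc l'" "l' < m" | "l = m + 1" by blast
      then show ?thesis
      proof cases
        case 1
        then show ?thesis using i w unfolding c_def by auto
      next
        case 2
        then show ?thesis using wstep[of l'] far[of "w l'"] far[of "w (Suc l')"] w(3)[of l'] w(3)[of "Suc l'"]
          unfolding c_def gp_def by auto
      next
        case 3
        then have "gp d z (c l) (c (Suc l)) = gp d z (\<gamma> r') (x j)"
          using w sym[OF M(2) xM[OF j(1)]] unfolding c_def gp_def by auto
        then show ?thesis using j by auto
      qed
    qed
    have "2 * D \<le> L + k * \<Delta>" if "6 * L * D + 2 \<le> 2 ^ k" for k
    proof -
      have "m + 2 \<le> 2 ^ k" using that m by (auto simp: algebra_simps)
      then obtain l where "l < m + 2"
        "gp d z (c l) (c (Suc l)) \<le> gp d z (c 0) (c (m + 2)) + int (k * \<Delta>)"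
        using chain_gp[OF hyp zM, of "m + 2" c k] cM by auto
      moreover have "gp d z (c 0) (c (m + 2)) = 0" using gp0 unfolding c_def by simp
      ultimately show ?thesis using cstep[of l] by linarith
    qed
    then have "D \<le> D0" using D0 by blast
    moreover obtain i where "i \<le> N" "d (\<gamma> t) (x i) = dist (\<gamma> t)" using dist_att by blast
    ultimately show ?thesis using D_ge[of t] t unfolding n_def by (intro exI[of _ i]) simp
  qed
  then show ?thesis by blast
qed

section \<open>Gromov products as distances to geodesics\<close>

context graph_metric
begin

text \<open>The four-point inequality without a preferred base point: of the three sums of opposite
  distances, each is at most the larger of the other two, up to \<open>\<Delta>\<close>.\<close>

lemma four_point_sum:
  assumes "four_point M d \<Delta>" "x \<in> M" "y \<in> M" "z \<in> M" "w \<in> M"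
  shows "d x z + d y w \<le> max (d x y + d z w) (d x w + d y z) + \<Delta>"
  using four_pointD[OF assms(1), of w x y z] assms(2-) sym[of w x] sym[of w y] sym[of w z]
  unfolding gp_def by auto

text \<open>The product seen from \<open>z\<close> controls the distance from \<open>z\<close> to a
  geodesic, \<open>gp_le_geodesic\<close> being the opposite estimate; the factor 2 lost between
  them is harmless.\<close>

lemma near_geodesic:
  assumes hyp: "four_point M d \<Delta>" and M: "p \<in> M" "q \<in> M" "z \<in> M"
    and geo: "geodesic_path M d p q \<gamma>"
  shows "\<exists>t\<le>d p q. int (d z (\<gamma> t)) \<le> gp d z p q + int \<Delta>"
proof -
  note g = geodesic_pathD[OF geo]
  \<comment> \<open>The candidate is the point as far from \<open>p\<close> as \<open>z\<close> is,
    or \<open>q\<close> if the geodesic is too short.\<close>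
  define t where "t = min (d p z) (d p q)"
  have t: "t \<le> d p q" unfolding t_def by simp
  have "d p q + d z (\<gamma> t) \<le> max (d p z + d q (\<gamma> t)) (d p (\<gamma> t) + d z q) + \<Delta>"
    using four_point_sum[OF hyp, of p z q "\<gamma> t"] M g(3)[OF t] by simp
  moreover have "d p (\<gamma> t) = t" using g(4)[of 0 t] g(1) t by simp
  moreover have "d q (\<gamma> t) = d p q - t" using g(4)[of t "d p q"] g(2) t sym[of q "\<gamma> t"] M g(3)[OF t] by simp
  moreover have "d z q + d p z \<ge> d p q" using tri[of p z q] M by simp
  ultimately have "int (d z (\<gamma> t)) \<le> int (d p z) + int (d z q) - int (d p q) + int \<Delta>"
    unfolding t_def by (auto simp: min_def max_def split: if_splits)
  then show ?thesis using t sym[of z p] M unfolding gp_def by auto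
qed

lemma gp_geodesic:
  assumes "p \<in> M" "q \<in> M" "geodesic_path M d p q \<gamma>" "t \<le> d p q"
  shows "gp d (\<gamma> t) p q = 0"
  using geodesic_pathD(1,2)[OF assms(3)] geodesic_pathD(3)[OF assms(3,4)]
    geodesic_pathD(4)[OF assms(3), of 0 t] geodesic_pathD(4)[OF assms(3), of t "d p q"] assms(4)
    sym[of "\<gamma> t" p] assms(1)
  unfolding gp_def by auto

lemma gp_shift:
  assumes "x \<in> M" "y \<in> M" "p \<in> M" "q \<in> M"
  shows "gp d x p q \<le> gp d y p q + 2 * int (d x y)"
  using tri[of x y p] tri[of x y q] assms unfolding gp_def by auto

lemma gp_le_geodesic:
  assumes "p \<in> M" "x \<in> M" "y \<in> M" "geodesic_path M d x y \<gamma>" "t \<le> d x y"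
  shows "gp d p x y \<le> 2 * int (d p (\<gamma> t))"
  using gp_shift[of p "\<gamma> t" x y] gp_geodesic[of x y \<gamma> t] geodesic_pathD(3)[OF assms(4,5)] assms by auto

text \<open>The branch point of the tripod spanned by \<open>p\<close>, \<open>x\<close>,
  \<open>w\<close>, placed on the side from \<open>x\<close> to \<open>w\<close>. Its ideal distance
  from \<open>x\<close> may be a half-integer; rounding down costs the extra 1.\<close>

lemma median:
  assumes hyp: "four_point M d \<Delta>" and M: "p \<in> M" "x \<in> M" "w \<in> M"
  shows "\<exists>z\<in>M. gp d z x w = 0 \<and> gp d z p x \<le> int \<Delta> \<and> gp d z p w \<le> int \<Delta> + 1"
proof -
  define t where "t = nat (gp d x p w div 2)"
  have ge: "gp d x p w \<ge> 0" using tri[of p x w] M sym unfolding gp_def by auto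
  have t: "2 * int t \<le> gp d x p w" "gp d x p w \<le> 2 * int t + 1" using ge unfolding t_def by auto
  have "t \<le> d x w" using t(1) tri[of x w p] sym[of w p] M unfolding gp_def by auto
  then obtain z where z: "z \<in> M" "d x z = t" "d z w = d x w - t" using geod M by blast
  have "d z p + d x w \<le> max (d x p + d z w) (d x z + d p w) + \<Delta>"
    using four_point_sum[OF hyp, of z x p w] z M sym[of z x] by (auto simp: max.commute add.commute)
  then show ?thesis using z t M \<open>t \<le> d x w\<close> sym[of z x] sym[of p x] unfolding gp_def
    by (intro bexI[of _ z]) auto
qed

end

locale bilipschitz_pair = D: graph_metric M d + E: graph_metric M e
  for M :: "'a set" and d e :: "'a \<Rightarrow> 'a \<Rightarrow> nat" +
  fixes L \<Delta> :: nat
  assumes hyp: "four_point M d \<Delta>"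
    and le1: "\<lbrakk>x \<in> M; y \<in> M\<rbrakk> \<Longrightarrow> d x y \<le> L * e x y"
    and le2: "\<lbrakk>x \<in> M; y \<in> M\<rbrakk> \<Longrightarrow> e x y \<le> L * d x y"
begin

lemma quasi_path_geodesic:
  assumes "geodesic_path M e p q x"
  shows "quasi_path M d L (e p q) x"
proof -
  note g = geodesic_pathD[OF assms]
  have "d (x i) (x (Suc i)) \<le> L" if "i < e p q" for i
    using le1[of "x i" "x (Suc i)"] g(3)[of i] g(3)[of "Suc i"] g(4)[of i "Suc i"] that by auto
  moreover have "j - i \<le> L * d (x i) (x j)" if "i \<le> j" "j \<le> e p q" for i j
    using le2[of "x i" "x j"] g(3)[of i] g(3)[of j] g(4)[of i j] that by auto
  ultimately show ?thesis using g(3) unfolding quasi_path_def by blast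
qed

text \<open>The stability constant of quasi-geodesics, chosen once so that it does not vary with the
  endpoints.\<close>

definition near where "near = (SOME D0. \<forall>N x \<gamma> t. quasi_path M d L N x \<longrightarrow>
    geodesic_path M d (x 0) (x N) \<gamma> \<longrightarrow> t \<le> d (x 0) (x N) \<longrightarrow> (\<exists>i\<le>N. d (\<gamma> t) (x i) \<le> D0))"

lemma near:
  assumes "geodesic_path M e p q x" "geodesic_path M d p q \<gamma>" "t \<le> d p q"
  shows "\<exists>i\<le>e p q. d (\<gamma> t) (x i) \<le> near"
  using someI_ex[OF D.geodesic_near_quasi_path[OF hyp, of L], folded near_def]
    quasi_path_geodesic[OF assms(1)] geodesic_pathD(1,2)[OF assms(1)] assms(2,3) by metis

text \<open>A small product puts \<open>z\<close> near a \<open>d\<close>-geodesic, and stability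
  puts that near the \<open>e\<close>-geodesic; the factor \<open>L\<close> converts
  \<open>d\<close> into \<open>e\<close>.\<close>

lemma near_e_geodesic:
  assumes "p \<in> M" "q \<in> M" "z \<in> M" "geodesic_path M e p q x" "gp d z p q \<le> int m"
  shows "\<exists>i\<le>e p q. e z (x i) \<le> L * (m + \<Delta> + near)"
proof -
  obtain \<gamma> where \<gamma>: "geodesic_path M d p q \<gamma>" using D.geodesic_path_exists assms by blast
  obtain t where t: "t \<le> d p q" "int (d z (\<gamma> t)) \<le> gp d z p q + int \<Delta>"
    using D.near_geodesic[OF hyp assms(1-3) \<gamma>] by blast
  obtain i where i: "i \<le> e p q" "d (\<gamma> t) (x i) \<le> near" using near[OF assms(4) \<gamma> t(1)] by blast
  have M: "\<gamma> t \<in> M" "x i \<in> M" using geodesic_pathD(3) \<gamma> assms(4) t i by metis+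
  have "d z (x i) \<le> m + \<Delta> + near" using D.tri[OF assms(3) M] t i assms(5) by linarith
  then have "L * d z (x i) \<le> L * (m + \<Delta> + near)" by (rule mult_left_mono) simp
  then show ?thesis using le2[OF assms(3) M(2)] i by (meson le_trans)
qed

text \<open>The converse half of stability, that \<open>e\<close>-geodesics stay near
  \<open>d\<close>-geodesics, by a discrete continuity argument: the partners of successive points
  of the \<open>d\<close>-geodesic move along \<open>x\<close> in bounded jumps from one end to the
  other, hence pass close to every \<open>x k\<close>.\<close>

lemma gp_e_geodesic:
  assumes M: "p \<in> M" "q \<in> M" and geo: "geodesic_path M e p q x" and k: "k \<le> e p q"
  shows "gp d (x k) p q \<le> int (2 * (L * (L * (2 * near + 1)) + near))"
proof -
  obtain \<gamma> where \<gamma>: "geodesic_path M d p q \<gamma>" using D.geodesic_path_exists M by blast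
  note g = geodesic_pathD[OF \<gamma>] and h = geodesic_pathD[OF geo]
  define n where "n = d p q"
  \<comment> \<open>The last point is given the last index as its partner, so that the partners do
    reach every \<open>k\<close>.\<close>
  have "\<exists>i. i \<le> e p q \<and> d (\<gamma> t) (x i) \<le> near \<and> (t = n \<longrightarrow> i = e p q)" if t: "t \<le> n" for t
  proof (cases "t = n")
    case True
    then show ?thesis using g(2) h(2) D.zero[OF M(2) M(2)] unfolding n_def by auto
  next
    case False
    then show ?thesis using near[OF geo \<gamma>, of t] t unfolding n_def by blast
  qed
  then obtain \<iota> where \<iota>: "\<And>t. t \<le> n \<Longrightarrow> \<iota> t \<le> e p q \<and> d (\<gamma> t) (x (\<iota> t)) \<le> near \<and> (t = n \<longrightarrow> \<iota> t = e p q)"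
    by metis
  have "\<exists>t\<le>n. d (x k) (\<gamma> t) \<le> L * (L * (2 * near + 1)) + near"
  proof -
    define t where "t = (LEAST t. k \<le> \<iota> t)"
    have ex: "k \<le> \<iota> n" using \<iota>[of n] k by simp
    have tn: "t \<le> n" unfolding t_def by (rule Least_le[of "\<lambda>t. k \<le> \<iota> t", OF ex])
    have t: "k \<le> \<iota> t" unfolding t_def by (rule LeastI[of "\<lambda>t. k \<le> \<iota> t", OF ex])
    show ?thesis
    proof (cases t)
      case 0
      have M': "x k \<in> M" "x 0 \<in> M" "x (\<iota> 0) \<in> M" "\<gamma> 0 \<in> M"
        using h(3) k \<iota>[of 0] g(3)[of 0] by auto
      \<comment> \<open>The first partner need not be index 0, but \<open>\<gamma> 0 = x 0\<close>
        keeps it bounded.\<close>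
      have "\<iota> 0 \<le> L * near"
      proof -
        have "\<iota> 0 = e (x 0) (x (\<iota> 0))" using h(4)[of 0 "\<iota> 0"] \<iota>[of 0] by simp
        also have "\<dots> \<le> L * d (x 0) (x (\<iota> 0))" using le2 M' by blast
        also have "\<dots> \<le> L * near" using \<iota>[of 0] g(1) h(1) by (intro mult_left_mono) auto
        finally show ?thesis .
      qed
      then have "k \<le> L * near" using t 0 by simp
      have "d (x k) (\<gamma> 0) \<le> L * e (x 0) (x k)" 
        using le1[OF M'(2,1)] D.sym[OF M'(1,4)] g(1) h(1) by simp
      also have "\<dots> = L * k" using h(4)[of 0 k] k by simp
      also have "\<dots> \<le> L * (L * (2 * near + 1))" 
        using \<open>k \<le> L * near\<close> by (intro mult_left_mono) (auto simp: algebra_simps)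
      finally show ?thesis by (intro exI[of _ 0]) auto
    next
      case (Suc s)
      have s: "\<iota> s < k" "s \<le> n"
        using not_less_Least[of s "\<lambda>t. k \<le> \<iota> t"] Suc tn unfolding t_def by auto
      have M': "x k \<in> M" "x (\<iota> s) \<in> M" "x (\<iota> t) \<in> M" "\<gamma> s \<in> M" "\<gamma> t \<in> M"
        using h(3) k \<iota>[OF tn] \<iota>[OF s(2)] g(3)[of s] g(3)[of t] s tn unfolding n_def by auto
      have "d (\<gamma> s) (\<gamma> t) = 1" using g(4)[of s t] Suc tn unfolding n_def by auto
      then have "d (x (\<iota> s)) (x (\<iota> t)) \<le> 2 * near + 1"
        using D.tri[OF M'(2,4,3)] D.tri[OF M'(4,5,3)] D.sym[OF M'(2,4)] \<iota>[OF tn] \<iota>[OF s(2)] by linarith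
      have "k - \<iota> s \<le> e (x (\<iota> s)) (x (\<iota> t))" using h(4)[of "\<iota> s" "\<iota> t"] s t \<iota>[OF tn] by simp
      also have "\<dots> \<le> L * d (x (\<iota> s)) (x (\<iota> t))" using le2 M' by blast
      also have "\<dots> \<le> L * (2 * near + 1)"
        using \<open>d (x (\<iota> s)) (x (\<iota> t)) \<le> 2 * near + 1\<close> by (rule mult_left_mono) simp
      finally have *: "k - \<iota> s \<le> L * (2 * near + 1)" .
      have "d (x (\<iota> s)) (x k) \<le> L * e (x (\<iota> s)) (x k)" using le1 M' by blast
      also have "\<dots> = L * (k - \<iota> s)" using h(4)[of "\<iota> s" k] s k by simp
      also have "\<dots> \<le> L * (L * (2 * near + 1))" using * by (rule mult_left_mono) simp
      finally show ?thesis 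
        using D.tri[OF M'(1,2,4)] D.sym[OF M'(1,2)] D.sym[OF M'(2,4)] \<iota>[OF s(2)] s(2)
        by (intro exI[of _ s]) linarith
    qed
  qed
  then obtain t where t: "t \<le> n" "d (x k) (\<gamma> t) \<le> L * (L * (2 * near + 1)) + near" by blast
  have "gp d (x k) p q \<le> gp d (\<gamma> t) p q + 2 * int (d (x k) (\<gamma> t))"
    using D.gp_shift[of "x k" "\<gamma> t" p q] h(3)[OF k] g(3) t M unfolding n_def by auto
  moreover have "gp d (\<gamma> t) p q = 0" using D.gp_geodesic[OF M \<gamma>, of t] t(1) unfolding n_def .
  moreover define R where "R = L * (L * (2 * near + 1)) + near"
  ultimately show ?thesis using t(2) unfolding R_def[symmetric] by linarith
qed

text \<open>All \<open>e\<close>-geodesic sides of the triangle \<open>p\<close>, \<open>x\<close>,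
  \<open>w\<close> pass near the \<open>d\<close>-median \<open>z\<close>, so up to a constant the
  product of \<open>x\<close> and \<open>w\<close> at \<open>p\<close> is twice the distance from
  \<open>p\<close> to a point \<open>\<gamma> i\<close> of the side from \<open>x\<close> to
  \<open>w\<close>. Hyperbolicity of \<open>d\<close> puts \<open>\<gamma> i\<close> near the side
  from \<open>x\<close> to \<open>y\<close> or the one from \<open>y\<close> to \<open>w\<close>,
  which bounds the product of that pair by the same distance.\<close>

theorem four_point_transfer: "\<exists>\<Delta>'. four_point M e \<Delta>'"
proof -
  \<comment> \<open>\<open>R\<close> bounds the \<open>d\<close>-product of the endpoints seen from
    a point of an \<open>e\<close>-geodesic, \<open>R2\<close> the \<open>e\<close>-distance from
    the median to the three sides, \<open>R3\<close> that from \<open>\<gamma> i\<close> to the side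
    selected by the four-point inequality.\<close>
  define R where "R = 2 * (L * (L * (2 * near + 1)) + near)"
  define R2 where "R2 = L * ((\<Delta> + 1) + \<Delta> + near)"
  define R3 where "R3 = L * ((R + \<Delta>) + \<Delta> + near)"
  have "min (gp e p x y) (gp e p y w) \<le> gp e p x w + int (6 * R2 + 2 * R3)"
    if M: "p \<in> M" "x \<in> M" "y \<in> M" "w \<in> M" for p x y w
  proof -
    obtain \<gamma> where \<gamma>: "geodesic_path M e x w \<gamma>" using E.geodesic_path_exists M by blast
    obtain z where z: "z \<in> M" "gp d z x w = 0" "gp d z p x \<le> int \<Delta>" "gp d z p w \<le> int \<Delta> + 1"
      using D.median[OF hyp M(1,2,4)] by blast
    obtain i where i: "i \<le> e x w" "e z (\<gamma> i) \<le> R2"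
      using near_e_geodesic[OF M(2,4) z(1) \<gamma>, of "\<Delta> + 1"] z unfolding R2_def by auto
    have gp_e: "gp e z a b \<le> 2 * int R2" if ab: "a \<in> M" "b \<in> M" "gp d z a b \<le> int \<Delta> + 1" for a b
    proof -
      obtain \<eta> where \<eta>: "geodesic_path M e a b \<eta>" using E.geodesic_path_exists ab by blast
      obtain j where "j \<le> e a b" "e z (\<eta> j) \<le> R2"
        using near_e_geodesic[OF ab(1,2) z(1) \<eta>, of "\<Delta> + 1"] ab unfolding R2_def by auto
      then show ?thesis using E.gp_le_geodesic[OF z(1) ab(1,2) \<eta>, of j] by linarith
    qed
    have uM: "\<gamma> i \<in> M" using geodesic_pathD(3)[OF \<gamma> i(1)] .
    \<comment> \<open>The two estimates at \<open>z\<close> cost \<open>4 * R2\<close>, and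
      replacing \<open>z\<close> by \<open>\<gamma> i\<close> in a doubled distance another
      \<open>2 * R2\<close>.\<close>
    have lower: "2 * int (e p (\<gamma> i)) \<le> gp e p x w + 6 * int R2"
      using gp_e[of p x] gp_e[of p w] M z E.tri[OF M(2) z(1) M(4)] E.tri[OF M(1) z(1) uM] i
        E.sym[OF z(1) M(1)] E.sym[OF z(1) M(2)]
      unfolding gp_def by auto
    have upper: "gp e p a b \<le> gp e p x w + int (6 * R2 + 2 * R3)"
      if ab: "a \<in> M" "b \<in> M" "gp d (\<gamma> i) a b \<le> int (R + \<Delta>)" for a b
    proof -
      obtain \<eta> where \<eta>: "geodesic_path M e a b \<eta>" using E.geodesic_path_exists ab by blast
      obtain j where j: "j \<le> e a b" "e (\<gamma> i) (\<eta> j) \<le> R3"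
        using near_e_geodesic[OF ab(1,2) uM \<eta>, of "R + \<Delta>"] ab unfolding R3_def by auto
      have "gp e p a b \<le> 2 * int (e p (\<eta> j))" using E.gp_le_geodesic[OF M(1) ab(1,2) \<eta> j(1)] .
      then show ?thesis using E.tri[OF M(1) uM geodesic_pathD(3)[OF \<eta> j(1)]] j lower by linarith
    qed
    have "gp d (\<gamma> i) x w \<le> int R" using gp_e_geodesic[OF M(2,4) \<gamma> i(1)] unfolding R_def .
    then have "min (gp d (\<gamma> i) x y) (gp d (\<gamma> i) y w) \<le> int (R + \<Delta>)"
      using four_pointD[OF hyp uM M(2,3,4)] by linarith
    then consider "gp d (\<gamma> i) x y \<le> int (R + \<Delta>)" | "gp d (\<gamma> i) y w \<le> int (R + \<Delta>)" by linarith
    then show ?thesis using upper[OF M(2,3)] upper[OF M(3,4)] by cases linarith+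
  qed
  then have "four_point M e (6 * R2 + 2 * R3)" unfolding four_point_def by blast
  then show ?thesis by blast
qed

end

section \<open>Groups with a length function\<close>

text \<open>All that is used of a word length; \<open>len_split\<close> says that a geodesic word
  can be cut anywhere.\<close>

locale length_group = group G for G (structure) +
  fixes len :: "'a \<Rightarrow> nat"
  assumes len_zero_iff: "x \<in> carrier G \<Longrightarrow> len x = 0 \<longleftrightarrow> x = \<one>"
    and len_inv: "x \<in> carrier G \<Longrightarrow> len (inv x) = len x"
    and len_mult: "\<lbrakk>x \<in> carrier G; y \<in> carrier G\<rbrakk> \<Longrightarrow> len (x \<otimes> y) \<le> len x + len y"
    and len_split: "\<lbrakk>x \<in> carrier G; k \<le> len x\<rbrakk> \<Longrightarrow>
      \<exists>y\<in>carrier G. \<exists>z\<in>carrier G. x = y \<otimes> z \<and> len y = k \<and> len z = len x - k"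
    and finite_len_le: "finite {x \<in> carrier G. len x \<le> n}"
begin

definition dist :: "'a \<Rightarrow> 'a \<Rightarrow> nat" where "dist x y = len (inv x \<otimes> y)"

lemma inv_mult_cancel: "\<lbrakk>x \<in> carrier G; y \<in> carrier G\<rbrakk> \<Longrightarrow> inv x \<otimes> (x \<otimes> y) = y"
  by (simp add: m_assoc[symmetric])

lemma mult_inv_cancel: "\<lbrakk>x \<in> carrier G; y \<in> carrier G\<rbrakk> \<Longrightarrow> x \<otimes> (inv x \<otimes> y) = y"
  by (simp add: m_assoc[symmetric])

lemma dist_translate: "\<lbrakk>g \<in> carrier G; x \<in> carrier G; y \<in> carrier G\<rbrakk> \<Longrightarrow>
    dist (g \<otimes> x) (g \<otimes> y) = dist x y"
  unfolding dist_def by (simp add: inv_mult_group m_assoc inv_mult_cancel)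

lemma dist_one [simp]: "x \<in> carrier G \<Longrightarrow> dist \<one> x = len x"
  unfolding dist_def by simp

lemma dist_mult: "\<lbrakk>x \<in> carrier G; y \<in> carrier G\<rbrakk> \<Longrightarrow> dist x (x \<otimes> y) = len y"
  unfolding dist_def by (simp add: inv_mult_cancel)

lemma len_one [simp]: "len \<one> = 0" using len_zero_iff by simp

sublocale graph_metric "carrier G" dist
proof
  fix x y z k assume x: "x \<in> carrier G" and y: "y \<in> carrier G"
  show "dist x y = 0 \<longleftrightarrow> x = y"
    using x y len_zero_iff[of "inv x \<otimes> y"] inv_equality[of x y] unfolding dist_def
    by (metis inv_closed inv_inv inv_solve_left l_inv m_closed one_closed r_one)
  show "dist x y = dist y x"
    using len_inv[of "inv x \<otimes> y"] x y unfolding dist_def by (simp add: inv_mult_group)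
  show "dist x z \<le> dist x y + dist y z" if "z \<in> carrier G"
    using len_mult[of "inv x \<otimes> y" "inv y \<otimes> z"] x y that unfolding dist_def
    by (simp add: m_assoc mult_inv_cancel)
  show "\<exists>z\<in>carrier G. dist x z = k \<and> dist z y = dist x y - k" if k: "k \<le> dist x y"
  proof -
    obtain a b where ab: "a \<in> carrier G" "b \<in> carrier G" "inv x \<otimes> y = a \<otimes> b" "len a = k" 
        "len b = dist x y - k"
      using len_split[of "inv x \<otimes> y" k] x y k unfolding dist_def by auto
    have "y = x \<otimes> a \<otimes> b" using mult_inv_cancel[of x y] ab x y by (simp add: m_assoc)
    then show ?thesis using ab x dist_mult[of x a] dist_mult[of "x \<otimes> a" b]
      by (intro bexI[of _ "x \<otimes> a"]) auto
  qed
qed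

definition Ball :: "nat \<Rightarrow> 'a set" where "Ball n = {x \<in> carrier G. len x \<le> n}"
definition Sphere :: "nat \<Rightarrow> 'a set" where "Sphere n = {x \<in> carrier G. len x = n}"

lemma finite_Ball [simp]: "finite (Ball n)" unfolding Ball_def by (rule finite_len_le)
lemma finite_Sphere [simp]: "finite (Sphere n)"
  by (rule finite_subset[OF _ finite_Ball[of n]]) (auto simp: Ball_def Sphere_def)

lemma Ball_nonempty: "card (Ball n) > 0"
proof -
  have "\<one> \<in> Ball n" unfolding Ball_def by simp
  then show ?thesis using finite_Ball by (auto simp: card_gt_0_iff)
qed

lemma card_dist_le:
  assumes "x \<in> carrier G"
  shows "finite {y \<in> carrier G. dist x y \<le> r}" "card {y \<in> carrier G. dist x y \<le> r} \<le> card (Ball r)"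
proof -
  have "{y \<in> carrier G. dist x y \<le> r} \<subseteq> (\<lambda>u. x \<otimes> u) ` Ball r"
  proof
    fix y assume "y \<in> {y \<in> carrier G. dist x y \<le> r}"
    then show "y \<in> (\<lambda>u. x \<otimes> u) ` Ball r"
      using assms mult_inv_cancel[of x y] unfolding Ball_def dist_def
      by (intro image_eqI[of _ _ "inv x \<otimes> y"]) auto
  qed
  then show "finite {y \<in> carrier G. dist x y \<le> r}" "card {y \<in> carrier G. dist x y \<le> r} \<le> card (Ball r)"
    using finite_Ball finite_surj surj_card_le by blast+
qed

lemma card_le_Ball_of_diam:
  assumes "A \<subseteq> carrier G" "\<And>x y. \<lbrakk>x \<in> A; y \<in> A\<rbrakk> \<Longrightarrow> dist x y \<le> r"
  shows "card A \<le> card (Ball r)"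
proof (cases "A = {}")
  case False
  then obtain x where "x \<in> A" by blast
  then have "A \<subseteq> {y \<in> carrier G. dist x y \<le> r}" using assms by auto
  then show ?thesis using card_dist_le[of x r] card_mono \<open>x \<in> A\<close> assms(1) by (meson le_trans subsetD)
qed auto

text \<open>
  An infinite-order element \<open>q\<close> puts linearly many elements of every coset \<open>\<langle>q\<rangle> \<gamma>\<close> into the
  balls, so linear growth leaves room for finitely many cosets only.
\<close>
lemma elementary_of_linear_growth:
  assumes lin: "\<And>n. card (Ball n) \<le> K * (n + 1)"
    and q: "q \<in> carrier G" "\<And>n::nat. n > 0 \<Longrightarrow> q [^] n \<noteq> \<one>"
  shows "elementary_group G"
proof -
  define H where "H = generate G {q}"
  have H: "subgroup H G" unfolding H_def by (rule generate_is_subgroup) (use q in auto)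
  have qn: "q [^] n \<in> H" for n :: nat
    by (induction n) (use H q in \<open>auto intro: subgroup.one_closed subgroup.m_closed simp: H_def generate.incl\<close>)
  have "finite (rcosets H)"
  proof (rule ccontr)
    assume "infinite (rcosets H)"
    \<comment> \<open>One coset more than \<open>K * (len q + 1)\<close>: the products
      \<open>q [^] k \<otimes> g c\<close> with \<open>k \<le> n\<close> then outnumber the ball of
      radius \<open>n * (len q + 1)\<close>.\<close>
    then obtain C where C: "C \<subseteq> rcosets H" "finite C" "card C = K * (len q + 1) + 1"
      using infinite_arbitrarily_large by blast
    have "\<exists>g. g \<in> carrier G \<and> c = H #> g" if "c \<in> C" for c
      using that C(1) unfolding RCOSETS_def by auto
    then obtain g where g: "\<And>c. c \<in> C \<Longrightarrow> g c \<in> carrier G \<and> c = H #> g c" by metis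
    define n where "n = Max (insert 0 ((\<lambda>c. len (g c)) ` C))"
    have n: "len (g c) \<le> n" if "c \<in> C" for c unfolding n_def using that C by (intro Max_ge) auto
    define \<phi> where "\<phi> = (\<lambda>(c, k::nat). q [^] k \<otimes> g c)"
    have len_pow: "len (q [^] k) \<le> k * len q" for k :: nat
    proof (induction k)
      case (Suc k)
      then show ?case using len_mult[of "q [^] k" q] q by auto
    qed auto
    have "\<phi> ` (C \<times> {..n}) \<subseteq> Ball (n * (len q + 1))"
    proof (clarsimp simp: \<phi>_def Ball_def)
      fix c k assume ck: "c \<in> C" "k \<le> n"
      have "len (q [^] k \<otimes> g c) \<le> k * len q + n"
        using len_mult[of "q [^] k" "g c"] len_pow[of k] n ck g q by fastforce
      also have "\<dots> \<le> n * len q + n" using ck by (intro add_mono mult_right_mono) auto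
      finally show "q [^] k \<otimes> g c \<in> carrier G \<and> len (q [^] k \<otimes> g c) \<le> n + n * len q"
        using g ck q by auto
    qed
    moreover have "inj_on \<phi> (C \<times> {..n})"
    proof (rule inj_onI, clarsimp simp: \<phi>_def)
      fix c k c' k' assume A: "c \<in> C" "k \<le> n" "c' \<in> C" "k' \<le> n" "q [^] k \<otimes> g c = q [^] k' \<otimes> g c'"
      have coset: "H #> (q [^] i \<otimes> g b) = b" if "b \<in> C" for b and i :: nat
      proof -
        have "H #> (q [^] i \<otimes> g b) = (H #> q [^] i) #> g b"
          using coset_mult_assoc[of H "q [^] i" "g b"] H subgroup.subset g that q by auto
        also have "H #> q [^] i = H" using coset_join2[OF _ H qn] q by auto
        finally show ?thesis using g that by simp
      qed
      have cc: "c = c'" using coset[OF A(1), of k] coset[OF A(3), of k'] A(5) by simp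
      then have eq: "q [^] k = q [^] k'" using A g q by (metis nat_pow_closed right_cancel)
      have "k = k'"
      proof (rule ccontr)
        have no: "q [^] i \<noteq> q [^] j" if "i < j" for i j :: nat
        proof
          assume "q [^] i = q [^] j"
          then have "q [^] i \<otimes> \<one> = q [^] i \<otimes> q [^] (j - i)"
            using nat_pow_mult[OF q(1), of i "j - i"] that q by simp
          then have "q [^] (j - i) = \<one>" using q(1) by (simp del: r_one)
          then show False using q(2)[of "j - i"] that by simp
        qed
        assume "k \<noteq> k'"
        then show False using no[of k k'] no[of k' k] eq by (metis nat_neq_iff)
      qed
      then show "c = c' \<and> k = k'" using cc by simp
    qed
    ultimately have "card (C \<times> {..n}) \<le> card (Ball (n * (len q + 1)))"
      using card_inj_on_le finite_Ball by blast
    also have "\<dots> \<le> K * (n * (len q + 1) + 1)" by (rule lin)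
    also have "\<dots> \<le> K * ((len q + 1) * (n + 1))" by (intro mult_left_mono) auto
    finally have "(K * (len q + 1) + 1) * (n + 1) \<le> (K * (len q + 1)) * (n + 1)"
      unfolding card_cartesian_product C(3) card_atMost Suc_eq_plus1 mult.assoc .
    then show False unfolding mult_le_cancel2 by linarith
  qed
  then show ?thesis using q(1) unfolding elementary_group_def H_def by blast
qed

end

section \<open>Spreading\<close>

locale hyperbolic_length = length_group +
  fixes \<Delta> :: nat
  assumes hyp: "four_point (carrier G) dist \<Delta>"
begin

lemma gp_self: "x \<in> carrier G \<Longrightarrow> gp dist \<one> x x = 2 * int (len x)"
  using zero[of x x] unfolding gp_def by simp

lemma len_ge_diff: "\<lbrakk>f \<in> carrier G; x \<in> carrier G\<rbrakk> \<Longrightarrow> len x \<le> len f + len (f \<otimes> x)"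
  using len_mult[of "inv f" "f \<otimes> x"] by (simp add: inv_mult_cancel len_inv)

text \<open>The first two conditions put the displacement
  \<open>len (f \<otimes> \<gamma> t) - t\<close> between \<open>len (f \<otimes> h) - len h\<close>
  and that number plus \<open>\<Delta>\<close>, independently of \<open>t\<close>; the third keeps
  the index of \<open>\<gamma>\<close> in range.\<close>

definition shifts_geodesic :: "'a \<Rightarrow> (nat \<Rightarrow> 'a) \<Rightarrow> 'a \<Rightarrow> nat \<Rightarrow> bool" where
  "shifts_geodesic h \<gamma> f t \<longleftrightarrow> len h + len (f \<otimes> \<gamma> t) \<le> t + len (f \<otimes> h) + \<Delta> \<and> t + len (f \<otimes> h) \<le> len h + len (f \<otimes> \<gamma> t) \<and>
       len (f \<otimes> \<gamma> t) \<le> len h \<and> dist (f \<otimes> \<gamma> t) (\<gamma> (len (f \<otimes> \<gamma> t))) \<le> 3 * \<Delta>"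

text \<open>
  The points \<open>f \<otimes> h\<close> with \<open>f\<close> in the ball all lie in the direction of \<open>inv g\<close>, hence in that of \<open>h\<close>;
  so \<open>f\<close> slides the geodesic from \<open>\<one>\<close> to \<open>h\<close> along itself, by about \<open>len (f \<otimes> h) - len h\<close>.
\<close>
lemma common_direction:
  assumes fail: "\<And>C. \<exists>g\<in>carrier G. \<exists>h\<in>carrier G. \<forall>f\<in>Ball R. len (g \<otimes> f \<otimes> h) + C < len g + len h"
  shows "\<exists>h\<in>carrier G. \<exists>\<gamma>. geodesic_path (carrier G) dist \<one> h \<gamma> \<and> U + R \<le> len h \<and>
    (\<forall>f\<in>Ball R. \<forall>t. R + \<Delta> < t \<longrightarrow> t \<le> U \<longrightarrow> shifts_geodesic h \<gamma> f t)"
proof -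
  \<comment> \<open>\<open>R\<close> is lost when \<open>f \<otimes> h\<close> replaces
    \<open>h\<close>, and \<open>\<Delta>\<close> in the four-point inequality; the rest makes
    \<open>f \<otimes> h\<close> and \<open>h\<close> run together up to length about
    \<open>U + R\<close>.\<close>
  define C where "C = R + \<Delta> + 2 * (U + R)"
  obtain g h where gh: "g \<in> carrier G" "h \<in> carrier G"
      "\<And>f. f \<in> Ball R \<Longrightarrow> len (g \<otimes> f \<otimes> h) + C < len g + len h"
    using fail[of C] by blast
  have BallD: "f \<in> carrier G" "len f \<le> R" if "f \<in> Ball R" for f using that unfolding Ball_def by auto
  have one: "\<one> \<in> Ball R" unfolding Ball_def by simp
  have toward_g: "int C \<le> gp dist \<one> (inv g) (f \<otimes> h) + int R" if f: "f \<in> Ball R" for f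
  proof -
    have "dist (inv g) (f \<otimes> h) = len (g \<otimes> f \<otimes> h)"
      using gh BallD[OF f] unfolding dist_def by (simp add: m_assoc)
    then show ?thesis
      using gh(3)[OF f] len_ge_diff[of f h] BallD[OF f] gh(1,2) unfolding gp_def by (simp add: len_inv)
  qed
  have gpC: "2 * int (U + R) \<le> gp dist \<one> (f \<otimes> h) h" if f: "f \<in> Ball R" for f
  proof -
    have "gp dist \<one> (f \<otimes> h) (inv g) = gp dist \<one> (inv g) (f \<otimes> h)"
      using sym[of "f \<otimes> h" "inv g"] gh BallD[OF f] unfolding gp_def by simp
    then show ?thesis
      using four_pointD[OF hyp, of \<one> "f \<otimes> h" "inv g" h] toward_g[OF f] toward_g[OF one] gh BallD[OF f]
      unfolding C_def by auto
  qed
  have long: "U + R \<le> len h" using gpC[OF one] gp_self[of h] gh by simp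
  obtain \<gamma> where \<gamma>: "geodesic_path (carrier G) dist \<one> h \<gamma>" using geodesic_path_exists gh by blast
  note geo = geodesic_pathD[OF \<gamma>, simplified dist_one[OF gh(2)]]
  have main: "shifts_geodesic h \<gamma> f t"
    if f: "f \<in> Ball R" and t: "R + \<Delta> < t" "t \<le> U" for f t
  proof -
    note fM = BallD[OF f]
    define x where "x = \<gamma> t"
    have tl: "t \<le> len h" using t long by simp
    have x: "x \<in> carrier G" "len x = t" "dist x h = len h - t"
      using geo(3)[OF tl] geo(4)[of 0 t] geo(4)[of t "len h"] geo(1,2) tl dist_one[of "\<gamma> t"]
      unfolding x_def by auto
    have fx: "f \<otimes> x \<in> carrier G" "f \<otimes> h \<in> carrier G" using fM x gh by auto
    have d1: "dist f (f \<otimes> x) = t" "dist f (f \<otimes> h) = len h" "dist (f \<otimes> x) (f \<otimes> h) = len h - t"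
      using dist_mult[of f] dist_translate[of f x h] x gh fM by auto
    have lower: "t \<le> R + len (f \<otimes> x)" using len_ge_diff[of f x] fM x by auto
    \<comment> \<open>The first alternative is excluded by \<open>R + \<Delta> < t\<close>; the
      second compares the displacements of \<open>x\<close> and \<open>h\<close>.\<close>
    have "len (f \<otimes> x) + len h \<le> max (len f + (len h - t)) (len (f \<otimes> h) + t) + \<Delta>"
      using four_point_sum[OF hyp, of \<one> f "f \<otimes> x" "f \<otimes> h"] fM fx d1 by simp
    then have a: "len h + len (f \<otimes> x) \<le> t + len (f \<otimes> h) + \<Delta>"
      using lower t tl fM(2) by (auto simp: max_def split: if_splits)
    have b: "t + len (f \<otimes> h) \<le> len h + len (f \<otimes> x)"
      using tri[of \<one> "f \<otimes> x" "f \<otimes> h"] fx d1 tl by auto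
    define s where "s = len (f \<otimes> x)"
    have s: "s \<le> U + R" unfolding s_def using len_mult[of f x] fM x t by auto
    have sl: "s \<le> len h" using s long by simp
    have y: "\<gamma> s \<in> carrier G" "len (\<gamma> s) = s" "dist (\<gamma> s) h = len h - s"
      using geo(3)[OF sl] geo(4)[of 0 s] geo(4)[of s "len h"] geo(1,2) sl dist_one[of "\<gamma> s"] by auto
    \<comment> \<open>Comparison of \<open>f \<otimes> x\<close> with \<open>f \<otimes> h\<close>,
      then with \<open>h\<close>, then with \<open>\<gamma> s\<close> loses one
      \<open>\<Delta>\<close> each time.\<close>
    have "gp dist \<one> (f \<otimes> x) (f \<otimes> h) \<ge> 2 * int s - int \<Delta>"
      using a fx d1 tl unfolding gp_def s_def by simp
    then have "gp dist \<one> (f \<otimes> x) h \<ge> 2 * int s - 2 * int \<Delta>"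
      using four_pointD[OF hyp, of \<one> "f \<otimes> x" "f \<otimes> h" h] gpC[OF f] fx gh s by auto
    moreover have "gp dist \<one> h (\<gamma> s) = 2 * int s"
      using y gh sl sym[of h "\<gamma> s"] unfolding gp_def by simp
    ultimately have "gp dist \<one> (f \<otimes> x) (\<gamma> s) \<ge> 2 * int s - 3 * int \<Delta>"
      using four_pointD[OF hyp, of \<one> "f \<otimes> x" h "\<gamma> s"] fx gh y by auto
    then have "dist (f \<otimes> x) (\<gamma> s) \<le> 3 * \<Delta>"
      using y fx unfolding gp_def s_def by simp
    then show ?thesis using a b sl unfolding s_def x_def shifts_geodesic_def by blast
  qed
  show ?thesis using gh(2) \<gamma> long main by blast
qed

text \<open>Right multiplication by \<open>x\<close> is injective, and its image lies in the
  \<open>r\<close>-neighbourhood of at most \<open>w + 1\<close> points of the geodesic.\<close>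

lemma card_moved:
  assumes "h \<in> carrier G" "x \<in> carrier G" and geo: "geodesic_path (carrier G) dist \<one> h \<gamma>"
    and A: "A \<subseteq> carrier G" "finite A"
    and near: "\<And>f. f \<in> A \<Longrightarrow> a \<le> len (f \<otimes> x) \<and> len (f \<otimes> x) \<le> a + w \<and> len (f \<otimes> x) \<le> len h \<and>
       dist (f \<otimes> x) (\<gamma> (len (f \<otimes> x))) \<le> r"
  shows "card A \<le> (w + 1) * card (Ball r)"
proof -
  define B where "B s = {y \<in> carrier G. dist (\<gamma> s) y \<le> r}" for s
  define I where "I = {s. a \<le> s \<and> s \<le> a + w \<and> s \<le> len h}"
  have \<gamma>M: "\<gamma> s \<in> carrier G" if "s \<le> len h" for s using geodesic_pathD(3)[OF geo] assms(1) that by simp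
  have "I \<subseteq> {a..a+w}" unfolding I_def by auto
  then have I: "finite I" "card I \<le> w + 1" using card_mono[of "{a..a+w}" I] finite_subset by auto
  have "(\<lambda>f. f \<otimes> x) ` A \<subseteq> (\<Union>s\<in>I. B s)"
  proof (rule image_subsetI)
    fix f assume f: "f \<in> A"
    then have "dist (\<gamma> (len (f \<otimes> x))) (f \<otimes> x) \<le> r"
      using near[OF f] sym[of "f \<otimes> x" "\<gamma> (len (f \<otimes> x))"] \<gamma>M A assms(2) by auto
    then show "f \<otimes> x \<in> (\<Union>s\<in>I. B s)" using near[OF f] f A assms(2) unfolding I_def B_def by blast
  qed
  moreover have fB: "finite (B s)" "card (B s) \<le> card (Ball r)" if "s \<in> I" for s
    using card_dist_le[of "\<gamma> s" r] \<gamma>M that unfolding B_def I_def by auto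
  moreover have "inj_on (\<lambda>f. f \<otimes> x) A" using A assms(2) by (intro inj_onI) (auto dest: right_cancel[THEN iffD1, rotated -1])
  ultimately have "card A \<le> card (\<Union>s\<in>I. B s)" using I by (intro card_inj_on_le) auto
  also have "\<dots> \<le> (\<Sum>s\<in>I. card (B s))" by (rule card_UN_le[OF I(1)])
  also have "\<dots> \<le> (\<Sum>s\<in>I. card (Ball r))" by (rule sum_mono) (use fB in auto)
  also have "\<dots> \<le> (w + 1) * card (Ball r)"
    unfolding sum_constant of_nat_id using I(2) by (rule mult_right_mono) simp
  finally show ?thesis .
qed

text \<open>
  The assumption makes \<open>f \<mapsto> len (f \<otimes> h) - len h\<close> a quasi-homomorphism on arbitrarily large balls with
  fibres of bounded size; elements of finite order have values near 0.
\<close>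
lemma elementary_of_common_direction:
  assumes fail: "\<And>R C. \<exists>g\<in>carrier G. \<exists>h\<in>carrier G. \<forall>f\<in>Ball R. len (g \<otimes> f \<otimes> h) + C < len g + len h"
    and inf: "infinite (carrier G)"
  shows "elementary_group G"
proof -
  define K where "K = card (Ball (3 * \<Delta>))"
  have lin: "card (Ball R) \<le> ((\<Delta> + 3) * K) * (R + 1)" for R
  proof -
    define t where "t = R + \<Delta> + 1"
    obtain h \<gamma> where h: "h \<in> carrier G" "geodesic_path (carrier G) dist \<one> h \<gamma>" "t + R \<le> len h"
      and shift: "\<And>f t'. \<lbrakk>f \<in> Ball R; R + \<Delta> < t'; t' \<le> t\<rbrakk> \<Longrightarrow> shifts_geodesic h \<gamma> f t'"
      using common_direction[where R=R and U=t, OF fail] by blast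
    note shift' = shift[unfolded shifts_geodesic_def]
    have xM: "\<gamma> t \<in> carrier G" "len (\<gamma> t) = t"
      using geodesic_pathD(1,3)[OF h(2)] geodesic_pathD(4)[OF h(2), of 0 t] h(1,3)
        dist_one[of "\<gamma> t"] by auto
    have "card (Ball R) \<le> ((2 * R + \<Delta> + 1) + 1) * card (Ball (3 * \<Delta>))"
    proof (rule card_moved[OF h(1) xM(1) h(2), where a = 0])
      fix f assume f: "f \<in> Ball R"
      then have "len (f \<otimes> \<gamma> t) \<le> 2 * R + \<Delta> + 1"
        using len_mult[of f "\<gamma> t"] xM unfolding Ball_def t_def by auto
      then show "0 \<le> len (f \<otimes> \<gamma> t) \<and> len (f \<otimes> \<gamma> t) \<le> 0 + (2 * R + \<Delta> + 1) \<and> len (f \<otimes> \<gamma> t) \<le> len h \<and>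
        dist (f \<otimes> \<gamma> t) (\<gamma> (len (f \<otimes> \<gamma> t))) \<le> 3 * \<Delta>"
        using shift'[OF f, of t] unfolding t_def by auto
    qed (use finite_Ball[of R] in \<open>auto simp: Ball_def\<close>)
    also have "\<dots> \<le> ((\<Delta> + 3) * (R + 1)) * K"
      unfolding K_def by (intro mult_right_mono) (auto simp: algebra_simps)
    finally show ?thesis by (simp add: mult.commute mult.left_commute)
  qed
  have "\<exists>q\<in>carrier G. \<forall>n::nat. n > 0 \<longrightarrow> q [^] n \<noteq> \<one>"
  proof (rule ccontr)
    assume "\<not> ?thesis"
    then have "\<forall>q\<in>carrier G. \<exists>n::nat. n > 0 \<and> q [^] n = \<one>" by blast
    then obtain N :: "'a \<Rightarrow> nat" where N: "\<And>q. q \<in> carrier G \<Longrightarrow> N q > 0 \<and> q [^] N q = \<one>" by metis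
    \<comment> \<open>Torsion elements will turn out to have
      \<open>\<bar>b q\<bar> \<le> 5 * \<Delta>\<close>, so they move \<open>\<gamma> t\<close> to
      lengths in a window of width \<open>11 * \<Delta>\<close>; this is one element more than such
      a window admits.\<close>
    obtain E where E: "E \<subseteq> carrier G" "finite E" "card E = (11 * \<Delta> + 1) * K + 1"
      using infinite_arbitrarily_large[OF inf] by blast
    define P where "P = (\<lambda>(q, n). len (q [^] (n::nat))) ` (SIGMA q:E. {..N q})"
    \<comment> \<open>Large enough for all powers up to the exponents \<open>N q\<close>, so that
      the quasi-homomorphism estimate applies along each cyclic group.\<close>
    define R where "R = Max (insert 0 P)"
    have "finite P" unfolding P_def using E by auto
    have R: "q [^] n \<in> Ball R" if "q \<in> E" "n \<le> N q" for q and n :: nat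
    proof -
      have "len (q [^] n) \<in> P" unfolding P_def using that by force
      then have "len (q [^] n) \<le> R" unfolding R_def using \<open>finite P\<close> by (intro Max_ge) auto
      then show ?thesis unfolding Ball_def using that E by auto
    qed
    \<comment> \<open>After one move by an element of \<open>Ball R\<close> the position still
      exceeds \<open>R + \<Delta>\<close> and is at most \<open>U\<close>, so a second move is
      controlled as well.\<close>
    define t where "t = 2 * R + \<Delta> + 1"
    define U where "U = 3 * R + \<Delta> + 1"
    obtain h \<gamma> where h: "h \<in> carrier G" "geodesic_path (carrier G) dist \<one> h \<gamma>" "U + R \<le> len h"
      and shift: "\<And>f t'. \<lbrakk>f \<in> Ball R; R + \<Delta> < t'; t' \<le> U\<rbrakk> \<Longrightarrow> shifts_geodesic h \<gamma> f t'"
      using common_direction[where R=R and U=U, OF fail] by blast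
    note shift' = shift[unfolded shifts_geodesic_def]
    define b where "b f = int (len (f \<otimes> h)) - int (len h)" for f
    have \<gamma>M: "\<gamma> s \<in> carrier G" if "s \<le> len h" for s
      using geodesic_pathD(3)[OF h(2)] h(1) that by simp
    have lent: "len (\<gamma> t) = t" "\<gamma> t \<in> carrier G"
      using geodesic_pathD(1)[OF h(2)] geodesic_pathD(4)[OF h(2), of 0 t] h(1,3)
        dist_one[of "\<gamma> t"] \<gamma>M unfolding t_def U_def by auto
    \<comment> \<open>Three displacements, each known up to \<open>\<Delta>\<close>, and an error
      \<open>3 * \<Delta>\<close> for replacing \<open>f' \<otimes> \<gamma> t\<close> by
      \<open>\<gamma> s\<close>.\<close>
    have quasi: "b f + b f' - 4 * int \<Delta> \<le> b (f \<otimes> f')" "b (f \<otimes> f') \<le> b f + b f' + 5 * int \<Delta>"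
      if f: "f \<in> Ball R" "f' \<in> Ball R" "f \<otimes> f' \<in> Ball R" for f f'
    proof -
      have fM: "f \<in> carrier G" "f' \<in> carrier G" "len f' \<le> R" using f unfolding Ball_def by auto
      define s where "s = len (f' \<otimes> \<gamma> t)"
      have s: "R + \<Delta> < s" "s \<le> U"
        using len_mult[OF fM(2) lent(2)] len_ge_diff[OF fM(2) lent(2)] lent(1) fM(3)
        unfolding s_def t_def U_def by auto
      have t: "R + \<Delta> < t" "t \<le> U" unfolding t_def U_def by auto
      note 1 = shift'[OF f(2) t, folded s_def] and 2 = shift'[OF f(1) s] and 3 = shift'[OF f(3) t]
      have M: "f \<otimes> (f' \<otimes> \<gamma> t) \<in> carrier G" "f \<otimes> \<gamma> s \<in> carrier G" "f' \<otimes> \<gamma> t \<in> carrier G" "\<gamma> s \<in> carrier G"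
        using fM lent \<gamma>M 1 by auto
      have "dist (f \<otimes> (f' \<otimes> \<gamma> t)) (f \<otimes> \<gamma> s) \<le> 3 * \<Delta>" using 1 dist_translate fM M by auto
      then have "len (f \<otimes> (f' \<otimes> \<gamma> t)) \<le> len (f \<otimes> \<gamma> s) + 3 * \<Delta>"
        "len (f \<otimes> \<gamma> s) \<le> len (f \<otimes> (f' \<otimes> \<gamma> t)) + 3 * \<Delta>"
        using tri[OF one_closed M(2,1)] tri[OF one_closed M(1,2)] sym[OF M(1,2)] M by auto
      moreover have "f \<otimes> f' \<otimes> \<gamma> t = f \<otimes> (f' \<otimes> \<gamma> t)" using fM lent m_assoc by auto
      ultimately show "b f + b f' - 4 * int \<Delta> \<le> b (f \<otimes> f')" "b (f \<otimes> f') \<le> b f + b f' + 5 * int \<Delta>"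
        using 1 2 3 unfolding b_def by auto
    qed
    have b1: "b \<one> = 0" unfolding b_def using h by simp
    have bE: "\<bar>b q\<bar> \<le> 5 * int \<Delta>" if q: "q \<in> E" for q
    proof -
      have qM: "q \<in> carrier G" using q E by auto
      have pw: "int n * (b q - 4 * int \<Delta>) \<le> b (q [^] n) \<and> b (q [^] n) \<le> int n * (b q + 5 * int \<Delta>)"
        if "n \<le> N q" for n :: nat
        using that
      proof (induction n)
        case (Suc n)
        have B: "q [^] n \<in> Ball R" "q \<in> Ball R" "q [^] n \<otimes> q \<in> Ball R"
          using R[OF q, of n] R[OF q, of 1] R[OF q, of "Suc n"] Suc N[OF qM] qM by auto
        then show ?case using quasi[OF B] Suc by (simp add: algebra_simps)
      qed (use b1 in auto)
      \<comment> \<open>At the exponent \<open>N q\<close> the power is \<open>\<one>\<close>, where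
        \<open>b\<close> vanishes; this leaves no room for a drift.\<close>
      have "int (N q) * (b q - 4 * int \<Delta>) \<le> 0" "0 \<le> int (N q) * (b q + 5 * int \<Delta>)"
        using pw[of "N q"] N[OF qM] b1 by auto
      then have "b q - 4 * int \<Delta> \<le> 0" "0 \<le> b q + 5 * int \<Delta>"
        using N[OF qM] by (auto simp: mult_le_0_iff zero_le_mult_iff)
      then show ?thesis by auto
    qed
    have "card E \<le> (11 * \<Delta> + 1) * card (Ball (3 * \<Delta>))"
    proof (rule card_moved[OF h(1) lent(2) h(2) E(1,2), where a = "t - 5 * \<Delta>"])
      fix f assume f: "f \<in> E"
      have "f \<in> Ball R" using R[OF f, of 1] N[of f] f E by force
      then show "t - 5 * \<Delta> \<le> len (f \<otimes> \<gamma> t) \<and> len (f \<otimes> \<gamma> t) \<le> t - 5 * \<Delta> + 11 * \<Delta> \<and> len (f \<otimes> \<gamma> t) \<le> len h \<and>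
        dist (f \<otimes> \<gamma> t) (\<gamma> (len (f \<otimes> \<gamma> t))) \<le> 3 * \<Delta>"
        using shift'[of f t] bE[OF f] unfolding b_def t_def U_def by auto
    qed
    then show False using E(3) unfolding K_def by simp
  qed
  then obtain q where "q \<in> carrier G" "\<And>n::nat. n > 0 \<Longrightarrow> q [^] n \<noteq> \<one>" by blast
  then show ?thesis using elementary_of_linear_growth[of "(\<Delta> + 3) * K"] lin by blast
qed

end

section \<open>Growth of spheres\<close>

text \<open>Fekete's argument for \<open>ln (s n)\<close>, which is subadditive and, up to
  \<open>ln K\<close>, superadditive. The infimum of \<open>b n / n\<close> serves for the lower
  bound; comparing \<open>b (n * m)\<close> along both factors gives the upper bound with a single
  error \<open>ln K\<close>. A value above \<open>K\<close> makes the rate positive.\<close>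

lemma exponential_growth_of_quasi_multiplicative:
  fixes s :: "nat \<Rightarrow> real"
  assumes ge1: "\<And>n. 1 \<le> s n"
    and sub: "\<And>n m. s (n + m) \<le> s n * s m"
    and super: "\<And>n m. s n * s m \<le> K * s (n + m)"
    and unbounded: "\<And>B. \<exists>n. B < s n"
  shows "\<exists>q>1. \<forall>n. q ^ (2 * n) \<le> s n \<and> s n \<le> K * q ^ (2 * n)"
proof -
  define b where "b n = ln (s n)" for n
  have pos: "s n > 0" for n using ge1[of n] by linarith
  have s0: "s 0 \<le> K" using super[of 0 0] pos[of 0] by simp
  then have K: "K \<ge> 1" using ge1[of 0] by linarith
  have b0: "b n \<ge> 0" for n unfolding b_def using ge1 by simp
  have up: "b (n * m) \<le> real m * b n" if "m > 0" for n m
    using that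
  proof (induction m rule: nat_induct_non_zero)
    case (Suc m)
    have "b (n * Suc m) \<le> ln (s n * s (n * m))"
      unfolding b_def mult_Suc_right using sub[of n "n * m"] pos by (simp add: mult_pos_pos)
    also have "\<dots> = b n + b (n * m)" unfolding b_def using pos[of n] pos[of "n * m"] by (simp add: ln_mult)
    finally show ?case using Suc by (simp add: algebra_simps)
  qed simp
  have low: "real m * b n \<le> real m * ln K + b (n * m)" if "m > 0" for n m
    using that
  proof (induction m rule: nat_induct_non_zero)
    case 1
    then show ?case using K by simp
  next
    case (Suc m)
    have "b n + b (n * m) = ln (s n * s (n * m))" unfolding b_def using pos[of n] pos[of "n * m"] by (simp add: ln_mult)
    also have "\<dots> \<le> ln (K * s (n * Suc m))"
      using super[of n "n * m"] pos K by (simp add: mult_pos_pos)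
    also have "\<dots> = ln K + b (n * Suc m)" unfolding b_def using pos[of "n * Suc m"] K by (simp add: ln_mult)
    finally show ?case using Suc by (simp add: algebra_simps)
  qed
  define A where "A = (\<lambda>n. b n / real n) ` {1..}"
  define \<beta> where "\<beta> = Inf A"
  have A: "A \<noteq> {}" "bdd_below A" unfolding A_def using b0 by (auto intro!: bdd_belowI[of _ 0])
  have \<beta>1: "real n * \<beta> \<le> b n" for n
  proof (cases "n = 0")
    case False
    then have "\<beta> \<le> b n / real n" unfolding \<beta>_def using A by (intro cInf_lower) (auto simp: A_def)
    then show ?thesis using False by (simp add: field_simps)
  qed (use b0 in auto)
  have \<beta>2: "b n \<le> ln K + real n * \<beta>" for n
  proof (cases "n = 0")
    case True
    then show ?thesis unfolding b_def using s0 pos[of 0] by simp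
  next
    case False
    have "(b n - ln K) / real n \<le> \<beta>" unfolding \<beta>_def
    proof (rule cInf_greatest[OF A(1)])
      fix a assume "a \<in> A"
      then obtain m where m: "m \<ge> 1" "a = b m / real m" unfolding A_def by auto
      have "real m * b n \<le> real m * ln K + real n * b m"
        using low[of m n] up[of n m] m False by (simp add: mult.commute)
      also have "\<dots> = real m * (ln K + real n * a)" using m by (simp add: field_simps)
      finally have "b n \<le> ln K + real n * a" using m by (simp add: mult_le_cancel_left_pos)
      then show "(b n - ln K) / real n \<le> a" using False by (simp add: field_simps)
    qed
    then show ?thesis using False by (simp add: field_simps)
  qed
  obtain n where n: "K < s n" using unbounded by blast
  have "ln K < b n" unfolding b_def using n K pos by simp
  then have "0 < real n * \<beta>" using \<beta>2[of n] by linarith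
  then have "\<beta> > 0" by (simp add: zero_less_mult_iff)
  \<comment> \<open>Half the rate, since the square root of the sphere size is what enters the
    norms.\<close>
  define q where "q = exp (\<beta> / 2)"
  have q: "q ^ (2 * n) = exp (real n * \<beta>)" for n
    unfolding q_def by (simp add: exp_of_nat_mult[symmetric])
  have "q ^ (2 * n) \<le> s n \<and> s n \<le> K * q ^ (2 * n)" for n
  proof -
    have "s n = exp (b n)" unfolding b_def using pos by simp
    moreover have "K * exp (real n * \<beta>) = exp (ln K + real n * \<beta>)" using K by (simp add: exp_add)
    ultimately show ?thesis using \<beta>1[of n] \<beta>2[of n] q by simp
  qed
  moreover have "q > 1" unfolding q_def using \<open>\<beta> > 0\<close> by simp
  ultimately show ?thesis by blast
qed

context length_group
begin

lemma elementary_of_finite: "finite (carrier G) \<Longrightarrow> elementary_group G"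
  unfolding elementary_group_def RCOSETS_def by (intro bexI[of _ \<one>]) auto

lemma Sphere_nonempty:
  assumes "infinite (carrier G)"
  shows "card (Sphere n) \<ge> 1"
proof -
  have "\<not> carrier G \<subseteq> Ball n" using assms finite_Ball finite_subset by blast
  then obtain x where x: "x \<in> carrier G" "x \<notin> Ball n" by blast
  then have "n \<le> len x" unfolding Ball_def by simp
  then obtain y where "y \<in> Sphere n" using len_split[OF x(1)] unfolding Sphere_def by blast
  then have "card (Sphere n) > 0" using finite_Sphere card_gt_0_iff by blast
  then show ?thesis by simp
qed

lemma card_Ball: "card (Ball n) = (\<Sum>i\<le>n. card (Sphere i))"
proof -
  have "Ball n = (\<Union>i\<in>{..n}. Sphere i)" unfolding Ball_def Sphere_def by auto
  then show ?thesis by (simp add: card_UN_disjoint Sphere_def disjoint_iff finite_Sphere[unfolded Sphere_def])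
qed

lemma card_Sphere_add: "card (Sphere (n + m)) \<le> card (Sphere n) * card (Sphere m)"
proof -
  have "Sphere (n + m) \<subseteq> (\<lambda>(y, z). y \<otimes> z) ` (Sphere n \<times> Sphere m)"
  proof
    fix x assume x: "x \<in> Sphere (n + m)"
    then obtain y z where "y \<in> carrier G" "z \<in> carrier G" "x = y \<otimes> z" "len y = n" "len z = m"
      using len_split[of x n] unfolding Sphere_def by auto
    then show "x \<in> (\<lambda>(y, z). y \<otimes> z) ` (Sphere n \<times> Sphere m)"
      unfolding Sphere_def by force
  qed
  then have "card (Sphere (n + m)) \<le> card (Sphere n \<times> Sphere m)"
    by (rule surj_card_le[rotated]) simp
  then show ?thesis by (simp add: card_cartesian_product)
qed

end

locale spreading_group = hyperbolic_length +
  fixes R C :: nat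
  assumes nonelementary: "\<not> elementary_group G"
    and spread: "\<lbrakk>g \<in> carrier G; h \<in> carrier G\<rbrakk> \<Longrightarrow>
      \<exists>f\<in>Ball R. len g + len h \<le> len (g \<otimes> f \<otimes> h) + C"

lemma (in hyperbolic_length) spreading_group_of_nonelementary:
  assumes "\<not> elementary_group G"
  shows "\<exists>R C. spreading_group G len \<Delta> R C"
proof -
  have "infinite (carrier G)" using assms elementary_of_finite by blast
  then obtain R C where "\<not> (\<exists>g\<in>carrier G. \<exists>h\<in>carrier G. \<forall>f\<in>Ball R. len (g \<otimes> f \<otimes> h) + C < len g + len h)"
    using elementary_of_common_direction assms by blast
  then have "spreading_group_axioms G len R C"
    unfolding spreading_group_axioms_def using assms by (metis not_le)
  then show ?thesis using hyperbolic_length_axioms spreading_group.intro by blast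
qed

context spreading_group
begin

lemma infinite_carrier: "infinite (carrier G)" using nonelementary elementary_of_finite by blast

text \<open>The element found in \<open>elementary_of_common_direction\<close> depends on the
  failure of spreading; here spreading itself supplies one. For long \<open>h\<close> the length of
  \<open>q = h \<otimes> f\<close> nearly doubles under squaring, and a gain of more than
  \<open>\<Delta>\<close> in one step persists for all powers.\<close>

lemma infinite_order_element: "\<exists>q\<in>carrier G. \<forall>n::nat. n > 0 \<longrightarrow> q [^] n \<noteq> \<one>"
proof -
  \<comment> \<open>Covers the loss \<open>C\<close> in spreading and two losses \<open>R\<close>
    caused by \<open>f\<close>, and leaves a gain of \<open>\<Delta> + 1\<close>.\<close>
  have "Sphere (C + 2 * R + \<Delta> + 1) \<noteq> {}" using Sphere_nonempty[OF infinite_carrier, of "C + 2 * R + \<Delta> + 1"] by auto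
  then obtain h where h: "h \<in> carrier G" "len h = C + 2 * R + \<Delta> + 1" unfolding Sphere_def by blast
  obtain f where f: "f \<in> carrier G" "len f \<le> R" "2 * len h \<le> len (h \<otimes> f \<otimes> h) + C"
    using spread[OF h(1) h(1)] unfolding Ball_def by auto
  define q where "q = h \<otimes> f"
  have q: "q \<in> carrier G" unfolding q_def using h f by auto
  have "q \<otimes> q = h \<otimes> f \<otimes> h \<otimes> f" unfolding q_def using h f by (simp add: m_assoc)
  then have "len (h \<otimes> f \<otimes> h) \<le> len (q \<otimes> q) + R"
    using len_mult[of "q \<otimes> q" "inv f"] f h q len_inv[of f] by (simp add: m_assoc)
  moreover have "len q \<le> len h + R" unfolding q_def using len_mult[of h f] h f by auto
  ultimately have qq: "len q + \<Delta> < len (q \<otimes> q)" using h f by linarith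
  define a where "a n = len (q [^] n)" for n :: nat
  have d: "dist (q [^] i) (q [^] (i + j)) = a j" for i j :: nat
    using dist_mult[of "q [^] i" "q [^] j"] q unfolding a_def by (simp add: nat_pow_mult)
  have a12: "a 0 = 0" "a 1 = len q" "a 2 = len (q \<otimes> q)" unfolding a_def using q by (auto simp: numeral_2_eq_2)
  have step: "a n < a (Suc n)" for n
  proof (induction n)
    case 0
    show ?case using qq len_mult[OF q q] a12 by simp
  next
    case (Suc n)
    \<comment> \<open>The alternative \<open>a 1 + a n\<close> is too small, by the induction
      hypothesis and \<open>qq\<close>; so \<open>a (n + 2)\<close> must carry the bound.\<close>
    have "dist (q [^] (0::nat)) (q [^] (2::nat)) + dist (q [^] (1::nat)) (q [^] (n + 2))
      \<le> max (dist (q [^] (0::nat)) (q [^] (1::nat)) + dist (q [^] (2::nat)) (q [^] (n + 2)))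
            (dist (q [^] (0::nat)) (q [^] (n + 2)) + dist (q [^] (1::nat)) (q [^] (2::nat))) + \<Delta>"
      by (rule four_point_sum[OF hyp]) (use q in auto)
    then have "a 2 + a (n + 1) \<le> max (a 1 + a n) (a (n + 2) + a 1) + \<Delta>"
      using d[of 0 2] d[of 1 "n + 1"] d[of 0 1] d[of 2 n] d[of 0 "n + 2"] d[of 1 1]
      by (simp add: numeral_2_eq_2 add.commute)
    then show ?case using Suc qq a12 by (auto simp: max_def split: if_splits)
  qed
  have "n \<le> a n" for n
  proof (induction n)
    case (Suc n)
    then show ?case using step[of n] by simp
  qed simp
  then have "q [^] n \<noteq> \<one>" if "n > 0" for n :: nat
    using that unfolding a_def by (metis len_one not_le)
  then show ?thesis using q by blast
qed

lemma Sphere_unbounded: "\<exists>n. B < card (Sphere n)"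
proof (rule ccontr)
  assume "\<not> ?thesis"
  then have "card (Ball n) \<le> B * (n + 1)" for n
    unfolding card_Ball using sum_bounded_above[of "{..n}" "\<lambda>i. card (Sphere i)" B]
    by (simp add: not_less algebra_simps)
  then show False using elementary_of_linear_growth infinite_order_element nonelementary by metis
qed

text \<open>Spreading with an exact length: the \<open>C\<close> extra letters of \<open>h\<close>
  pay for the possible loss, and whatever exceeds \<open>a + k\<close> is split off as a short
  remainder \<open>r\<close>.\<close>

lemma prolong:
  assumes u: "u \<in> Sphere a" and h: "h \<in> Sphere (k + C)"
  shows "\<exists>f\<in>Ball R. \<exists>r\<in>Ball (C + R). \<exists>g\<in>Sphere (a + k). u \<otimes> f \<otimes> h = g \<otimes> r"
proof -
  have uh: "u \<in> carrier G" "h \<in> carrier G" "len u = a" "len h = k + C" using u h unfolding Sphere_def by auto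
  obtain f where f: "f \<in> carrier G" "len f \<le> R" "a + k \<le> len (u \<otimes> f \<otimes> h)"
    using spread[OF uh(1,2)] uh unfolding Ball_def by auto
  then obtain g r where "g \<in> carrier G" "r \<in> carrier G" "u \<otimes> f \<otimes> h = g \<otimes> r" "len g = a + k"
      "len r = len (u \<otimes> f \<otimes> h) - (a + k)"
    using len_split[of "u \<otimes> f \<otimes> h" "a + k"] uh by auto
  moreover have "len (u \<otimes> f \<otimes> h) \<le> a + R + (k + C)"
    using len_mult[of "u \<otimes> f" h] len_mult[of u f] uh f by auto
  ultimately show ?thesis using f unfolding Ball_def Sphere_def by force
qed

text \<open>In the counting below, \<open>h\<close> is read off from the product and bounded data;
  this makes the counting maps surjective.\<close>

lemma recover: "\<lbrakk>u \<in> carrier G; f \<in> carrier G; h \<in> carrier G; u \<otimes> f \<otimes> h = p\<rbrakk> \<Longrightarrow>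
    h = inv f \<otimes> (inv u \<otimes> p)"
  by (auto simp: m_assoc inv_mult_cancel)

text \<open>Prolonging the prefix of length \<open>j\<close> of \<open>x\<close> gives elements that
  follow \<open>x\<close> for about \<open>j\<close> letters and are then free to leave it; up to
  bounded ambiguity there is one for each element of \<open>Sphere (k + C)\<close>.\<close>

lemma card_Sphere_near:
  assumes x: "x \<in> carrier G" "j \<le> len x"
  shows "card (Sphere (k + C)) \<le> card (Ball R) * card (Ball (C + R)) *
    card {g \<in> Sphere (j + k). dist g x + j \<le> len x + k + 2 * (C + R)}"
proof -
  define A where "A = {g \<in> Sphere (j + k). dist g x + j \<le> len x + k + 2 * (C + R)}"
  have fA: "finite A" unfolding A_def by simp
  obtain u y where uy: "u \<in> carrier G" "y \<in> carrier G" "x = u \<otimes> y" "len u = j" "len y = len x - j"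
    using len_split[OF x] by blast
  have "Sphere (k + C) \<subseteq> (\<lambda>(f, r, g). inv f \<otimes> (inv u \<otimes> (g \<otimes> r))) ` (Ball R \<times> Ball (C + R) \<times> A)"
  proof
    fix h assume h: "h \<in> Sphere (k + C)"
    then obtain f r g where frg: "f \<in> Ball R" "r \<in> Ball (C + R)" "g \<in> Sphere (j + k)" "u \<otimes> f \<otimes> h = g \<otimes> r"
      using prolong[of u j h k] uy unfolding Sphere_def by auto
    have M: "f \<in> carrier G" "r \<in> carrier G" "g \<in> carrier G" "h \<in> carrier G" "len h = k + C" "len f \<le> R"
        "len r \<le> C + R"
      using frg h unfolding Ball_def Sphere_def by auto
    have "dist (u \<otimes> f \<otimes> h) x = dist (f \<otimes> h) y"
      using dist_translate[of u "f \<otimes> h" y] uy M by (simp add: m_assoc)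
    also have "\<dots> \<le> (R + (k + C)) + (len x - j)"
      using dist_diff_le[of "f \<otimes> h" \<one> y] sym[of "f \<otimes> h" \<one>] sym[of y \<one>] len_mult[of f h] M uy by auto
    finally have "dist g x \<le> (C + R) + ((R + (k + C)) + (len x - j))"
      using tri[of g "g \<otimes> r" x] dist_mult[of g r] M frg(4) x by auto
    then have "g \<in> A" using frg x unfolding A_def by auto
    then show "h \<in> (\<lambda>(f, r, g). inv f \<otimes> (inv u \<otimes> (g \<otimes> r))) ` (Ball R \<times> Ball (C + R) \<times> A)"
      using recover[OF uy(1) M(1,4) frg(4)] frg by force
  qed
  then have "card (Sphere (k + C)) \<le> card (Ball R \<times> Ball (C + R) \<times> A)"
    by (rule surj_card_le[rotated]) (use fA in simp)
  then show ?thesis unfolding A_def by (simp add: card_cartesian_product mult.assoc)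
qed

text \<open>A pair \<open>(g, h)\<close> is encoded by its trimmed product \<open>p\<close>. All
  admissible \<open>g\<close> have length \<open>n\<close> and lie nearly on the way to
  \<open>p\<close>, hence close to each other, so each \<open>p\<close> is hit boundedly
  often.\<close>

lemma card_Sphere_mult_shift:
  "card (Sphere n) * card (Sphere (m + C)) \<le>
     card (Sphere (n + m)) * (card (Ball (2 * (C + R) + \<Delta>)) * (card (Ball R) * card (Ball (C + R))))"
proof -
  define W where "W p = {g \<in> Sphere n. dist g p \<le> m + 2 * (C + R)}" for p
  have W: "card (W p) \<le> card (Ball (2 * (C + R) + \<Delta>))" if p: "p \<in> Sphere (n + m)" for p
  proof (rule card_le_Ball_of_diam)
    fix g g' assume "g \<in> W p" "g' \<in> W p"
    then have M: "g \<in> carrier G" "g' \<in> carrier G" "p \<in> carrier G" and l: "len g = n" "len g' = n" "len p = n + m"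
        "dist g p \<le> m + 2 * (C + R)" "dist g' p \<le> m + 2 * (C + R)"
      using p unfolding W_def Sphere_def by auto
    show "dist g g' \<le> 2 * (C + R) + \<Delta>"
      using four_point_sum[OF hyp one_closed M(1,3,2)] sym[OF M(3,2)] l M
      by (auto simp: max_def split: if_splits)
  qed (auto simp: W_def Sphere_def)
  define T where "T = (SIGMA p:Sphere (n + m). W p \<times> (Ball R \<times> Ball (C + R)))"
  have fW: "finite (W p)" for p unfolding W_def by simp
  have fT: "finite T" unfolding T_def using fW by auto
  have "Sphere n \<times> Sphere (m + C) \<subseteq> (\<lambda>(p, g, f, r). (g, inv f \<otimes> (inv g \<otimes> (p \<otimes> r)))) ` T"
  proof clarify
    fix g h assume g: "g \<in> Sphere n" and h: "h \<in> Sphere (m + C)"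
    obtain f r p where frp: "f \<in> Ball R" "r \<in> Ball (C + R)" "p \<in> Sphere (n + m)" "g \<otimes> f \<otimes> h = p \<otimes> r"
      using prolong[OF g h] by auto
    have M: "f \<in> carrier G" "r \<in> carrier G" "g \<in> carrier G" "h \<in> carrier G" "p \<in> carrier G"
        "len h = m + C" "len f \<le> R" "len r \<le> C + R"
      using frp g h unfolding Ball_def Sphere_def by auto
    have "dist g (g \<otimes> f \<otimes> h) \<le> R + (m + C)"
      using dist_mult[of g "f \<otimes> h"] len_mult[of f h] M by (simp add: m_assoc)
    moreover have "dist p (g \<otimes> f \<otimes> h) \<le> C + R" using dist_mult[of p r] M frp by simp
    ultimately have "dist g p \<le> m + 2 * (C + R)"
      using dist_diff_le[of g "g \<otimes> f \<otimes> h" p] M sym[of p "g \<otimes> f \<otimes> h"] by auto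
    then have "(p, g, f, r) \<in> T" unfolding T_def W_def using frp g by auto
    then show "(g, h) \<in> (\<lambda>(p, g, f, r). (g, inv f \<otimes> (inv g \<otimes> (p \<otimes> r)))) ` T"
      using recover[OF M(3,1,4) frp(4)] by force
  qed
  then have "card (Sphere n \<times> Sphere (m + C)) \<le> card T"
    by (rule surj_card_le[rotated]) (rule fT)
  also have "\<dots> = (\<Sum>p\<in>Sphere (n + m). card (W p) * (card (Ball R) * card (Ball (C + R))))"
    unfolding T_def by (simp add: card_SigmaI fW card_cartesian_product)
  also have "\<dots> \<le> (\<Sum>p\<in>Sphere (n + m). card (Ball (2 * (C + R) + \<Delta>)) * (card (Ball R) * card (Ball (C + R))))"
    by (intro sum_mono mult_right_mono W) auto
  finally show ?thesis by (simp add: card_cartesian_product)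
qed

lemma Sphere_growth:
  "\<exists>q K. q > 1 \<and> K > 0 \<and> (\<forall>n. q ^ (2 * n) \<le> real (card (Sphere n)) \<and> real (card (Sphere n)) \<le> K * q ^ (2 * n))"
proof -
  define s where "s n = real (card (Sphere n))" for n
  define K1 where "K1 = real (card (Ball (2 * (C + R) + \<Delta>)) * (card (Ball R) * card (Ball (C + R))))"
  have K1: "K1 > 0" unfolding K1_def using Ball_nonempty by (auto simp: of_nat_0_less_iff simp del: of_nat_mult)
  have ge1: "1 \<le> s n" for n unfolding s_def using Sphere_nonempty[OF infinite_carrier, of n] by simp
  have shift: "s n * s (m + C) \<le> K1 * s (n + m)" for n m
  proof -
    have "real (card (Sphere n) * card (Sphere (m + C))) \<le> real (card (Sphere (n + m)) *
        (card (Ball (2 * (C + R) + \<Delta>)) * (card (Ball R) * card (Ball (C + R)))))"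
      using card_Sphere_mult_shift[of n m] by (simp only: of_nat_le_iff)
    then show ?thesis unfolding s_def K1_def of_nat_mult by (simp only: mult.commute)
  qed
  \<comment> \<open>The shift by \<open>C\<close> is removed by inserting the nonempty sphere of
    radius \<open>C + C\<close>.\<close>
  have up: "s m \<le> K1 * s (m + C)" for m
  proof -
    have "s m * 1 \<le> s m * s (C + C)" using ge1 by (intro mult_left_mono) (auto simp: s_def)
    then show ?thesis using shift[of m C] by simp
  qed
  have super: "s n * s m \<le> K1\<^sup>2 * s (n + m)" for n m
  proof -
    have "s n * s m \<le> s n * (K1 * s (m + C))" using up by (intro mult_left_mono) (auto simp: s_def)
    also have "\<dots> = K1 * (s n * s (m + C))" by simp
    also have "\<dots> \<le> K1 * (K1 * s (n + m))" using shift K1 by (intro mult_left_mono) auto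
    finally show ?thesis by (simp add: power2_eq_square mult.assoc)
  qed
  have sub: "s (n + m) \<le> s n * s m" for n m
    using card_Sphere_add[of n m] unfolding s_def by (metis of_nat_le_iff of_nat_mult)
  have unb: "\<exists>n. B < s n" for B
  proof -
    obtain n where "nat \<lceil>B\<rceil> < card (Sphere n)" using Sphere_unbounded by blast
    then show ?thesis unfolding s_def by (intro exI[of _ n]) linarith
  qed
  obtain q where "q > 1" "\<forall>n. q ^ (2 * n) \<le> s n \<and> s n \<le> K1\<^sup>2 * q ^ (2 * n)"
    using exponential_growth_of_quasi_multiplicative[OF ge1 sub super unb] by blast
  then show ?thesis unfolding s_def using K1 by (metis zero_less_power)
qed

end

section \<open>Haagerup's inequality\<close>

context length_group
begin

lemma sum_Ball_Sphere:
  fixes h :: "'a \<Rightarrow> 'c::comm_monoid_add"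
  shows "(\<Sum>x\<in>Ball n. h x) = (\<Sum>k\<le>n. \<Sum>x\<in>Sphere k. h x)"
proof -
  have "(\<Sum>k\<in>{..n}. \<Sum>x | x \<in> Ball n \<and> len x = k. h x) = (\<Sum>x\<in>Ball n. h x)"
    by (rule sum.group) (auto simp: Ball_def[of n, THEN eq_reflection] finite_len_le)
  moreover have "{x. x \<in> Ball n \<and> len x = k} = Sphere k" if "k \<le> n" for k
    using that unfolding Ball_def Sphere_def by auto
  ultimately show ?thesis by (metis (no_types, lifting) atMost_iff sum.cong)
qed

end

context hyperbolic_length
begin

text \<open>Bounds the number of cutting points \<open>p\<close> compatible with a given factor in
  \<open>convolution_piece\<close>; any two of them are at distance at most
  \<open>2 * \<Delta> + 1\<close>.\<close>

definition ambiguity :: real where "ambiguity = real (card (Ball (2 * \<Delta> + 1)))"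

lemma ambiguity_pos: "ambiguity > 0" unfolding ambiguity_def using Ball_nonempty by simp

text \<open>
  All left factors \<open>y\<close> of \<open>x = y \<otimes> (inv y \<otimes> x)\<close> with prescribed lengths pass near one point \<open>p\<close> of a
  geodesic from \<open>\<one>\<close> to \<open>x\<close>, so that \<open>a\<close> only matters near \<open>p\<close> and \<open>f\<close> only near \<open>inv p \<otimes> x\<close>.
\<close>
lemma convolution_piece:
  fixes a f :: "'a \<Rightarrow> real"
  shows "(\<Sum>x\<in>Sphere m. (\<Sum>y | y \<in> Sphere k \<and> dist y x = l. a y * f (inv y \<otimes> x))\<^sup>2) \<le>
    ambiguity\<^sup>2 * (\<Sum>y\<in>Sphere k. (a y)\<^sup>2) * (\<Sum>z\<in>Sphere l. (f z)\<^sup>2)"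
proof (cases "\<forall>x\<in>Sphere m. {y. y \<in> Sphere k \<and> dist y x = l} = {}")
  case True
  have "(\<Sum>y | y \<in> Sphere k \<and> dist y x = l. a y * f (inv y \<otimes> x)) = 0" if "x \<in> Sphere m" for x
    unfolding bspec[OF True that] by simp
  then have "(\<Sum>x\<in>Sphere m. (\<Sum>y | y \<in> Sphere k \<and> dist y x = l. a y * f (inv y \<otimes> x))\<^sup>2) = 0"
    by (intro sum.neutral) simp
  then show ?thesis by (simp add: sum_nonneg)
next
  case False
  then obtain x0 y0 where "x0 \<in> Sphere m" "y0 \<in> Sphere k" "dist y0 x0 = l" by blast
  then have ineq: "k \<le> l + m" "l \<le> k + m" "m \<le> k + l"
    using tri[of \<one> y0 x0] tri[of y0 \<one> x0] tri[of \<one> x0 y0] sym[of y0 x0] sym[of y0 \<one>]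
    unfolding Sphere_def by auto
  \<comment> \<open>The number of letters of \<open>y\<close> that survive in the product
    \<open>y \<otimes> (inv y \<otimes> x)\<close>, rounded down.\<close>
  define i where "i = (k + m - l) div 2"
  have i: "2 * i + l \<le> k + m" "k + m \<le> 2 * i + l + 1" using ineq unfolding i_def by auto
  have im: "i \<le> m" "i \<le> k" using i ineq by linarith+
  \<comment> \<open>The remaining \<open>k - i\<close> letters of \<open>y\<close> cancel, so
    \<open>y\<close> lies about that far from \<open>p\<close>.\<close>
  define P where "P = k - i + \<Delta>"
  define A where "A p = (\<Sum>y | y \<in> Sphere k \<and> dist p y \<le> P. (a y)\<^sup>2)" for p
  define F where "F r = (\<Sum>z | z \<in> Sphere l \<and> len (z \<otimes> inv r) \<le> P. (f z)\<^sup>2)" for r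
  have "\<forall>x\<in>Sphere m. \<exists>p r. p \<in> Sphere i \<and> r \<in> Sphere (m - i) \<and> x = p \<otimes> r"
    using len_split im unfolding Sphere_def by fastforce
  then obtain p r where pr: "\<And>x. x \<in> Sphere m \<Longrightarrow> p x \<in> Sphere i \<and> r x \<in> Sphere (m - i) \<and> x = p x \<otimes> r x"
    by metis
  have A0: "A u \<ge> 0" "F u \<ge> 0" for u unfolding A_def F_def by (auto intro: sum_nonneg)
  \<comment> \<open>After Cauchy-Schwarz, each sum is enlarged to one that depends on
    \<open>p x\<close> alone or on \<open>r x\<close> alone.\<close>
  have pointwise: "(\<Sum>y | y \<in> Sphere k \<and> dist y x = l. a y * f (inv y \<otimes> x))\<^sup>2 \<le> A (p x) * F (r x)"
    if x: "x \<in> Sphere m" for x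
  proof -
    define Y where "Y = {y. y \<in> Sphere k \<and> dist y x = l}"
    have xM: "x \<in> carrier G" "p x \<in> carrier G" "r x \<in> carrier G" "len x = m" "len (p x) = i"
        "len (r x) = m - i" "x = p x \<otimes> r x"
      using pr[OF x] x unfolding Sphere_def by auto
    have fY: "finite Y" unfolding Y_def by simp
    have YM: "y \<in> carrier G" if "y \<in> Y" for y using that unfolding Y_def Sphere_def by auto
    have near: "dist (p x) y \<le> P" if y: "y \<in> Y" for y
    proof -
      have px: "dist (p x) x = m - i" using dist_mult[of "p x" "r x"] xM by simp
      have "m + dist (p x) y \<le> max (i + l) (k + (m - i)) + \<Delta>"
        using four_point_sum[OF hyp one_closed xM(2) xM(1) YM[OF y]] px xM y sym[OF xM(1) YM[OF y]]
          sym[OF xM(2,1)] YM[OF y]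
        unfolding Y_def Sphere_def by (simp add: add.commute)
      then show ?thesis using i im unfolding P_def by (auto simp: max_def split: if_splits)
    qed
    have inj: "inj_on (\<lambda>y. inv y \<otimes> x) Y"
      by (rule inj_onI) (use YM xM in \<open>metis inv_closed inv_inv right_cancel\<close>)
    have "(\<Sum>y\<in>Y. a y * f (inv y \<otimes> x))\<^sup>2 \<le> (\<Sum>y\<in>Y. (a y)\<^sup>2) * (\<Sum>y\<in>Y. (f (inv y \<otimes> x))\<^sup>2)"
      by (rule Cauchy_Schwarz_ineq_sum)
    also have "(\<Sum>y\<in>Y. (f (inv y \<otimes> x))\<^sup>2) = (\<Sum>z\<in>(\<lambda>y. inv y \<otimes> x) ` Y. (f z)\<^sup>2)"
      by (simp add: sum.reindex[OF inj])
    also have "(\<Sum>y\<in>Y. (a y)\<^sup>2) * \<dots> \<le> A (p x) * F (r x)"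
    proof (rule mult_mono)
      show "(\<Sum>y\<in>Y. (a y)\<^sup>2) \<le> A (p x)"
        unfolding A_def by (rule sum_mono2) (use near Y_def in auto)
      have "(\<lambda>y. inv y \<otimes> x) ` Y \<subseteq> {z \<in> Sphere l. len (z \<otimes> inv (r x)) \<le> P}"
      proof (rule image_subsetI)
        fix y assume y: "y \<in> Y"
        have "inv y \<otimes> x \<otimes> inv (r x) = inv y \<otimes> p x" using xM YM[OF y] by (metis inv_closed inv_solve_right m_assoc m_closed)
        then have "len (inv y \<otimes> x \<otimes> inv (r x)) = dist (p x) y"
          using sym[OF xM(2) YM[OF y]] unfolding dist_def by simp
        then show "inv y \<otimes> x \<in> {z \<in> Sphere l. len (z \<otimes> inv (r x)) \<le> P}"
          using y near[OF y] YM[OF y] xM(1) unfolding Sphere_def Y_def dist_def by auto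
      qed
      then show "(\<Sum>z\<in>(\<lambda>y. inv y \<otimes> x) ` Y. (f z)\<^sup>2) \<le> F (r x)"
        unfolding F_def by (intro sum_mono2) auto
    qed (auto intro: A0 sum_nonneg)
    finally show ?thesis unfolding Y_def .
  qed
  have countA: "real (card {u \<in> Sphere i. dist u y \<le> P}) \<le> ambiguity" if y: "y \<in> Sphere k" for y
  proof -
    have "card {u \<in> Sphere i. dist u y \<le> P} \<le> card (Ball (2 * \<Delta> + 1))"
    proof (rule card_le_Ball_of_diam)
      fix u u' assume "u \<in> {u \<in> Sphere i. dist u y \<le> P}" "u' \<in> {u \<in> Sphere i. dist u y \<le> P}"
      then have M: "u \<in> carrier G" "u' \<in> carrier G" "y \<in> carrier G" and
        l: "len u = i" "len u' = i" "len y = k" "dist u y \<le> P" "dist u' y \<le> P"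
        using y unfolding Sphere_def by auto
      show "dist u u' \<le> 2 * \<Delta> + 1"
        using four_point_sum[OF hyp one_closed M(1,3,2)] sym[OF M(3,2)] l M im unfolding P_def
        by (auto simp: max_def split: if_splits)
    qed (auto simp: Sphere_def)
    then show ?thesis unfolding ambiguity_def by simp
  qed
  \<comment> \<open>After inversion this is a count around \<open>inv z\<close>; here the rounding
    of \<open>i\<close> costs the extra 1.\<close>
  have countF: "real (card {u \<in> Sphere (m - i). len (z \<otimes> inv u) \<le> P}) \<le> ambiguity"
    if z: "z \<in> Sphere l" for z
  proof -
    define W where "W = {u \<in> Sphere (m - i). len (z \<otimes> inv u) \<le> P}"
    have WM: "u \<in> carrier G" if "u \<in> W" for u using that unfolding W_def Sphere_def by auto
    have "inj_on (\<lambda>u. inv u) W" by (rule inj_onI) (use WM in \<open>metis inv_inv\<close>)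
    then have "card W = card ((\<lambda>u. inv u) ` W)" by (simp add: card_image)
    also have "\<dots> \<le> card (Ball (2 * \<Delta> + 1))"
    proof (rule card_le_Ball_of_diam)
      fix v v' assume "v \<in> (\<lambda>u. inv u) ` W" "v' \<in> (\<lambda>u. inv u) ` W"
      then obtain u u' where u: "u \<in> W" "u' \<in> W" and v: "v = inv u" "v' = inv u'" by blast
      have l: "v \<in> carrier G" "v' \<in> carrier G" "len v = m - i" "len v' = m - i"
          "len (z \<otimes> v) \<le> P" "len (z \<otimes> v') \<le> P"
        using WM[OF u(1)] WM[OF u(2)] u unfolding v W_def Sphere_def by (simp_all add: len_inv)
      have M: "z \<in> carrier G" "inv z \<in> carrier G" "len (inv z) = l" using z len_inv unfolding Sphere_def by auto
      have d: "dist (inv z) v \<le> P" "dist (inv z) v' \<le> P" using l M unfolding dist_def by simp_all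
      have "l + dist v v' \<le> (m - i) + P + \<Delta>"
        using four_point_sum[OF hyp one_closed l(1) M(2) l(2)] sym[OF M(2) l(1)] l M(2,3) d
        by (auto simp: max_def split: if_splits)
      then show "dist v v' \<le> 2 * \<Delta> + 1" using i im unfolding P_def by linarith
    qed (use WM in auto)
    finally show ?thesis unfolding ambiguity_def W_def by simp
  qed
  have sumA: "(\<Sum>u\<in>Sphere i. A u) \<le> ambiguity * (\<Sum>y\<in>Sphere k. (a y)\<^sup>2)"
  proof -
    have "(\<Sum>u\<in>Sphere i. A u) = (\<Sum>y\<in>Sphere k. \<Sum>u | u \<in> Sphere i \<and> dist u y \<le> P. (a y)\<^sup>2)"
      unfolding A_def by (rule sum.swap_restrict) auto
    also have "\<dots> \<le> (\<Sum>y\<in>Sphere k. ambiguity * (a y)\<^sup>2)"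
      using countA by (intro sum_mono) (simp add: mult_right_mono)
    finally show ?thesis by (simp add: sum_distrib_left)
  qed
  have sumF: "(\<Sum>u\<in>Sphere (m - i). F u) \<le> ambiguity * (\<Sum>z\<in>Sphere l. (f z)\<^sup>2)"
  proof -
    have "(\<Sum>u\<in>Sphere (m - i). F u) = (\<Sum>z\<in>Sphere l. \<Sum>u | u \<in> Sphere (m - i) \<and> len (z \<otimes> inv u) \<le> P. (f z)\<^sup>2)"
      unfolding F_def by (rule sum.swap_restrict) auto
    also have "\<dots> \<le> (\<Sum>z\<in>Sphere l. ambiguity * (f z)\<^sup>2)"
      using countF by (intro sum_mono) (simp add: mult_right_mono)
    finally show ?thesis by (simp add: sum_distrib_left)
  qed
  have "(\<Sum>x\<in>Sphere m. (\<Sum>y | y \<in> Sphere k \<and> dist y x = l. a y * f (inv y \<otimes> x))\<^sup>2) \<le>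
      (\<Sum>x\<in>Sphere m. A (p x) * F (r x))"
    by (rule sum_mono) (rule pointwise)
  \<comment> \<open>\<open>x\<close> is recovered from its two pieces, so the sum embeds into a
    product of sums.\<close>
  also have "\<dots> = (\<Sum>(u, v)\<in>(\<lambda>x. (p x, r x)) ` Sphere m. A u * F v)"
  proof -
    have "inj_on (\<lambda>x. (p x, r x)) (Sphere m)" by (rule inj_onI) (metis pr prod.inject)
    then show ?thesis by (simp add: sum.reindex)
  qed
  also have "\<dots> \<le> (\<Sum>(u, v)\<in>Sphere i \<times> Sphere (m - i). A u * F v)"
    by (rule sum_mono2) (use pr A0 in auto)
  also have "\<dots> = (\<Sum>u\<in>Sphere i. A u) * (\<Sum>v\<in>Sphere (m - i). F v)"
    by (simp add: sum_product sum.cartesian_product)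
  also have "\<dots> \<le> (ambiguity * (\<Sum>y\<in>Sphere k. (a y)\<^sup>2)) * (ambiguity * (\<Sum>z\<in>Sphere l. (f z)\<^sup>2))"
    using sumA sumF A0 ambiguity_pos by (intro mult_mono) (auto intro!: sum_nonneg mult_nonneg_nonneg)
  finally show ?thesis by (simp add: power2_eq_square mult.commute mult.left_commute mult.assoc)
qed

text \<open>Factors of lengths \<open>k\<close> and \<open>l\<close> have a product of length
  \<open>m\<close> only for \<open>l\<close> in a window of at most \<open>2 * k + 1\<close> values.
  The window enters twice, in Cauchy-Schwarz over \<open>l\<close> and in counting the
  \<open>m\<close> that involve a given \<open>l\<close>; hence the square.\<close>

lemma haagerup_sphere:
  fixes a f :: "'a \<Rightarrow> real"
  shows "(\<Sum>x\<in>Ball N. (\<Sum>y\<in>Sphere k. a y * f (inv y \<otimes> x))\<^sup>2) \<le>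
    (ambiguity * (2 * real k + 1))\<^sup>2 * (\<Sum>y\<in>Sphere k. (a y)\<^sup>2) * (\<Sum>z\<in>Ball (N + k). (f z)\<^sup>2)"
proof -
  define S where "S = (\<Sum>y\<in>Sphere k. (a y)\<^sup>2)"
  define F where "F l = (\<Sum>z\<in>Sphere l. (f z)\<^sup>2)" for l
  define t where "t l x = (\<Sum>y | y \<in> Sphere k \<and> dist y x = l. a y * f (inv y \<otimes> x))" for l x
  define I where "I m = {m - k..m + k}" for m
  have cI: "real (card (I m)) \<le> 2 * real k + 1" for m unfolding I_def by simp
  have F0: "F l \<ge> 0" "S \<ge> 0" for l unfolding F_def S_def by (auto intro: sum_nonneg)
  have inner: "(\<Sum>x\<in>Sphere m. (\<Sum>y\<in>Sphere k. a y * f (inv y \<otimes> x))\<^sup>2) \<le>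
      (2 * real k + 1) * (ambiguity\<^sup>2 * S * (\<Sum>l\<in>I m. F l))" for m
  proof -
    have "(\<Sum>y\<in>Sphere k. a y * f (inv y \<otimes> x))\<^sup>2 \<le> (2 * real k + 1) * (\<Sum>l\<in>I m. (t l x)\<^sup>2)"
      if x: "x \<in> Sphere m" for x
    proof -
      have "(\<lambda>y. dist y x) ` Sphere k \<subseteq> I m"
      proof (rule image_subsetI)
        fix y assume "y \<in> Sphere k"
        then show "dist y x \<in> I m"
          using tri[of \<one> y x] tri[of y \<one> x] sym[of y \<one>] x unfolding I_def Sphere_def by auto
      qed
      then have "(\<Sum>y\<in>Sphere k. a y * f (inv y \<otimes> x)) = (\<Sum>l\<in>I m. t l x)"
        unfolding t_def by (intro sum.group[symmetric]) (auto simp: I_def)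
      then have "(\<Sum>y\<in>Sphere k. a y * f (inv y \<otimes> x))\<^sup>2 \<le> (\<Sum>l\<in>I m. (t l x)\<^sup>2) * card (I m)"
        using sum_squared_le_sum_of_squares[of "\<lambda>l. t l x" "I m"] by simp
      also have "\<dots> \<le> (\<Sum>l\<in>I m. (t l x)\<^sup>2) * (2 * real k + 1)"
        using cI by (intro mult_left_mono sum_nonneg) auto
      finally show ?thesis by (simp add: mult.commute)
    qed
    then have "(\<Sum>x\<in>Sphere m. (\<Sum>y\<in>Sphere k. a y * f (inv y \<otimes> x))\<^sup>2) \<le>
      (\<Sum>x\<in>Sphere m. (2 * real k + 1) * (\<Sum>l\<in>I m. (t l x)\<^sup>2))" by (rule sum_mono)
    also have "\<dots> = (2 * real k + 1) * (\<Sum>l\<in>I m. \<Sum>x\<in>Sphere m. (t l x)\<^sup>2)"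
      unfolding sum_distrib_left[symmetric] by (subst sum.swap) (rule HOL.refl)
    also have "\<dots> \<le> (2 * real k + 1) * (\<Sum>l\<in>I m. ambiguity\<^sup>2 * S * F l)"
      unfolding t_def S_def F_def by (intro mult_left_mono sum_mono convolution_piece) auto
    finally show ?thesis by (simp add: sum_distrib_left)
  qed
  have "(\<Sum>m\<le>N. \<Sum>l\<in>I m. F l) \<le> (\<Sum>l\<le>N + k. (2 * real k + 1) * F l)"
  proof -
    have "(\<Sum>m\<le>N. \<Sum>l\<in>I m. F l) = (\<Sum>m\<in>{..N}. \<Sum>l | l \<in> {..N + k} \<and> l \<in> I m. F l)"
      by (intro sum.cong) (auto simp: I_def)
    also have "\<dots> = (\<Sum>l\<in>{..N + k}. \<Sum>m | m \<in> {..N} \<and> l \<in> I m. F l)"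
      by (rule sum.swap_restrict) auto
    also have "\<dots> \<le> (\<Sum>l\<in>{..N + k}. (2 * real k + 1) * F l)"
    proof (rule sum_mono)
      fix l
      have "{m. m \<in> {..N} \<and> l \<in> I m} \<subseteq> I l" unfolding I_def by auto
      then have "card {m. m \<in> {..N} \<and> l \<in> I m} \<le> card (I l)" by (intro card_mono) (auto simp: I_def)
      then have "real (card {m. m \<in> {..N} \<and> l \<in> I m}) \<le> 2 * real k + 1" using cI[of l] by linarith
      then show "(\<Sum>m | m \<in> {..N} \<and> l \<in> I m. F l) \<le> (2 * real k + 1) * F l"
        unfolding sum_constant using F0(1)[of l] by (rule mult_right_mono)
    qed
    finally show ?thesis by simp
  qed
  then have FF: "(\<Sum>m\<le>N. \<Sum>l\<in>I m. F l) \<le> (2 * real k + 1) * (\<Sum>z\<in>Ball (N + k). (f z)\<^sup>2)"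
    unfolding sum_Ball_Sphere F_def sum_distrib_left .
  have "(\<Sum>x\<in>Ball N. (\<Sum>y\<in>Sphere k. a y * f (inv y \<otimes> x))\<^sup>2) \<le>
      (\<Sum>m\<le>N. (2 * real k + 1) * (ambiguity\<^sup>2 * S * (\<Sum>l\<in>I m. F l)))"
    unfolding sum_Ball_Sphere by (intro sum_mono inner)
  also have "\<dots> = (2 * real k + 1) * (ambiguity\<^sup>2 * S) * (\<Sum>m\<le>N. \<Sum>l\<in>I m. F l)"
    by (simp add: sum_distrib_left mult.assoc)
  also have "\<dots> \<le> (2 * real k + 1) * (ambiguity\<^sup>2 * S) * ((2 * real k + 1) * (\<Sum>z\<in>Ball (N + k). (f z)\<^sup>2))"
    using FF F0 by (intro mult_left_mono) auto
  finally show ?thesis unfolding S_def by (simp add: power2_eq_square mult.commute mult.left_commute mult.assoc)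
qed

end

section \<open>Square-summable functions and the operator norm\<close>

lemma l2_sum_le:
  assumes "f \<in> l2_space G" "finite X" "X \<subseteq> carrier G"
  shows "(\<Sum>x\<in>X. (cmod (f x))\<^sup>2) \<le> (l2_norm G f)\<^sup>2"
proof -
  have "(\<Sum>x\<in>X. (cmod (f x))\<^sup>2) \<le> (\<Sum>\<^sub>\<infinity>x\<in>carrier G. (cmod (f x))\<^sup>2)"
    using assms unfolding l2_space_def by (intro finite_sum_le_infsum) auto
  moreover have "(\<Sum>\<^sub>\<infinity>x\<in>carrier G. (cmod (f x))\<^sup>2) \<ge> 0" by (intro infsum_nonneg) auto
  ultimately show ?thesis unfolding l2_norm_def by simp
qed

lemma l2_norm_nonneg: "l2_norm G f \<ge> 0"
  unfolding l2_norm_def by (intro real_sqrt_ge_zero infsum_nonneg) auto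

lemma l2_norm_leI:
  assumes "\<And>X. \<lbrakk>finite X; X \<subseteq> carrier G\<rbrakk> \<Longrightarrow> (\<Sum>x\<in>X. (cmod (f x))\<^sup>2) \<le> B\<^sup>2" "B \<ge> 0"
    and "{x. f x \<noteq> 0} \<subseteq> carrier G"
  shows "f \<in> l2_space G" "l2_norm G f \<le> B"
proof -
  have s: "(\<lambda>x. (cmod (f x))\<^sup>2) summable_on carrier G"
    by (rule nonneg_bdd_above_summable_on) (use assms(1) in \<open>auto intro!: bdd_aboveI[of _ "B\<^sup>2"]\<close>)
  then show "f \<in> l2_space G" using assms(3) unfolding l2_space_def by simp
  have "(\<Sum>\<^sub>\<infinity>x\<in>carrier G. (cmod (f x))\<^sup>2) \<le> B\<^sup>2"
    by (rule infsum_le_finite_sums[OF s]) (use assms(1) in auto)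
  then show "l2_norm G f \<le> B" unfolding l2_norm_def using assms(2) by (simp add: real_le_lsqrt)
qed

lemma infsum_finite_support:
  fixes h :: "'a \<Rightarrow> real"
  assumes "finite X" "X \<subseteq> A" "\<And>x. x \<in> A - X \<Longrightarrow> h x = 0"
  shows "infsum h A = (\<Sum>x\<in>X. h x)"
proof -
  have "infsum h A = infsum h X" by (rule infsum_cong_neutral) (use assms in auto)
  then show ?thesis using assms by simp
qed

lemma l2_finite_support:
  assumes "finite X" "X \<subseteq> carrier G" "\<And>x. x \<notin> X \<Longrightarrow> f x = 0"
  shows "f \<in> l2_space G" "l2_norm G f = sqrt (\<Sum>x\<in>X. (cmod (f x))\<^sup>2)"
proof -
  show n: "l2_norm G f = sqrt (\<Sum>x\<in>X. (cmod (f x))\<^sup>2)"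
    unfolding l2_norm_def by (subst infsum_finite_support[of X]) (use assms in auto)
  show "f \<in> l2_space G"
  proof (rule l2_norm_leI(1)[of G f "l2_norm G f"])
    fix Y assume Y: "finite Y" "Y \<subseteq> carrier G"
    have "(\<Sum>x\<in>Y. (cmod (f x))\<^sup>2) = (\<Sum>x\<in>Y \<inter> X. (cmod (f x))\<^sup>2)"
      by (rule sum.mono_neutral_right) (use Y assms in auto)
    also have "\<dots> \<le> (\<Sum>x\<in>X. (cmod (f x))\<^sup>2)" by (rule sum_mono2) (use assms in auto)
    finally show "(\<Sum>x\<in>Y. (cmod (f x))\<^sup>2) \<le> (l2_norm G f)\<^sup>2" unfolding n by (simp add: sum_nonneg)
  qed (use assms l2_norm_nonneg in auto)
qed

lemma l2_norm_scale: "l2_norm G (\<lambda>x. t * f x) = cmod t * l2_norm G f"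
  unfolding l2_norm_def norm_mult power_mult_distrib infsum_cmult_right'
  by (simp add: real_sqrt_mult)

lemma l2_space_scale: "f \<in> l2_space G \<Longrightarrow> (\<lambda>x. t * f x) \<in> l2_space G"
  unfolding l2_space_def by (auto simp: norm_mult power_mult_distrib intro: summable_on_cmult_right)

lemma left_regular_scale: "left_regular G a (\<lambda>x. t * f x) = (\<lambda>x. t * left_regular G a f x)"
  unfolding left_regular_def left_translation_def sum_distrib_left
  by (auto intro!: sum.cong simp: mult.left_commute)

text \<open>The real \<open>Sup\<close> in \<open>l2_opnorm\<close> carries information only for a
  bounded set. The bound \<open>B\<close> guarantees this, also behind the second conclusion, where
  it no longer appears.\<close>

lemma regular_norm_le:
  assumes "B \<ge> 0" "\<And>f. f \<in> l2_space G \<Longrightarrow> l2_norm G (left_regular G a f) \<le> B * l2_norm G f"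
  shows "regular_norm G a \<le> B"
    and "f \<in> l2_space G \<Longrightarrow> l2_norm G (left_regular G a f) \<le> regular_norm G a * l2_norm G f"
proof -
  define V where "V = {l2_norm G (left_regular G a f) | f. f \<in> l2_space G \<and> l2_norm G f \<le> 1}"
  have zero: "(\<lambda>x. 0) \<in> l2_space G" "l2_norm G (\<lambda>x. 0) = 0"
    unfolding l2_space_def l2_norm_def by auto
  then have V: "V \<noteq> {}" unfolding V_def by (auto intro!: exI[of _ "\<lambda>x. 0"])
  have le: "v \<le> B" if v: "v \<in> V" for v
  proof -
    obtain f where f: "v = l2_norm G (left_regular G a f)" "f \<in> l2_space G" "l2_norm G f \<le> 1"
      using v unfolding V_def by auto
    have "v \<le> B * l2_norm G f" using f assms(2) by simp
    also have "\<dots> \<le> B * 1" using f assms(1) by (intro mult_left_mono) auto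
    finally show ?thesis by simp
  qed
  have n: "regular_norm G a = Sup V" unfolding l2_opnorm_def V_def ..
  show "regular_norm G a \<le> B" unfolding n by (rule cSup_least[OF V le])
  assume f: "f \<in> l2_space G"
  show "l2_norm G (left_regular G a f) \<le> regular_norm G a * l2_norm G f"
  proof (cases "l2_norm G f = 0")
    case True
    then show ?thesis using assms(2)[OF f] by simp
  next
    case False
    define r where "r = l2_norm G f"
    have r: "r > 0" using False l2_norm_nonneg[of G f] unfolding r_def by linarith
    define g where "g = (\<lambda>x. complex_of_real (1 / r) * f x)"
    have "l2_norm G g = 1" unfolding g_def l2_norm_scale using r by (simp add: r_def[symmetric] norm_divide)
    moreover have "g \<in> l2_space G" unfolding g_def by (rule l2_space_scale[OF f])
    ultimately have "l2_norm G (left_regular G a g) \<in> V" unfolding V_def by auto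
    then have "l2_norm G (left_regular G a g) \<le> regular_norm G a"
      unfolding n using le by (intro cSup_upper) (auto intro!: bdd_aboveI)
    then show ?thesis unfolding g_def left_regular_scale l2_norm_scale r_def[symmetric]
      using r by (simp add: norm_divide field_simps)
  qed
qed

section \<open>Radial elements and convolution by them\<close>

context length_group
begin

definition rad :: "nat \<Rightarrow> (nat \<Rightarrow> real) \<Rightarrow> 'a \<Rightarrow> complex" where
  "rad n c = (\<lambda>x. \<Sum>k\<le>n. complex_of_real (c k) * indicator (Sphere k) x)"

lemma rad_eq: "rad n c x = (if x \<in> Ball n then complex_of_real (c (len x)) else 0)"
proof -
  have "complex_of_real (c k) * indicator (Sphere k) x =
      (if k = len x then (if x \<in> carrier G then complex_of_real (c (len x)) else 0) else 0)" for k
    by (auto simp: Sphere_def indicator_def)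
  then show ?thesis unfolding rad_def Ball_def by (simp add: sum.delta)
qed

lemma left_regular_rad:
  "left_regular G (rad n c) f x =
    (if x \<in> carrier G then \<Sum>k\<le>n. \<Sum>y\<in>Sphere k. complex_of_real (c k) * f (inv y \<otimes> x) else 0)"
proof -
  have "left_regular G (rad n c) f x = (\<Sum>g\<in>Ball n. rad n c g * left_translation G g f x)"
    unfolding left_regular_def by (rule sum.mono_neutral_left) (auto simp: rad_eq)
  also have "\<dots> = (\<Sum>k\<le>n. \<Sum>g\<in>Sphere k. rad n c g * left_translation G g f x)"
    by (rule sum_Ball_Sphere)
  also have "\<dots> = (if x \<in> carrier G then \<Sum>k\<le>n. \<Sum>y\<in>Sphere k. complex_of_real (c k) * f (inv y \<otimes> x) else 0)"
    by (auto simp: left_translation_def rad_eq Sphere_def Ball_def intro!: sum.cong)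
  finally show ?thesis .
qed

lemma sum_Ball_radial:
  fixes h :: "nat \<Rightarrow> real"
  shows "(\<Sum>x\<in>Ball n. h (len x)) = (\<Sum>k\<le>n. real (card (Sphere k)) * h k)"
  unfolding sum_Ball_Sphere by (auto intro!: sum.cong simp: Sphere_def)

lemma l2_norm_rad: "l2_norm G (rad n c) = sqrt (\<Sum>k\<le>n. real (card (Sphere k)) * (c k)\<^sup>2)"
proof -
  have "l2_norm G (rad n c) = sqrt (\<Sum>x\<in>Ball n. (cmod (rad n c x))\<^sup>2)"
    by (rule l2_finite_support(2)) (auto simp: rad_eq Ball_def finite_len_le)
  also have "(\<Sum>x\<in>Ball n. (cmod (rad n c x))\<^sup>2) = (\<Sum>x\<in>Ball n. (c (len x))\<^sup>2)"
    by (rule sum.cong) (auto simp: rad_eq)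
  finally show ?thesis unfolding sum_Ball_radial[of "\<lambda>k. (c k)\<^sup>2"] .
qed

end

lemma L2_set_sum_le:
  "L2_set (\<lambda>x. \<Sum>k\<le>(n::nat). t k x) A \<le> (\<Sum>k\<le>n. L2_set (t k) A)"
proof (induction n)
  case (Suc n)
  have "L2_set (\<lambda>x. (\<Sum>k\<le>n. t k x) + t (Suc n) x) A \<le>
      L2_set (\<lambda>x. \<Sum>k\<le>n. t k x) A + L2_set (t (Suc n)) A"
    by (rule L2_set_triangle_ineq)
  then show ?case using Suc by simp
qed simp

context hyperbolic_length
begin

text \<open>The triangle inequality over the spheres, with the real inequality applied to
  \<open>cmod (f x)\<close>; since the latter concerns finite sums over balls, \<open>X\<close> is
  first enclosed in a ball.\<close>

theorem haagerup_radial: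
  assumes c: "\<And>k. k \<le> n \<Longrightarrow> c k \<ge> 0" and f: "f \<in> l2_space G"
  shows "l2_norm G (left_regular G (rad n c) f) \<le>
    (2 * ambiguity * (\<Sum>k\<le>n. (real k + 1) * c k * sqrt (card (Sphere k)))) * l2_norm G f"
proof (rule l2_norm_leI(2))
  define B where "B = 2 * ambiguity * (\<Sum>k\<le>n. (real k + 1) * c k * sqrt (card (Sphere k))) * l2_norm G f"
  show B0: "2 * ambiguity * (\<Sum>k\<le>n. (real k + 1) * c k * sqrt (card (Sphere k))) * l2_norm G f \<ge> 0"
    using c ambiguity_pos l2_norm_nonneg[of G f] by (auto intro!: mult_nonneg_nonneg sum_nonneg)
  show "{x. left_regular G (rad n c) f x \<noteq> 0} \<subseteq> carrier G" by (auto simp: left_regular_rad)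
  fix X assume X: "finite X" "X \<subseteq> carrier G"
  define N where "N = Max (insert 0 (len ` X))"
  have XN: "X \<subseteq> Ball N" unfolding N_def Ball_def using X by auto
  define t where "t k x = c k * (\<Sum>y\<in>Sphere k. 1 * cmod (f (inv y \<otimes> x)))" for k x
  have t0: "t k x \<ge> 0" if "k \<le> n" for k x unfolding t_def using c that by (auto intro!: mult_nonneg_nonneg sum_nonneg)
  have pw: "cmod (left_regular G (rad n c) f x) \<le> (\<Sum>k\<le>n. t k x)" for x
  proof (cases "x \<in> carrier G")
    case True
    then have "cmod (left_regular G (rad n c) f x) \<le>
        (\<Sum>k\<le>n. \<Sum>y\<in>Sphere k. cmod (complex_of_real (c k) * f (inv y \<otimes> x)))"
      unfolding left_regular_rad by (simp only: if_True) (intro order.trans[OF norm_sum] sum_mono norm_sum)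
    also have "\<dots> = (\<Sum>k\<le>n. t k x)"
      unfolding t_def sum_distrib_left using c by (intro sum.cong) (auto simp: norm_mult)
    finally show ?thesis .
  next
    case False
    then show ?thesis using t0 by (auto simp: left_regular_rad intro!: sum_nonneg)
  qed
  have tk: "L2_set (t k) (Ball N) \<le> c k * (ambiguity * (2 * real k + 1)) * sqrt (card (Sphere k)) * l2_norm G f"
    if k: "k \<le> n" for k
  proof -
    have "(\<Sum>x\<in>Ball N. (\<Sum>y\<in>Sphere k. 1 * cmod (f (inv y \<otimes> x)))\<^sup>2) \<le>
        (ambiguity * (2 * real k + 1))\<^sup>2 * (\<Sum>y\<in>Sphere k. 1\<^sup>2) * (\<Sum>z\<in>Ball (N + k). (cmod (f z))\<^sup>2)"
      by (rule haagerup_sphere)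
    also have "\<dots> \<le> (ambiguity * (2 * real k + 1))\<^sup>2 * card (Sphere k) * (l2_norm G f)\<^sup>2"
      using l2_sum_le[OF f finite_Ball, of "N + k"] unfolding Ball_def
      by (intro mult_mono mult_nonneg_nonneg sum_nonneg) auto
    finally have "L2_set (\<lambda>x. \<Sum>y\<in>Sphere k. 1 * cmod (f (inv y \<otimes> x))) (Ball N) \<le>
        sqrt ((ambiguity * (2 * real k + 1))\<^sup>2 * card (Sphere k) * (l2_norm G f)\<^sup>2)"
      unfolding L2_set_def by (rule real_sqrt_le_mono)
    also have "\<dots> = ambiguity * (2 * real k + 1) * sqrt (card (Sphere k)) * l2_norm G f"
      using ambiguity_pos l2_norm_nonneg[of G f] by (simp add: real_sqrt_mult abs_mult)
    finally have "c k * L2_set (\<lambda>x. \<Sum>y\<in>Sphere k. 1 * cmod (f (inv y \<otimes> x))) (Ball N) \<le>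
        c k * (ambiguity * (2 * real k + 1) * sqrt (card (Sphere k)) * l2_norm G f)"
      using c k by (intro mult_left_mono) auto
    moreover have "L2_set (t k) (Ball N) = c k * L2_set (\<lambda>x. \<Sum>y\<in>Sphere k. 1 * cmod (f (inv y \<otimes> x))) (Ball N)"
      unfolding t_def using c[OF k] by (rule L2_set_right_distrib[symmetric])
    ultimately show ?thesis by (simp add: mult.assoc)
  qed
  have "L2_set (\<lambda>x. cmod (left_regular G (rad n c) f x)) (Ball N) \<le> L2_set (\<lambda>x. \<Sum>k\<le>n. t k x) (Ball N)"
    by (rule L2_set_mono) (use pw in auto)
  also have "\<dots> \<le> (\<Sum>k\<le>n. L2_set (t k) (Ball N))" by (rule L2_set_sum_le)
  also have "\<dots> \<le> (\<Sum>k\<le>n. c k * (ambiguity * (2 * real k + 1)) * sqrt (card (Sphere k)) * l2_norm G f)"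
    by (rule sum_mono) (use tk in auto)
  also have "\<dots> \<le> (\<Sum>k\<le>n. c k * (ambiguity * (2 * (real k + 1))) * sqrt (card (Sphere k)) * l2_norm G f)"
    using c ambiguity_pos l2_norm_nonneg[of G f]
    by (intro sum_mono mult_right_mono mult_left_mono) auto
  also have "\<dots> = B" unfolding B_def sum_distrib_left sum_distrib_right
    by (intro sum.cong) (auto simp: algebra_simps)
  finally have "L2_set (\<lambda>x. cmod (left_regular G (rad n c) f x)) (Ball N) \<le> B" .
  then have "(\<Sum>x\<in>Ball N. (cmod (left_regular G (rad n c) f x))\<^sup>2) \<le> B\<^sup>2"
    unfolding L2_set_def by (simp add: sqrt_le_D)
  moreover have "(\<Sum>x\<in>X. (cmod (left_regular G (rad n c) f x))\<^sup>2) \<le>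
      (\<Sum>x\<in>Ball N. (cmod (left_regular G (rad n c) f x))\<^sup>2)"
    by (rule sum_mono2) (use XN in auto)
  ultimately show "(\<Sum>x\<in>X. (cmod (left_regular G (rad n c) f x))\<^sup>2) \<le>
     (2 * ambiguity * (\<Sum>k\<le>n. (real k + 1) * c k * sqrt (card (Sphere k))) * l2_norm G f)\<^sup>2"
    unfolding B_def by linarith
qed

end

section \<open>Lower bound for radial elements\<close>

text \<open>A geometric sum is comparable to its largest term; this turns a sum over thresholds
  \<open>j\<close> into the single power \<open>q ^ B\<close>.\<close>

lemma sum_power_upto_half:
  fixes q :: real
  assumes "q > 1"
  shows "(\<Sum>j | j \<le> k \<and> 2 * j \<le> B. q ^ (2 * j)) \<le> q\<^sup>2 / (q\<^sup>2 - 1) * q ^ B"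
proof -
  have q2: "q\<^sup>2 > 1" using assms by (simp add: one_less_power)
  have "(\<Sum>j | j \<le> k \<and> 2 * j \<le> B. q ^ (2 * j)) \<le> (\<Sum>j\<le>B div 2. q ^ (2 * j))"
    using assms by (intro sum_mono2) auto
  also have "\<dots> = (\<Sum>j<Suc (B div 2). (q\<^sup>2) ^ j)" by (simp add: power_mult lessThan_Suc_atMost)
  also have "\<dots> = ((q\<^sup>2) ^ Suc (B div 2) - 1) / (q\<^sup>2 - 1)" using q2 by (intro geometric_sum) auto
  also have "\<dots> \<le> (q\<^sup>2) ^ Suc (B div 2) / (q\<^sup>2 - 1)" using q2 by (intro divide_right_mono) auto
  also have "\<dots> = q\<^sup>2 / (q\<^sup>2 - 1) * q ^ (2 * (B div 2))" by (simp add: power_mult)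
  also have "\<dots> \<le> q\<^sup>2 / (q\<^sup>2 - 1) * q ^ B"
    using assms q2 by (intro mult_left_mono power_increasing) auto
  finally show ?thesis .
qed

context spreading_group
begin

text \<open>
  The elements of length \<open>k\<close> that cancel about \<open>j\<close> letters against \<open>x\<close> make up a proportion
  \<open>q ^ (-2 j)\<close> of the sphere and each contributes \<open>q ^ (2 j)\<close>, so all \<open>j \<le> k\<close> count equally.
\<close>
lemma sphere_average_lower:
  fixes q :: real
  assumes q: "q > 1" and growth: "\<And>n. q ^ (2 * n) \<le> real (card (Sphere n))"
  shows "\<exists>\<kappa>>0. \<forall>k. \<forall>x\<in>carrier G. k \<le> len x \<longrightarrow>
    \<kappa> * (real k + 1) * q ^ k * (1 / q) ^ len x \<le> (\<Sum>g\<in>Sphere k. (1 / q) ^ dist g x)"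
proof -
  define D where "D = 2 * (C + R)"
  define L where "L = real (card (Ball R) * card (Ball (C + R)))"
  define E where "E = q\<^sup>2 / (q\<^sup>2 - 1) * q ^ D"
  have q2: "q\<^sup>2 > 1" using q by (simp add: one_less_power)
  have L: "L > 0" unfolding L_def using Ball_nonempty by (auto simp: of_nat_0_less_iff simp del: of_nat_mult)
  have E: "E > 0" unfolding E_def using q q2 by (auto intro!: mult_pos_pos divide_pos_pos)
  have "(1 / (L * E)) * (real k + 1) * q ^ k * (1 / q) ^ len x \<le> (\<Sum>g\<in>Sphere k. (1 / q) ^ dist g x)"
    if x: "x \<in> carrier G" "k \<le> len x" for k x
  proof -
    define m where "m = len x"
    \<comment> \<open>The elements cancelling at least about \<open>j\<close> letters of
      \<open>x\<close>, for which \<open>dist g x\<close> is at most \<open>m + k - 2 * j\<close>,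
      with slack \<open>D\<close>.\<close>
    define A where "A j = {g \<in> Sphere k. 2 * j \<le> m + k + D - dist g x}" for j
    have dle: "dist g x \<le> m + k" if "g \<in> Sphere k" for g
      using tri[of g \<one> x] sym[of g \<one>] that x unfolding Sphere_def m_def by auto
    have Aj: "q ^ (2 * (k - j)) \<le> L * real (card (A j))" if j: "j \<le> k" for j
    proof -
      have "{g \<in> Sphere (j + (k - j)). dist g x + j \<le> len x + (k - j) + 2 * (C + R)} \<subseteq> A j"
        unfolding A_def m_def D_def using j by auto
      then have sub: "card {g \<in> Sphere (j + (k - j)). dist g x + j \<le> len x + (k - j) + 2 * (C + R)} \<le> card (A j)"
        by (rule card_mono[rotated]) (simp add: A_def)
      have "q ^ (2 * (k - j)) \<le> q ^ (2 * (k - j + C))" using q by (intro power_increasing) auto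
      also have "\<dots> \<le> real (card (Sphere (k - j + C)))" by (rule growth)
      also have "\<dots> \<le> real (card (Ball R) * card (Ball (C + R)) *
          card {g \<in> Sphere (j + (k - j)). dist g x + j \<le> len x + (k - j) + 2 * (C + R)})"
        using card_Sphere_near[OF x(1), of j "k - j"] x(2) j by (simp only: of_nat_le_iff)
      also have "\<dots> \<le> real (card (Ball R) * card (Ball (C + R)) * card (A j))"
        using sub by (intro of_nat_mono mult_left_mono) auto
      finally show ?thesis unfolding L_def by simp
    qed
    \<comment> \<open>Each \<open>j\<close> accounts for the same amount \<open>q ^ (2 * k)\<close>;
      this is the origin of the factor \<open>k + 1\<close>.\<close>
    have "(real k + 1) * q ^ (2 * k) = (\<Sum>j\<le>k. q ^ (2 * j) * q ^ (2 * (k - j)))"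
    proof -
      have "q ^ (2 * j) * q ^ (2 * (k - j)) = q ^ (2 * k)" if "j \<le> k" for j
        using that by (simp add: power_add[symmetric] algebra_simps)
      then show ?thesis by simp
    qed
    also have "\<dots> \<le> (\<Sum>j\<le>k. q ^ (2 * j) * (L * real (card (A j))))"
      using Aj q by (intro sum_mono mult_left_mono) auto
    also have "\<dots> = L * (\<Sum>j\<in>{..k}. \<Sum>g | g \<in> Sphere k \<and> 2 * j \<le> m + k + D - dist g x. q ^ (2 * j))"
      unfolding A_def by (simp add: sum_distrib_left mult.commute mult.left_commute)
    also have "\<dots> = L * (\<Sum>g\<in>Sphere k. \<Sum>j | j \<in> {..k} \<and> 2 * j \<le> m + k + D - dist g x. q ^ (2 * j))"
      by (subst sum.swap_restrict) auto
    also have "\<dots> \<le> L * (\<Sum>g\<in>Sphere k. q\<^sup>2 / (q\<^sup>2 - 1) * q ^ (m + k + D - dist g x))"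
      using sum_power_upto_half[OF q] L by (intro mult_left_mono sum_mono) auto
    also have "\<dots> = L * (\<Sum>g\<in>Sphere k. E * q ^ (m + k) * (1 / q) ^ dist g x)"
    proof -
      have "q ^ (m + k + D - dist g x) = q ^ D * q ^ (m + k) * (1 / q) ^ dist g x" if "g \<in> Sphere k" for g
        using dle[OF that] q by (simp add: power_diff power_add power_divide)
      then show ?thesis unfolding E_def by (intro arg_cong[of _ _ "\<lambda>z. L * z"] sum.cong) auto
    qed
    also have "\<dots> = (L * E) * (q ^ (m + k) * (\<Sum>g\<in>Sphere k. (1 / q) ^ dist g x))"
      by (simp add: sum_distrib_left mult.assoc)
    finally have "(real k + 1) * q ^ (2 * k) / (L * E * q ^ (m + k)) \<le> (\<Sum>g\<in>Sphere k. (1 / q) ^ dist g x)"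
      using L E q by (simp add: pos_divide_le_eq mult.commute mult.left_commute)
    moreover have "(1 / (L * E)) * (real k + 1) * q ^ k * (1 / q) ^ m = (real k + 1) * q ^ (2 * k) / (L * E * q ^ (m + k))"
      using q L E by (simp add: power_add power_divide mult_2)
    ultimately show ?thesis unfolding m_def by simp
  qed
  moreover have "1 / (L * E) > 0" using L E by simp
  ultimately show ?thesis by blast
qed

text \<open>Pairing with the test function over the shell \<open>n \<le> len x \<le> 2 * n\<close>:
  from \<open>n\<close> on, every \<open>k \<le> n\<close> is covered by
  \<open>sphere_average_lower\<close>, and up to \<open>2 * n\<close> the convolution does not see
  the truncation at \<open>3 * n\<close>. Shell and ball both have squared norm of order
  \<open>n + 1\<close>, which cancels.\<close>

theorem radial_norm_lower:
  fixes q :: real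
  assumes q: "q > 1" and growth: "\<And>n. q ^ (2 * n) \<le> real (card (Sphere n))"
    "\<And>n. real (card (Sphere n)) \<le> K * q ^ (2 * n)"
  shows "\<exists>\<kappa>>0. \<forall>n c. (\<forall>k\<le>n. c k \<ge> 0) \<longrightarrow>
    \<kappa> * (\<Sum>k\<le>n. (real k + 1) * c k * q ^ k) \<le> regular_norm G (rad n c)"
proof -
  obtain \<kappa> where \<kappa>: "\<kappa> > 0" "\<And>k x. \<lbrakk>x \<in> carrier G; k \<le> len x\<rbrakk> \<Longrightarrow>
    \<kappa> * (real k + 1) * q ^ k * (1 / q) ^ len x \<le> (\<Sum>g\<in>Sphere k. (1 / q) ^ dist g x)"
    using sphere_average_lower[OF q growth(1)] by blast
  have K: "K \<ge> 1" using growth(1)[of 0] growth(2)[of 0] by simp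
  have "(\<kappa> / (3 * K)) * (\<Sum>k\<le>n. (real k + 1) * c k * q ^ k) \<le> regular_norm G (rad n c)"
    if c: "\<forall>k\<le>n. c k \<ge> 0" for n c
  proof -
    define W where "W = (\<Sum>k\<le>n. (real k + 1) * c k * q ^ k)"
    define N where "N = 3 * n"
    define \<phi> where "\<phi> x = (if x \<in> Ball N then (1 / q) ^ len x else 0)" for x
    define f where "f = (\<lambda>x. complex_of_real (\<phi> x))"
    have \<phi>0: "\<phi> x \<ge> 0" for x unfolding \<phi>_def using q by simp
    define u where "u = left_regular G (rad n c) f"
    define v where "v x = (\<Sum>k\<le>n. \<Sum>y\<in>Sphere k. c k * \<phi> (inv y \<otimes> x))" for x
    have uv: "u x = complex_of_real (v x)" if "x \<in> carrier G" for x
      unfolding u_def v_def f_def left_regular_rad using that by simp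
    have v0: "v x \<ge> 0" for x unfolding v_def using c \<phi>0 by (auto intro!: sum_nonneg)
    have f: "f \<in> l2_space G" "l2_norm G f = sqrt (\<Sum>x\<in>Ball N. (cmod (f x))\<^sup>2)"
    proof -
      have "Ball N \<subseteq> carrier G" "\<And>x. x \<notin> Ball N \<Longrightarrow> f x = 0"
        unfolding f_def \<phi>_def Ball_def by auto
      then show "f \<in> l2_space G" "l2_norm G f = sqrt (\<Sum>x\<in>Ball N. (cmod (f x))\<^sup>2)"
        using l2_finite_support[OF finite_Ball[of N]] by blast+
    qed
    have nf: "(l2_norm G f)\<^sup>2 = (\<Sum>x\<in>Ball N. (\<phi> x)\<^sup>2)"
      unfolding f(2) by (simp add: f_def sum_nonneg)
    also have "\<dots> = (\<Sum>x\<in>Ball N. ((1 / q) ^ len x)\<^sup>2)" by (rule sum.cong) (auto simp: \<phi>_def)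
    also have "\<dots> = (\<Sum>k\<le>N. real (card (Sphere k)) * ((1 / q) ^ k)\<^sup>2)"
      by (rule sum_Ball_radial)
    also have "\<dots> \<le> (\<Sum>k\<le>N. K)"
    proof (rule sum_mono)
      fix k
      have "real (card (Sphere k)) * ((1 / q) ^ k)\<^sup>2 \<le> (K * q ^ (2 * k)) * ((1 / q) ^ k)\<^sup>2"
        by (intro mult_right_mono growth) auto
      also have "\<dots> = K" using q by (simp add: power_divide power_mult[symmetric] mult.commute)
      finally show "real (card (Sphere k)) * ((1 / q) ^ k)\<^sup>2 \<le> K" .
    qed
    also have "\<dots> = K * (3 * real n + 1)" unfolding N_def by simp
    also have "\<dots> \<le> K * (3 * (real n + 1))" using K by (intro mult_left_mono) auto
    finally have upper: "(l2_norm G f)\<^sup>2 \<le> 3 * K * (real n + 1)" by (simp add: algebra_simps)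
    \<comment> \<open>The upper bound supplies the finiteness of the operator norm.\<close>
    have B0: "2 * ambiguity * (\<Sum>k\<le>n. (real k + 1) * c k * sqrt (card (Sphere k))) \<ge> 0"
      using c ambiguity_pos by (auto intro!: mult_nonneg_nonneg sum_nonneg)
    have reg: "l2_norm G u \<le> regular_norm G (rad n c) * l2_norm G f"
      unfolding u_def by (rule regular_norm_le(2)[OF B0 haagerup_radial f(1)]) (use c in auto)
    have u: "u \<in> l2_space G"
    proof (rule l2_finite_support(1)[of "Ball (N + n)"])
      fix x assume x: "x \<notin> Ball (N + n)"
      show "u x = 0"
      proof (cases "x \<in> carrier G")
        case True
        have "\<phi> (inv y \<otimes> x) = 0" if "y \<in> Sphere k" "k \<le> n" for y k
          using len_ge_diff[of "inv y" x] that x True len_inv[of y] unfolding \<phi>_def Sphere_def Ball_def by auto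
        then show ?thesis unfolding uv[OF True] v_def by simp
      qed (simp add: u_def left_regular_rad)
    qed (auto simp: Ball_def finite_len_le)
    have "\<kappa> * W * (\<phi> x)\<^sup>2 \<le> \<phi> x * v x" if x: "x \<in> carrier G" "n \<le> len x" "len x \<le> 2 * n" for x
    proof -
      have \<phi>x: "\<phi> x = (1 / q) ^ len x" unfolding \<phi>_def Ball_def N_def using x by auto
      have "\<kappa> * W * \<phi> x = (\<Sum>k\<le>n. c k * (\<kappa> * (real k + 1) * q ^ k * (1 / q) ^ len x))"
        unfolding W_def \<phi>x by (simp add: sum_distrib_left sum_distrib_right mult.commute mult.left_commute)
      also have "\<dots> \<le> (\<Sum>k\<le>n. c k * (\<Sum>g\<in>Sphere k. (1 / q) ^ dist g x))"
        using c x by (intro sum_mono mult_left_mono \<kappa>(2)) auto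
      also have "\<dots> = v x"
        unfolding v_def sum_distrib_left
      proof (intro sum.cong HOL.refl)
        fix k g assume "k \<in> {..n}" "g \<in> Sphere k"
        then have "inv g \<otimes> x \<in> Ball N"
          using len_mult[of "inv g" x] x len_inv[of g] unfolding Ball_def Sphere_def N_def by auto
        then show "c k * (1 / q) ^ dist g x = c k * \<phi> (inv g \<otimes> x)" unfolding \<phi>_def dist_def by simp
      qed
      finally have "\<kappa> * W * \<phi> x \<le> v x" .
      then have "\<phi> x * (\<kappa> * W * \<phi> x) \<le> \<phi> x * v x" using \<phi>0 by (rule mult_left_mono)
      then show ?thesis by (simp add: power2_eq_square mult.commute mult.left_commute)
    qed
    then have "(\<Sum>x | x \<in> Ball (2 * n) \<and> n \<le> len x. \<kappa> * W * (\<phi> x)\<^sup>2) \<le>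
        (\<Sum>x | x \<in> Ball (2 * n) \<and> n \<le> len x. \<phi> x * v x)"
      by (intro sum_mono) (auto simp: Ball_def)
    also have "\<dots> \<le> (\<Sum>x\<in>Ball N. \<phi> x * v x)"
      by (rule sum_mono2) (use \<phi>0 v0 in \<open>auto simp: Ball_def N_def finite_len_le\<close>)
    also have "\<dots> \<le> L2_set \<phi> (Ball N) * L2_set v (Ball N)"
      using L2_set_mult_ineq[of \<phi> v "Ball N"] \<phi>0 v0 by simp
    also have "\<dots> \<le> l2_norm G f * l2_norm G u"
    proof (rule mult_mono)
      show "L2_set \<phi> (Ball N) \<le> l2_norm G f" unfolding f(2) L2_set_def by (simp add: f_def)
      have "(\<Sum>x\<in>Ball N. (v x)\<^sup>2) = (\<Sum>x\<in>Ball N. (cmod (u x))\<^sup>2)"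
        by (rule sum.cong) (auto simp: uv Ball_def)
      also have "\<dots> \<le> (l2_norm G u)\<^sup>2" by (rule l2_sum_le[OF u]) (auto simp: Ball_def finite_len_le)
      finally show "L2_set v (Ball N) \<le> l2_norm G u"
        unfolding L2_set_def using l2_norm_nonneg[of G u] by (simp add: real_le_lsqrt sum_nonneg)
    qed (auto simp: l2_norm_nonneg L2_set_nonneg)
    also have "\<dots> \<le> l2_norm G f * (regular_norm G (rad n c) * l2_norm G f)"
      using reg l2_norm_nonneg by (rule mult_left_mono)
    finally have main: "\<kappa> * W * (\<Sum>x | x \<in> Ball (2 * n) \<and> n \<le> len x. (\<phi> x)\<^sup>2) \<le>
        regular_norm G (rad n c) * (l2_norm G f)\<^sup>2"
      by (simp add: sum_distrib_left power2_eq_square mult.commute mult.left_commute)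
    have low: "real n + 1 \<le> (\<Sum>x | x \<in> Ball (2 * n) \<and> n \<le> len x. (\<phi> x)\<^sup>2)"
    proof -
      have "(\<Sum>x | x \<in> Ball (2 * n) \<and> n \<le> len x. (\<phi> x)\<^sup>2) =
          (\<Sum>x\<in>Ball (2 * n). if n \<le> len x then ((1 / q) ^ len x)\<^sup>2 else 0)"
        by (subst sum.inter_filter[symmetric]) (auto intro!: sum.cong simp: \<phi>_def Ball_def N_def finite_len_le)
      also have "\<dots> = (\<Sum>k\<le>2 * n. real (card (Sphere k)) * (if n \<le> k then ((1 / q) ^ k)\<^sup>2 else 0))"
        by (rule sum_Ball_radial)
      also have "\<dots> \<ge> (\<Sum>k\<le>2 * n. if n \<le> k then 1 else 0)"
      proof (rule sum_mono)
        fix k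
        have "1 = q ^ (2 * k) * ((1 / q) ^ k)\<^sup>2"
          using q by (simp add: power_divide power_mult[symmetric] mult.commute)
        also have "\<dots> \<le> real (card (Sphere k)) * ((1 / q) ^ k)\<^sup>2"
          by (intro mult_right_mono growth) auto
        finally show "(if n \<le> k then 1 else 0) \<le> real (card (Sphere k)) * (if n \<le> k then ((1 / q) ^ k)\<^sup>2 else 0)"
          by simp
      qed
      moreover have "(\<Sum>k\<le>2 * n. if n \<le> k then 1 else (0::real)) = real n + 1"
      proof -
        have "{x. x \<le> 2 * n \<and> n \<le> x} = {n..2 * n}" by auto
        then show ?thesis by (simp add: sum.If_cases Int_def)
      qed
      ultimately show ?thesis by simp
    qed
    have W0: "W \<ge> 0" unfolding W_def using c q by (auto intro!: sum_nonneg mult_nonneg_nonneg)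
    \<comment> \<open>The sign is needed to replace the norm of \<open>f\<close> by its upper bound;
      a negative value would contradict \<open>main\<close>.\<close>
    have reg0: "regular_norm G (rad n c) \<ge> 0"
    proof (rule ccontr)
      assume neg: "\<not> ?thesis"
      have "(\<Sum>x | x \<in> Ball (2 * n) \<and> n \<le> len x. (\<phi> x)\<^sup>2) \<le> (l2_norm G f)\<^sup>2"
        unfolding nf by (rule sum_mono2) (auto simp: Ball_def N_def finite_len_le)
      then have "(l2_norm G f)\<^sup>2 > 0" using low by linarith
      then have "regular_norm G (rad n c) * (l2_norm G f)\<^sup>2 < 0" using neg by (simp add: mult_neg_pos)
      moreover have "0 \<le> \<kappa> * W * (\<Sum>x | x \<in> Ball (2 * n) \<and> n \<le> len x. (\<phi> x)\<^sup>2)"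
        using \<kappa> W0 by (auto intro!: mult_nonneg_nonneg sum_nonneg)
      ultimately show False using main by linarith
    qed
    have "\<kappa> * W * (real n + 1) \<le> \<kappa> * W * (\<Sum>x | x \<in> Ball (2 * n) \<and> n \<le> len x. (\<phi> x)\<^sup>2)"
      using low \<kappa> W0 by (intro mult_left_mono) auto
    also have "\<dots> \<le> regular_norm G (rad n c) * (3 * K * (real n + 1))"
      using main mult_left_mono[OF upper reg0] by linarith
    finally have "(\<kappa> * W) * (real n + 1) \<le> (regular_norm G (rad n c) * (3 * K)) * (real n + 1)"
      by (simp add: mult.assoc)
    then have "\<kappa> * W \<le> regular_norm G (rad n c) * (3 * K)"
      by (rule mult_right_le_imp_le) simp
    then show ?thesis unfolding W_def[symmetric] using K by (simp add: field_simps)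
  qed
  moreover have "\<kappa> / (3 * K) > 0" using \<kappa> K by simp
  ultimately show ?thesis by blast
qed

end

section \<open>Word lengths\<close>

context group
begin

definition word :: "'a list \<Rightarrow> 'a" where "word w = foldr (\<otimes>) w \<one>"

lemma word_simps: "word [] = \<one>" "word (x # w) = x \<otimes> word w" unfolding word_def by simp_all

lemma word_closed: "set w \<subseteq> carrier G \<Longrightarrow> word w \<in> carrier G"
  by (induction w) (auto simp: word_simps)

lemma word_append: "\<lbrakk>set v \<subseteq> carrier G; set w \<subseteq> carrier G\<rbrakk> \<Longrightarrow> word (v @ w) = word v \<otimes> word w"
  by (induction v) (auto simp: word_simps word_closed m_assoc)

lemma word_inv: "set w \<subseteq> carrier G \<Longrightarrow> word (rev (map (\<lambda>x. inv x) w)) = inv (word w)"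
proof (induction w)
  case (Cons x w)
  have "set (rev (map (\<lambda>x. inv x) w)) \<subseteq> carrier G" using Cons by auto
  then show ?case using Cons by (simp add: word_append word_simps word_closed inv_mult_group)
qed (simp add: word_simps)

lemma word_length_le: "\<lbrakk>set w \<subseteq> S; word w = x\<rbrakk> \<Longrightarrow> word_length G S x \<le> length w"
  unfolding word_length_def word_def by (rule Least_le) blast

context
  fixes S assumes S: "finite_symmetric_generating_set G S"
begin

lemma gensD: "finite S" "S \<subseteq> carrier G" "x \<in> S \<Longrightarrow> inv x \<in> S" "generate G S = carrier G"
  using S unfolding finite_symmetric_generating_set_def by auto

lemma word_exists:
  assumes "x \<in> carrier G"
  shows "\<exists>w. set w \<subseteq> S \<and> word w = x"
proof -
  have "x \<in> generate G S" using assms gensD(4) by simp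
  then show ?thesis
  proof (induction rule: generate.induct)
    case one
    then show ?case by (intro exI[of _ "[]"]) (simp add: word_simps)
  next
    case (incl h)
    then show ?case using gensD(2) by (intro exI[of _ "[h]"]) (auto simp: word_simps)
  next
    case (inv h)
    then show ?case using gensD(2) gensD(3)[of h] by (intro exI[of _ "[inv h]"]) (auto simp: word_simps)
  next
    case (eng h1 h2)
    then obtain v w where "set v \<subseteq> S" "word v = h1" "set w \<subseteq> S" "word w = h2" by blast
    then show ?case using gensD(2) by (intro exI[of _ "v @ w"]) (auto simp: word_append)
  qed
qed

lemma geodesic_word:
  assumes "x \<in> carrier G"
  shows "\<exists>w. set w \<subseteq> S \<and> word w = x \<and> length w = word_length G S x"
proof -
  have "\<exists>n. \<exists>w. length w = n \<and> set w \<subseteq> S \<and> word w = x" using word_exists[OF assms] by blast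
  then have "\<exists>w. length w = word_length G S x \<and> set w \<subseteq> S \<and> word w = x"
    unfolding word_length_def word_def by (rule LeastI_ex)
  then show ?thesis by blast
qed

text \<open>For splitting, both pieces of a shortest word are again shortest, because their lengths
  add up to that of \<open>x\<close>. Finiteness of balls is that of bounded words over a finite
  alphabet.\<close>

lemma length_group_word_length: "length_group G (word_length G S)"
proof (intro length_group.intro length_group_axioms.intro is_group)
  let ?l = "word_length G S"
  note subS = gensD(2)
  show "?l x = 0 \<longleftrightarrow> x = \<one>" if "x \<in> carrier G" for x
    using geodesic_word[OF that] word_length_le[of "[]" S \<one>] by (auto simp: word_simps)
  have inv_le: "?l (inv x) \<le> ?l x" if x: "x \<in> carrier G" for x
  proof -
    obtain w where w: "set w \<subseteq> S" "word w = x" "length w = ?l x" using geodesic_word[OF x] by blast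
    then have "word (rev (map (\<lambda>x. inv x) w)) = inv x" using word_inv[of w] subS by auto
    then show ?thesis using word_length_le[of "rev (map (\<lambda>x. inv x) w)" S "inv x"] w gensD(3) by auto
  qed
  show "?l (inv x) = ?l x" if "x \<in> carrier G" for x
    using inv_le[OF that] inv_le[of "inv x"] that by simp
  show mult: "?l (x \<otimes> y) \<le> ?l x + ?l y" if x: "x \<in> carrier G" and y: "y \<in> carrier G" for x y
  proof -
    obtain v w where "set v \<subseteq> S" "word v = x" "length v = ?l x" "set w \<subseteq> S" "word w = y" "length w = ?l y"
      using geodesic_word[OF x] geodesic_word[OF y] by blast
    then show ?thesis using word_length_le[of "v @ w" S "x \<otimes> y"] word_append[of v w] subS by auto
  qed
  show "\<exists>y\<in>carrier G. \<exists>z\<in>carrier G. x = y \<otimes> z \<and> ?l y = k \<and> ?l z = ?l x - k"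
    if x: "x \<in> carrier G" and k: "k \<le> ?l x" for x k
  proof -
    obtain w where w: "set w \<subseteq> S" "word w = x" "length w = ?l x" using geodesic_word[OF x] by blast
    define y where "y = word (take k w)"
    define z where "z = word (drop k w)"
    have sub: "set (take k w) \<subseteq> S" "set (drop k w) \<subseteq> S"
      using w(1) set_take_subset[of k w] set_drop_subset[of k w] by auto
    have yz: "y \<in> carrier G" "z \<in> carrier G" unfolding y_def z_def using sub subS by (auto intro!: word_closed)
    have xyz: "x = y \<otimes> z"
      using word_append[of "take k w" "drop k w"] sub subS w(2) unfolding y_def z_def by auto
    have "?l y \<le> k" "?l z \<le> ?l x - k"
      using word_length_le[OF sub(1) y_def[symmetric]] word_length_le[OF sub(2) z_def[symmetric]] w(3) k by auto
    then have "?l y = k \<and> ?l z = ?l x - k" using mult[OF yz] xyz k by auto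
    then show ?thesis using xyz yz by blast
  qed
  show "finite {x \<in> carrier G. ?l x \<le> n}" for n
  proof (rule finite_subset)
    show "{x \<in> carrier G. ?l x \<le> n} \<subseteq> word ` {w. set w \<subseteq> S \<and> length w \<le> n}"
      using geodesic_word by (auto simp: image_iff) metis
    show "finite (word ` {w. set w \<subseteq> S \<and> length w \<le> n})"
      using finite_lists_length_le[OF gensD(1)] by simp
  qed
qed

text \<open>Applied to two word lengths in both directions, this gives their bi-Lipschitz
  equivalence.\<close>

lemma length_le_word_length:
  assumes "length_group G l"
  shows "\<exists>L. \<forall>x\<in>carrier G. l x \<le> L * word_length G S x"
proof -
  interpret L: length_group G l by (rule assms)
  define L where "L = Max (insert 0 (l ` S))"
  have S_le: "l a \<le> L" if "a \<in> S" for a unfolding L_def using that gensD(1) by (intro Max_ge) auto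
  have "l (word w) \<le> L * length w" if "set w \<subseteq> S" for w
    using that
  proof (induction w)
    case (Cons a w)
    then have "l (a \<otimes> word w) \<le> l a + l (word w)" using gensD(2) by (intro L.len_mult word_closed) auto
    then show ?case using Cons S_le[of a] by (simp add: word_simps)
  qed (simp add: word_simps)
  then show ?thesis using geodesic_word by metis
qed

end

text \<open>Hyperbolicity of \<open>T\<close> is carried over to \<open>S\<close> before spreading
  is derived, since spreading and the norms both refer to the length given by
  \<open>S\<close>.\<close>

lemma spreading_group_word_length:
  assumes hyp: "hyperbolic_group G" and non: "\<not> elementary_group G"
    and S: "finite_symmetric_generating_set G S"
  shows "\<exists>\<Delta> R C. spreading_group G (word_length G S) \<Delta> R C"
proof -
  obtain T \<delta> where T: "finite_symmetric_generating_set G T" and "\<delta> \<ge> 0" and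
    \<delta>: "\<And>p x y z. \<lbrakk>p \<in> carrier G; x \<in> carrier G; y \<in> carrier G; z \<in> carrier G\<rbrakk> \<Longrightarrow>
      gromov_product (word_dist G T) p x z \<ge>
      min (gromov_product (word_dist G T) p x y) (gromov_product (word_dist G T) p y z) - \<delta>"
    using hyp unfolding hyperbolic_group_def gromov_hyperbolic_def by blast
  interpret LT: length_group G "word_length G T" by (rule length_group_word_length[OF T])
  interpret LS: length_group G "word_length G S" by (rule length_group_word_length[OF S])
  have dist: "word_dist G T x y = real (LT.dist x y)" for x y
    unfolding word_dist_def LT.dist_def by simp
  have gp: "gromov_product (word_dist G T) p x y = real_of_int (gp LT.dist p x y) / 2" for p x y
    unfolding gromov_product_def dist gp_def by simp
  have "four_point (carrier G) LT.dist (nat \<lceil>2 * \<delta>\<rceil>)"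
    unfolding four_point_def
  proof (intro ballI)
    fix p x y z assume "p \<in> carrier G" "x \<in> carrier G" "y \<in> carrier G" "z \<in> carrier G"
    from \<delta>[OF this] have "real_of_int (min (gp LT.dist p x y) (gp LT.dist p y z)) \<le>
        real_of_int (gp LT.dist p x z) + 2 * \<delta>"
      unfolding gp by (auto simp: min_def split: if_splits)
    then have "min (gp LT.dist p x y) (gp LT.dist p y z) \<le> gp LT.dist p x z + \<lceil>2 * \<delta>\<rceil>"
      by linarith
    then show "min (gp LT.dist p x y) (gp LT.dist p y z) \<le> gp LT.dist p x z + int (nat \<lceil>2 * \<delta>\<rceil>)"
      by linarith
  qed
  moreover obtain L1 where "\<forall>x\<in>carrier G. word_length G T x \<le> L1 * word_length G S x"
    using length_le_word_length[OF S LT.length_group_axioms] by blast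
  moreover obtain L2 where "\<forall>x\<in>carrier G. word_length G S x \<le> L2 * word_length G T x"
    using length_le_word_length[OF T LS.length_group_axioms] by blast
  ultimately have "bilipschitz_pair (carrier G) LT.dist LS.dist (L1 + L2) (nat \<lceil>2 * \<delta>\<rceil>)"
    by unfold_locales (auto simp: LT.dist_def LS.dist_def add_mult_distrib intro: trans_le_add1 trans_le_add2)
  then obtain \<Delta> where "four_point (carrier G) LS.dist \<Delta>"
    using bilipschitz_pair.four_point_transfer by blast
  then interpret HS: hyperbolic_length G "word_length G S" \<Delta>
    by unfold_locales
  show ?thesis using HS.spreading_group_of_nonelementary[OF non] by blast
qed

end

section \<open>Norms of radial elements\<close>

lemma comparable_onI:
  assumes "A > 0" "B > 0" "\<And>x. x \<in> I \<Longrightarrow> f x \<le> A * g x" "\<And>x. x \<in> I \<Longrightarrow> g x \<le> B * f x"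
  shows "comparable_on I f g"
  using assms unfolding comparable_on_def dominated_on_def by blast

lemma dominated_on_trans:
  assumes "dominated_on I f g" "dominated_on I g h"
  shows "dominated_on I f h"
proof -
  obtain A B where "A > 0" "B > 0" and le: "\<And>x. x \<in> I \<Longrightarrow> f x \<le> A * g x" "\<And>x. x \<in> I \<Longrightarrow> g x \<le> B * h x"
    using assms unfolding dominated_on_def by blast
  have "f x \<le> (A * B) * h x" if x: "x \<in> I" for x
  proof -
    have "A * g x \<le> A * (B * h x)" using le(2)[OF x] \<open>A > 0\<close> by (intro mult_left_mono) auto
    then show ?thesis using le(1)[OF x] by simp
  qed
  then show ?thesis using \<open>A > 0\<close> \<open>B > 0\<close> unfolding dominated_on_def by (metis mult_pos_pos)
qed

lemma comparable_on_trans: "\<lbrakk>comparable_on I f g; comparable_on I g h\<rbrakk> \<Longrightarrow> comparable_on I f h"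
  unfolding comparable_on_def by (meson dominated_on_trans)

lemma comparable_on_reindex:
  "\<lbrakk>comparable_on I f g; \<And>x. x \<in> J \<Longrightarrow> r x \<in> I\<rbrakk> \<Longrightarrow> comparable_on J (\<lambda>x. f (r x)) (\<lambda>x. g (r x))"
  unfolding comparable_on_def dominated_on_def by metis

lemma comparable_on_cong:
  "\<lbrakk>comparable_on I f g; \<And>x. x \<in> I \<Longrightarrow> f x = f' x; \<And>x. x \<in> I \<Longrightarrow> g x = g' x\<rbrakk> \<Longrightarrow>
    comparable_on I f' g'"
  unfolding comparable_on_def dominated_on_def by metis

lemma sum_squares_bounds:
  "(real n + 1) ^ 3 \<le> 3 * (\<Sum>k\<le>n. (real k + 1)\<^sup>2)" "(\<Sum>k\<le>n. (real k + 1)\<^sup>2) \<le> (real n + 1) ^ 3"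
proof (induction n)
  case (Suc n)
  case 1
  have "(real (Suc n) + 1) ^ 3 \<le> (real n + 1) ^ 3 + 3 * (real (Suc n) + 1)\<^sup>2"
    by (simp add: power2_eq_square power3_eq_cube algebra_simps)
  then show ?case using Suc(1) by simp
  case 2
  have "(real n + 1) ^ 3 + (real (Suc n) + 1)\<^sup>2 \<le> (real (Suc n) + 1) ^ 3"
    by (simp add: power2_eq_square power3_eq_cube algebra_simps)
  then show ?case using Suc(2) by simp
qed auto

lemma harm_le_ln: "harm (Suc n) \<le> 1 + ln (real n + 1)"
proof -
  have "harm (Suc n) - ln (real (Suc n)) \<le> harm (Suc 0) - ln (real (Suc 0))"
    using decseq_harm_diff_ln by (rule decseqD) simp
  then show ?thesis by (simp add: harm_expand add.commute)
qed

lemma harm_Suc_sum: "harm (Suc n) = (\<Sum>k\<le>n. 1 / (real k + 1))"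
  unfolding harm_altdef lessThan_Suc_atMost by (simp add: inverse_eq_divide add.commute)

context spreading_group
begin

text \<open>For nonnegative \<open>c\<close>, what the triangle inequality and Haagerup's inequality
  on spheres yield, without the constant.\<close>

definition radial_weight :: "nat \<Rightarrow> (nat \<Rightarrow> real) \<Rightarrow> real" where
  "radial_weight n c = (\<Sum>k\<le>n. (real k + 1) * (c k * sqrt (card (Sphere k))))"

text \<open>The triangle inequality over the spheres loses only a constant here. The lower bound
  comes with \<open>q ^ k\<close>, which growth exchanges for \<open>sqrt (card (Sphere k))\<close>.
  Indexing by pairs makes the constants independent of \<open>n\<close> and
  \<open>c\<close>.\<close>

theorem radial_norm_comparable:
  "comparable_on {(n, c). \<forall>k\<le>n. c k \<ge> 0} (\<lambda>(n, c). regular_norm G (rad n c)) (\<lambda>(n, c). radial_weight n c)"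
proof -
  obtain q K where q: "q > 1" "K > 0" and growth: "\<And>n. q ^ (2 * n) \<le> real (card (Sphere n))"
    "\<And>n. real (card (Sphere n)) \<le> K * q ^ (2 * n)"
    using Sphere_growth by blast
  obtain \<kappa> where \<kappa>: "\<kappa> > 0" "\<And>n c. (\<forall>k\<le>n. c k \<ge> 0) \<Longrightarrow>
    \<kappa> * (\<Sum>k\<le>n. (real k + 1) * c k * q ^ k) \<le> regular_norm G (rad n c)"
    using radial_norm_lower[OF q(1) growth] by blast
  have upper: "regular_norm G (rad n c) \<le> (2 * ambiguity) * radial_weight n c" if c: "\<forall>k\<le>n. c k \<ge> 0" for n c
  proof -
    have "2 * ambiguity * (\<Sum>k\<le>n. (real k + 1) * c k * sqrt (card (Sphere k))) \<ge> 0"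
      using c ambiguity_pos by (auto intro!: mult_nonneg_nonneg sum_nonneg)
    then have "regular_norm G (rad n c) \<le> 2 * ambiguity * (\<Sum>k\<le>n. (real k + 1) * c k * sqrt (card (Sphere k)))"
      by (rule regular_norm_le(1)) (rule haagerup_radial, use c in auto)
    then show ?thesis unfolding radial_weight_def by (simp add: mult.assoc)
  qed
  have lower: "radial_weight n c \<le> (sqrt K / \<kappa>) * regular_norm G (rad n c)" if c: "\<forall>k\<le>n. c k \<ge> 0" for n c
  proof -
    have sq: "sqrt (card (Sphere k)) \<le> sqrt K * q ^ k" for k
    proof -
      have "sqrt (card (Sphere k)) \<le> sqrt (K * q ^ (2 * k))" using growth(2) by (rule real_sqrt_le_mono)
      also have "\<dots> = sqrt K * q ^ k" using q by (simp add: real_sqrt_mult power_even_eq)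
      finally show ?thesis .
    qed
    have "radial_weight n c \<le> (\<Sum>k\<le>n. (real k + 1) * (c k * (sqrt K * q ^ k)))"
      unfolding radial_weight_def using c sq by (intro sum_mono mult_left_mono) auto
    also have "\<dots> = sqrt K * (\<Sum>k\<le>n. (real k + 1) * c k * q ^ k)"
      by (simp add: sum_distrib_left mult.commute mult.left_commute)
    also have "\<dots> \<le> sqrt K * (regular_norm G (rad n c) / \<kappa>)"
      using \<kappa>(2)[OF c] \<kappa>(1) q by (intro mult_left_mono) (auto simp: field_simps)
    finally show ?thesis by simp
  qed
  show ?thesis
    by (rule comparable_onI[of "2 * ambiguity" "sqrt K / \<kappa>"])
      (use upper lower ambiguity_pos q \<kappa> in auto)
qed

text \<open>By exponential growth the term \<open>k = n\<close> dominates both the weight and the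
  norm, so both sides have the order of \<open>(n + 1) * s n\<close>.\<close>

lemma ball_weight_comparable:
  "comparable_on UNIV (\<lambda>n. radial_weight n (\<lambda>k. 1)) (\<lambda>n. (real n + 1) * l2_norm G (rad n (\<lambda>k. 1)))"
proof -
  obtain q K where q: "q > 1" "K > 0" and growth: "\<And>n. q ^ (2 * n) \<le> real (card (Sphere n))"
    "\<And>n. real (card (Sphere n)) \<le> K * q ^ (2 * n)"
    using Sphere_growth by blast
  define s where "s n = sqrt (card (Sphere n))" for n
  have s0: "s n \<ge> 0" for n unfolding s_def by simp
  have sqq: "sqrt (q ^ (2 * n)) = q ^ n" for n using q by (simp add: power_even_eq)
  have s1: "q ^ n \<le> s n" for n
    using real_sqrt_le_mono[OF growth(1)[of n]] unfolding s_def sqq .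
  have s2: "s n \<le> sqrt K * q ^ n" for n
    using real_sqrt_le_mono[OF growth(2)[of n]] unfolding s_def real_sqrt_mult sqq .
  have geo: "(\<Sum>k\<le>n. r ^ k) \<le> r / (r - 1) * r ^ n" if "r > 1" for r :: real and n
  proof -
    have "(\<Sum>k\<le>n. r ^ k) = (r ^ Suc n - 1) / (r - 1)"
      using geometric_sum[of r "Suc n"] that by (simp add: lessThan_Suc_atMost)
    also have "\<dots> \<le> r ^ Suc n / (r - 1)" using that by (intro divide_right_mono) auto
    finally show ?thesis by simp
  qed
  define A where "A = sqrt K * (q / (q - 1))"
  define B where "B = sqrt (K * (q\<^sup>2 / (q\<^sup>2 - 1)))"
  have q2: "q\<^sup>2 > 1" using q by (simp add: one_less_power)
  have AB: "A > 0" "B > 0" unfolding A_def B_def using q q2 by auto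
  have l2: "l2_norm G (rad n (\<lambda>k. 1)) = sqrt (\<Sum>k\<le>n. (s k)\<^sup>2)" for n
    unfolding l2_norm_rad s_def by simp
  have l2_ge: "s n \<le> l2_norm G (rad n (\<lambda>k. 1))" for n
  proof -
    have "(s n)\<^sup>2 \<le> (\<Sum>k\<le>n. (s k)\<^sup>2)" by (rule member_le_sum) auto
    then show ?thesis unfolding l2 using real_le_rsqrt by blast
  qed
  have l2_le: "l2_norm G (rad n (\<lambda>k. 1)) \<le> B * s n" for n
  proof -
    have "(\<Sum>k\<le>n. (s k)\<^sup>2) \<le> (\<Sum>k\<le>n. K * (q\<^sup>2) ^ k)"
      unfolding s_def using growth(2) by (intro sum_mono) (simp add: power_mult)
    also have "\<dots> \<le> K * (q\<^sup>2 / (q\<^sup>2 - 1) * (q\<^sup>2) ^ n)"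
      unfolding sum_distrib_left[symmetric] using geo[OF q2] q by (intro mult_left_mono) auto
    also have "\<dots> \<le> K * (q\<^sup>2 / (q\<^sup>2 - 1) * (s n)\<^sup>2)"
      using growth(1)[of n] q q2 unfolding s_def by (intro mult_left_mono) (auto simp: power_mult)
    also have "\<dots> = (B * s n)\<^sup>2" unfolding B_def power_mult_distrib using q q2 by simp
    finally show ?thesis unfolding l2 using AB s0 by (intro real_le_lsqrt) (auto intro: sum_nonneg)
  qed
  have w: "radial_weight n (\<lambda>k. 1) = (\<Sum>k\<le>n. (real k + 1) * s k)" for n
    unfolding radial_weight_def s_def by simp
  show ?thesis
  proof (rule comparable_onI[OF AB])
    fix n :: nat
    have "radial_weight n (\<lambda>k. 1) \<le> (\<Sum>k\<le>n. (real n + 1) * (sqrt K * q ^ k))"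
      unfolding w using s2 s0 by (intro sum_mono mult_mono) auto
    also have "\<dots> = (real n + 1) * (sqrt K * (\<Sum>k\<le>n. q ^ k))" by (simp add: sum_distrib_left)
    also have "\<dots> \<le> (real n + 1) * (sqrt K * (q / (q - 1) * q ^ n))"
      using geo[OF q(1)] q by (intro mult_left_mono) auto
    also have "\<dots> = A * ((real n + 1) * q ^ n)" unfolding A_def by simp
    also have "\<dots> \<le> A * ((real n + 1) * l2_norm G (rad n (\<lambda>k. 1)))"
      using AB order.trans[OF s1 l2_ge] by (intro mult_left_mono) auto
    finally show "radial_weight n (\<lambda>k. 1) \<le> A * ((real n + 1) * l2_norm G (rad n (\<lambda>k. 1)))" .
    have "(real n + 1) * l2_norm G (rad n (\<lambda>k. 1)) \<le> (real n + 1) * (B * s n)"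
      using l2_le by (intro mult_left_mono) auto
    also have "\<dots> = B * ((real n + 1) * s n)" by simp
    also have "\<dots> \<le> B * radial_weight n (\<lambda>k. 1)"
    proof -
      have "(real n + 1) * s n \<le> (\<Sum>k\<le>n. (real k + 1) * s k)"
        using s0 by (intro member_le_sum[where f = "\<lambda>k. (real k + 1) * s k"]) auto
      then show ?thesis unfolding w using AB by (intro mult_left_mono) auto
    qed
    finally show "(real n + 1) * l2_norm G (rad n (\<lambda>k. 1)) \<le> B * radial_weight n (\<lambda>k. 1)" .
  qed
qed

section \<open>Radial elements with prescribed norms of the spherical parts\<close>

definition profile :: "(nat \<Rightarrow> real) \<Rightarrow> nat \<Rightarrow> (nat \<Rightarrow> real) \<Rightarrow> bool" where
  "profile h n c \<longleftrightarrow> (\<forall>k\<le>n. c k \<ge> 0 \<and> c k * sqrt (card (Sphere k)) = h k)"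

lemma profile_exists:
  assumes "\<And>k. h k \<ge> 0"
  shows "\<exists>c. profile h n c"
proof -
  have "real (card (Sphere k)) > 0" for k using Sphere_nonempty[OF infinite_carrier, of k] by linarith
  then show ?thesis unfolding profile_def
    by (intro exI[of _ "\<lambda>k. h k / sqrt (card (Sphere k))"]) (use assms in \<open>auto simp: less_imp_neq[symmetric]\<close>)
qed

lemma profile_norms:
  assumes "profile h n c"
  shows "radial_weight n c = (\<Sum>k\<le>n. (real k + 1) * h k)" "l2_norm G (rad n c) = sqrt (\<Sum>k\<le>n. (h k)\<^sup>2)"
proof -
  show "radial_weight n c = (\<Sum>k\<le>n. (real k + 1) * h k)"
    using assms unfolding radial_weight_def profile_def by auto
  have "real (card (Sphere k)) * (c k)\<^sup>2 = (h k)\<^sup>2" if "k \<le> n" for k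
  proof -
    have "h k = c k * sqrt (card (Sphere k))" using assms that unfolding profile_def by auto
    then show ?thesis by (simp add: power_mult_distrib)
  qed
  then show "l2_norm G (rad n c) = sqrt (\<Sum>k\<le>n. (h k)\<^sup>2)"
    unfolding l2_norm_rad by (intro arg_cong[of _ _ sqrt] sum.cong) auto
qed

lemma infsum_rad_weighted:
  assumes "profile h n c"
  shows "(\<Sum>\<^sub>\<infinity>x\<in>carrier G. w (len x) * (cmod (rad n c x))\<^sup>2) = (\<Sum>k\<le>n. w k * (h k)\<^sup>2)"
proof -
  have "(\<Sum>\<^sub>\<infinity>x\<in>carrier G. w (len x) * (cmod (rad n c x))\<^sup>2) = (\<Sum>x\<in>Ball n. w (len x) * (cmod (rad n c x))\<^sup>2)"
    by (rule infsum_finite_support) (auto simp: rad_eq Ball_def finite_len_le)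
  also have "\<dots> = (\<Sum>x\<in>Ball n. w (len x) * (c (len x))\<^sup>2)"
    by (rule sum.cong) (auto simp: rad_eq)
  also have "\<dots> = (\<Sum>k\<le>n. real (card (Sphere k)) * (w k * (c k)\<^sup>2))" by (rule sum_Ball_radial)
  also have "\<dots> = (\<Sum>k\<le>n. w k * (h k)\<^sup>2)"
  proof (rule sum.cong)
    fix k assume "k \<in> {..n}"
    then have "h k = c k * sqrt (card (Sphere k))" using assms unfolding profile_def by auto
    then show "real (card (Sphere k)) * (w k * (c k)\<^sup>2) = w k * (h k)\<^sup>2" by (simp add: power_mult_distrib)
  qed simp
  finally show ?thesis .
qed

text \<open>Reduces assertions on operator norms to comparisons of explicit sums.\<close>

lemma regular_norm_comparable:
  assumes "\<And>i. i \<in> I \<Longrightarrow> \<forall>k\<le>N i. c i k \<ge> 0"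
    and "comparable_on I (\<lambda>i. radial_weight (N i) (c i)) g"
  shows "comparable_on I (\<lambda>i. regular_norm G (rad (N i) (c i))) g"
  using comparable_on_trans[OF comparable_on_reindex[OF radial_norm_comparable, of I "\<lambda>i. (N i, c i)"]] assms
  by simp

lemma l2_norm_sphere: "l2_norm G (rad n (\<lambda>k. if k = n then 1 else 0)) = sqrt (card (Sphere n))"
proof -
  have "(\<Sum>k\<le>n. real (card (Sphere k)) * (if k = n then 1 else 0)\<^sup>2) = (\<Sum>k\<le>n. if k = n then real (card (Sphere k)) else 0)"
    by (rule sum.cong) auto
  then show ?thesis unfolding l2_norm_rad by (simp add: sum.delta)
qed

lemma sphere_comparable:
  "comparable_on UNIV (\<lambda>n. regular_norm G (rad n (\<lambda>k. if k = n then 1 else 0)))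
    (\<lambda>n. (real n + 1) * l2_norm G (rad n (\<lambda>k. if k = n then 1 else 0)))"
proof (rule regular_norm_comparable)
  have "radial_weight n (\<lambda>k. if k = n then 1 else 0) = (real n + 1) * sqrt (card (Sphere n))" for n
  proof -
    have "radial_weight n (\<lambda>k. if k = n then 1 else 0) =
        (\<Sum>k\<le>n. if k = n then (real k + 1) * sqrt (card (Sphere k)) else 0)"
      unfolding radial_weight_def by (rule sum.cong) auto
    then show ?thesis by (simp add: sum.delta)
  qed
  then show "comparable_on UNIV (\<lambda>n. radial_weight n (\<lambda>k. if k = n then 1 else 0))
    (\<lambda>n. (real n + 1) * l2_norm G (rad n (\<lambda>k. if k = n then 1 else 0)))"
    unfolding l2_norm_sphere by (intro comparable_onI[of 1 1]) auto
qed auto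

lemma ball_comparable:
  "comparable_on UNIV (\<lambda>n. regular_norm G (rad n (\<lambda>k. 1))) (\<lambda>n. (real n + 1) * l2_norm G (rad n (\<lambda>k. 1)))"
  by (rule regular_norm_comparable[OF _ ball_weight_comparable]) auto

text \<open>With \<open>Q\<close> the sum of the squares of \<open>k + 1\<close>, the weight is
  \<open>Q\<close> and the norm \<open>sqrt Q\<close>; their quotient \<open>sqrt Q\<close> has the
  order of \<open>(n + 1) powr (3/2)\<close>.\<close>

lemma linear_profile_comparable:
  "comparable_on {(n, c). profile (\<lambda>k. real k + 1) n c} (\<lambda>(n, c). regular_norm G (rad n c))
    (\<lambda>(n, c). (real n + 1) powr (3/2) * l2_norm G (rad n c))"
proof -
  have "comparable_on {(n, c). profile (\<lambda>k. real k + 1) n c} (\<lambda>i. radial_weight (fst i) (snd i))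
    (\<lambda>(n, c). (real n + 1) powr (3/2) * l2_norm G (rad n c))"
  proof (rule comparable_onI[of 1 "sqrt 3"]; (clarify, unfold prod.case fst_conv snd_conv)?)
    fix n c assume p: "profile (\<lambda>k. real k + 1) n c"
    define Q where "Q = (\<Sum>k\<le>n. (real k + 1)\<^sup>2)"
    have Q0: "Q \<ge> 0" unfolding Q_def by (auto intro: sum_nonneg)
    have W: "radial_weight n c = sqrt Q * sqrt Q"
      using profile_norms(1)[OF p] Q0 unfolding Q_def by (simp add: power2_eq_square)
    have N: "l2_norm G (rad n c) = sqrt Q" using profile_norms(2)[OF p] unfolding Q_def .
    have P: "(real n + 1) powr (3/2) = sqrt ((real n + 1) ^ 3)"
    proof -
      have "sqrt ((real n + 1) ^ 3) = ((real n + 1) powr 3) powr (1/2)"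
        by (simp add: powr_half_sqrt powr_numeral)
      also have "\<dots> = (real n + 1) powr (3/2)" unfolding powr_powr by simp
      finally show ?thesis by (rule HOL.sym)
    qed
    have b: "sqrt Q \<le> sqrt ((real n + 1) ^ 3)" "sqrt ((real n + 1) ^ 3) \<le> sqrt 3 * sqrt Q"
      using sum_squares_bounds[of n] unfolding Q_def real_sqrt_mult[symmetric] by (auto intro: real_sqrt_le_mono)
    show "radial_weight n c \<le> 1 * ((real n + 1) powr (3/2) * l2_norm G (rad n c))"
      using mult_right_mono[OF b(1), of "sqrt Q"] Q0 unfolding P N fst_conv snd_conv W by simp
    show "(real n + 1) powr (3/2) * l2_norm G (rad n c) \<le> sqrt 3 * radial_weight n c"
      using mult_right_mono[OF b(2), of "sqrt Q"] Q0 unfolding P N fst_conv snd_conv W by (simp add: mult.assoc)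
  qed simp_all
  then have "comparable_on {(n, c). profile (\<lambda>k. real k + 1) n c} (\<lambda>i. regular_norm G (rad (fst i) (snd i)))
    (\<lambda>(n, c). (real n + 1) powr (3/2) * l2_norm G (rad n c))"
    by (rule regular_norm_comparable[rotated]) (auto simp: profile_def)
  then show ?thesis by (rule comparable_on_cong) auto
qed

text \<open>Weight and squared weighted norm are the same harmonic number, so weight over weighted
  norm is its square root.\<close>

lemma inverse_square_profile_norms:
  assumes p: "profile (\<lambda>k. (real k + 1) powr (-2)) n c"
  shows "radial_weight n c = harm (Suc n)"
    "(\<Sum>\<^sub>\<infinity>x\<in>carrier G. (real (len x) + 1) powr (2 * (3/2)) * (cmod (rad n c x))\<^sup>2) = harm (Suc n)"
proof -
  have e: "(real k + 1) powr (-2) = 1 / (real k + 1)\<^sup>2" for k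
    by (simp add: powr_minus powr_numeral inverse_eq_divide)
  have "radial_weight n c = (\<Sum>k\<le>n. 1 / (real k + 1))"
    unfolding profile_norms(1)[OF p] e by (intro sum.cong) (simp_all add: power2_eq_square)
  then show "radial_weight n c = harm (Suc n)" unfolding harm_Suc_sum .
  have "(real k + 1) powr (2 * (3/2)) * ((real k + 1) powr (-2))\<^sup>2 = 1 / (real k + 1)" for k
  proof -
    have "(real k + 1) powr (2 * (3/2)) = (real k + 1) ^ 3" by (simp add: powr_numeral)
    moreover have "real k + 1 \<noteq> 0" by linarith
    ultimately show ?thesis unfolding e by (simp add: power2_eq_square power3_eq_cube)
  qed
  then show "(\<Sum>\<^sub>\<infinity>x\<in>carrier G. (real (len x) + 1) powr (2 * (3/2)) * (cmod (rad n c x))\<^sup>2) = harm (Suc n)"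
    unfolding infsum_rad_weighted[OF p, of "\<lambda>k. (real k + 1) powr (2 * (3/2))"] harm_Suc_sum by simp
qed

lemma inverse_square_profile_comparable:
  "comparable_on {(n, c). n \<ge> 1 \<and> profile (\<lambda>k. (real k + 1) powr (-2)) n c} (\<lambda>(n, c). regular_norm G (rad n c))
    (\<lambda>(n, c). sqrt (ln (real n + 1)) *
      sqrt (\<Sum>\<^sub>\<infinity>x\<in>carrier G. (real (len x) + 1) powr (2 * (3/2)) * (cmod (rad n c x))\<^sup>2))"
    (is "comparable_on ?I _ ?g")
proof -
  \<comment> \<open>The summand 1 in \<open>1 + ln (n + 1)\<close>, the bound for the harmonic
    number, is absorbed by \<open>ln (n + 1) / ln 2\<close>, which is at least 1 for
    \<open>n \<ge> 1\<close>.\<close>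
  define A where "A = sqrt (1 + 1 / ln 2)"
  have A: "A > 0" unfolding A_def by (simp add: add_pos_pos)
  have "comparable_on ?I (\<lambda>i. radial_weight (fst i) (snd i)) ?g"
  proof (rule comparable_onI[of A 1]; (clarify, unfold prod.case fst_conv snd_conv)?)
    fix n :: nat and c assume n: "n \<ge> 1" and p: "profile (\<lambda>k. (real k + 1) powr (-2)) n c"
    define H :: real where "H = harm (Suc n)"
    have H0: "H \<ge> 0" unfolding H_def by (rule harm_nonneg)
    note norms = inverse_square_profile_norms[OF p, folded H_def]
    have W: "radial_weight n c = sqrt H * sqrt H" using norms(1) H0 by simp
    have "ln 2 \<le> ln (real n + 1)" using n by (subst ln_le_cancel_iff) auto
    then have "1 \<le> ln (real n + 1) / ln 2" by (subst le_divide_eq_1) auto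
    moreover have "(1 + 1 / ln 2) * ln (real n + 1) = ln (real n + 1) + ln (real n + 1) / ln 2"
      by (simp add: distrib_right)
    ultimately have "H \<le> (1 + 1 / ln 2) * ln (real n + 1)"
      using harm_le_ln[of n] unfolding H_def by linarith
    then have b1: "sqrt H \<le> A * sqrt (ln (real n + 1))"
      unfolding A_def real_sqrt_mult[symmetric] by (rule real_sqrt_le_mono)
    have "ln (real n + 1) \<le> ln (real (Suc n) + 1)" by (subst ln_le_cancel_iff) auto
    also have "\<dots> \<le> H" unfolding H_def by (rule ln_le_harm)
    finally have b2: "sqrt (ln (real n + 1)) \<le> sqrt H" by (rule real_sqrt_le_mono)
    show "radial_weight n c \<le> A * (sqrt (ln (real n + 1)) *
        sqrt (\<Sum>\<^sub>\<infinity>x\<in>carrier G. (real (len x) + 1) powr (2 * (3/2)) * (cmod (rad n c x))\<^sup>2))"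
      using mult_right_mono[OF b1, of "sqrt H"] H0 unfolding norms(2) fst_conv snd_conv W by (simp add: mult.assoc)
    show "sqrt (ln (real n + 1)) *
        sqrt (\<Sum>\<^sub>\<infinity>x\<in>carrier G. (real (len x) + 1) powr (2 * (3/2)) * (cmod (rad n c x))\<^sup>2) \<le>
        1 * radial_weight n c"
      using mult_right_mono[OF b2, of "sqrt H"] H0 unfolding norms(2) fst_conv snd_conv W by simp
  qed (use A in auto)
  then have "comparable_on ?I (\<lambda>i. regular_norm G (rad (fst i) (snd i))) ?g"
    by (rule regular_norm_comparable[rotated]) (auto simp: profile_def)
  then show ?thesis by (rule comparable_on_cong) auto
qed

text \<open>Operator norm over weighted norm is at least a multiple of the square root of a harmonic
  number, and harmonic numbers are unbounded.\<close>

lemma weighted_inequality_fails: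
  assumes B: "B > 0"
  shows "\<exists>n c. regular_norm G (rad n c) >
    B * sqrt (\<Sum>\<^sub>\<infinity>x\<in>carrier G. (real (len x) + 1) powr (2 * (3/2)) * (cmod (rad n c x))\<^sup>2)"
proof -
  obtain E where E: "E > 0" "\<And>n c. (\<forall>k\<le>n. c k \<ge> 0) \<Longrightarrow> radial_weight n c \<le> E * regular_norm G (rad n c)"
    using radial_norm_comparable unfolding comparable_on_def dominated_on_def by fastforce
  have "eventually (\<lambda>n. (E * B)\<^sup>2 < (harm n :: real)) sequentially"
    using harm_at_top unfolding filterlim_at_top_dense by blast
  then obtain n where n: "(E * B)\<^sup>2 < (harm n :: real)" unfolding eventually_sequentially by blast
  define H :: real where "H = harm (Suc n)"
  have H: "(E * B)\<^sup>2 < H" using n harm_mono[of n "Suc n"] unfolding H_def by (meson less_le_trans le_SucI le_refl)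
  then have H0: "H > 0" by (meson le_less_trans zero_le_power2)
  have EB: "E * B < sqrt H" using H by (rule real_less_rsqrt)
  obtain c where p: "profile (\<lambda>k. (real k + 1) powr (-2)) n c"
    using profile_exists[of "\<lambda>k. (real k + 1) powr (-2)"] by auto
  note norms = inverse_square_profile_norms[OF p, folded H_def]
  have "E * (B * sqrt H) < sqrt H * sqrt H"
    using mult_strict_right_mono[OF EB, of "sqrt H"] H0 unfolding mult.assoc by simp
  also have "\<dots> = radial_weight n c" using norms(1) H0 by simp
  also have "\<dots> \<le> E * regular_norm G (rad n c)" using p by (intro E(2)) (auto simp: profile_def)
  finally have "B * sqrt H < regular_norm G (rad n c)" using E(1) by simp
  then show ?thesis unfolding norms(2)[symmetric] by blast
qed

lemma rad_in_group_algebra: "rad n c \<in> group_algebra_on G (Ball n)"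
proof -
  have "{x. rad n c x \<noteq> 0} \<subseteq> Ball n" by (auto simp: rad_eq)
  then show ?thesis
    unfolding group_algebra_on_def using finite_Ball[of n] finite_subset by (auto simp: Ball_def)
qed

end

text \<open>What remains is to recognise all elements as instances of \<open>rad\<close>. Sharpness
  of the weighted inequality is expressed by its failure for the exponent \<open>3/2\<close>
  itself.\<close>

theorem mainTheorem2:
  fixes G :: "('a, 'b) monoid_scheme" and S :: "'a set"
  assumes "hyperbolic_group G"
    and "\<not> elementary_group G"
    and "finite_symmetric_generating_set G S"
  shows
    "(comparable_on (UNIV :: nat set)
       (\<lambda>n. regular_norm G (sph G S n))
       (\<lambda>n. (real n + 1) * l2_norm G (sph G S n))) \<and>
     (factor_attained G (word_sphere G S) (\<lambda>n. real n + 1) (\<lambda>n. {sph G S n})) \<and>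
     (comparable_on (UNIV :: nat set)
       (\<lambda>n. regular_norm G (ball_element G S n))
       (\<lambda>n. (real n + 1) * l2_norm G (ball_element G S n))) \<and>
     (comparable_on {(n, c). radial_profile G S (\<lambda>k. real k + 1) n c}
       (\<lambda>(n, c). regular_norm G (radial G S n c))
       (\<lambda>(n, c). (real n + 1) powr (3/2) * l2_norm G (radial G S n c))) \<and>
     (factor_attained G (word_ball G S) (\<lambda>n. (real n + 1) powr (3/2))
       (\<lambda>n. {radial G S n c | c. radial_profile G S (\<lambda>k. real k + 1) n c})) \<and>
     (comparable_on {(n, c). n \<ge> 1 \<and> radial_profile G S (\<lambda>k. (real k + 1) powr (-2)) n c}
       (\<lambda>(n, c). regular_norm G (radial G S n c))
       (\<lambda>(n, c). sqrt (ln (real n + 1)) * weighted_l2_norm G S (3/2) (radial G S n c))) \<and>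
     (\<not> dominated_on (group_algebra G)
         (\<lambda>a. regular_norm G a) (\<lambda>a. weighted_l2_norm G S (3/2) a))"
proof -
  have "group G" using assms(1) unfolding hyperbolic_group_def by blast
  then obtain \<Delta> R C where "spreading_group G (word_length G S) \<Delta> R C"
    using group.spreading_group_word_length[OF _ assms] by blast
  then interpret spreading_group G "word_length G S" \<Delta> R C .
  have Sph: "word_sphere G S = Sphere" and Bal: "word_ball G S = Ball"
    unfolding word_sphere_def Sphere_def word_ball_def Ball_def by auto
  have radial: "radial G S = rad" unfolding radial_def rad_def sph_def Sph by auto
  have sph: "sph G S n = rad n (\<lambda>k. if k = n then 1 else 0)" for n
    unfolding sph_def Sph by (auto simp: rad_eq Sphere_def Ball_def indicator_def)
  have ball: "ball_element G S n = rad n (\<lambda>k. 1)" for n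
    unfolding ball_element_def rad_def sph_def Sph by simp
  have prof: "radial_profile G S h n c \<longleftrightarrow> profile h n c" for h n c
  proof -
    have "l2_norm G (\<lambda>x. complex_of_real (c k) * sph G S k x) = \<bar>c k\<bar> * sqrt (card (Sphere k))" for k
      unfolding l2_norm_scale sph l2_norm_sphere by simp
    then show ?thesis unfolding radial_profile_def profile_def by (metis abs_of_nonneg)
  qed
  have weighted: "weighted_l2_norm G S (3/2) f =
      sqrt (\<Sum>\<^sub>\<infinity>x\<in>carrier G. (real (word_length G S x) + 1) powr (2 * (3/2)) * (cmod (f x))\<^sup>2)" for f
    unfolding weighted_l2_norm_def ..
  have "factor_attained G (word_sphere G S) (\<lambda>n. real n + 1) (\<lambda>n. {sph G S n})"
  proof -
    obtain B where "B > 0" "\<And>n. (real n + 1) * l2_norm G (sph G S n) \<le> B * regular_norm G (sph G S n)"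
      using sphere_comparable unfolding comparable_on_def dominated_on_def sph by auto
    moreover have "sph G S n \<in> group_algebra_on G (word_sphere G S n)" for n
      unfolding group_algebra_on_def sph_def Sph by (auto simp: Sphere_def indicator_def finite_Sphere[unfolded Sphere_def])
    moreover have "l2_norm G (sph G S n) > 0" for n
      unfolding sph l2_norm_sphere using Sphere_nonempty[OF infinite_carrier, of n] by simp
    ultimately show ?thesis unfolding factor_attained_def by blast
  qed
  moreover have "factor_attained G (word_ball G S) (\<lambda>n. (real n + 1) powr (3/2))
       (\<lambda>n. {radial G S n c | c. radial_profile G S (\<lambda>k. real k + 1) n c})"
  proof -
    obtain B where B: "B > 0" "\<And>n c. profile (\<lambda>k. real k + 1) n c \<Longrightarrow>
        (real n + 1) powr (3/2) * l2_norm G (rad n c) \<le> B * regular_norm G (rad n c)"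
      using linear_profile_comparable unfolding comparable_on_def dominated_on_def by fastforce
    have "\<exists>b\<in>{rad n c | c. profile (\<lambda>k. real k + 1) n c}. b \<in> group_algebra_on G (Ball n) \<and>
        l2_norm G b > 0 \<and> (real n + 1) powr (3/2) * l2_norm G b \<le> B * regular_norm G b" for n
    proof -
      obtain c where p: "profile (\<lambda>k. real k + 1) n c" using profile_exists[of "\<lambda>k. real k + 1"] by auto
      have "(\<Sum>k\<le>n. (real k + 1)\<^sup>2) > 0" by (intro sum_pos) auto
      then have "l2_norm G (rad n c) > 0" unfolding profile_norms(2)[OF p] by simp
      then show ?thesis using p B(2)[OF p] rad_in_group_algebra by blast
    qed
    then show ?thesis unfolding factor_attained_def radial prof Bal using B(1) by blast
  qed
  moreover have "\<not> dominated_on (group_algebra G) (\<lambda>a. regular_norm G a) (\<lambda>a. weighted_l2_norm G S (3/2) a)"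
  proof
    assume "dominated_on (group_algebra G) (\<lambda>a. regular_norm G a) (\<lambda>a. weighted_l2_norm G S (3/2) a)"
    then obtain B where B: "B > 0" "\<And>a. a \<in> group_algebra G \<Longrightarrow> regular_norm G a \<le> B * weighted_l2_norm G S (3/2) a"
      unfolding dominated_on_def by blast
    obtain n c where "regular_norm G (rad n c) > B * weighted_l2_norm G S (3/2) (rad n c)"
      using weighted_inequality_fails[OF B(1)] unfolding weighted by blast
    moreover have "rad n c \<in> group_algebra G"
      using rad_in_group_algebra[of n c] unfolding group_algebra_on_def by auto
    ultimately show False using B(2) by (meson not_le)
  qed
  ultimately show ?thesis
    using sphere_comparable ball_comparable linear_profile_comparable inverse_square_profile_comparable
    unfolding radial prof weighted sph ball by blast
qed

end
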